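(* Let $n\ge 1$, let $J_1,\dotsc,J_m$ be nonempty subintervals of $[n]=\{1,\dotsc,n\}$, and let $G=G_{J_1}\circ\cdots\circ G_{J_m}$ be the corresponding star network. Then for every partition $\lambda\vdash n$ we have $$\epsilon_q^\lambda\bigl(\widetilde C_{s_{J_1}}(q)\cdots \widetilde C_{s_{J_m}}(q)\bigr)=\sum_{\pi} q^{\mathrm{cr}(\pi)/2}\sum_{W} q^{\mathrm{invnc}(W)},$$ where the outer sum is over all path families $\pi$ of type $e$ (the identity permutation) which cover $G$, and the inner sum is over all column-strict $\pi$-tableaux $W$ of shape $\lambda^{\top}$ (the conjugate partition of $\lambda$).
   Context: Hecke algebra. $H_n(q)$ is the algebra over $\mathbb Z[q^{1/2},q^{-1/2}]$ with unit $T_e$ generated by $T_{s_1},\dotsc,T_{s_{n-1}}$ ($s_i$ the adjacent transpositions in the symmetric group $\mathfrak S_n$) with relations $T_{s_i}^2=(q-1)T_{s_i}+qT_e$, $T_{s_i}T_{s_j}T_{s_i}=T_{s_j}T_{s_i}T_{s_j}$ if $|i-j|=1$, $T_{s_i}T_{s_j}=T_{s_j}T_{s_i}$ if $|i-j|\ge 2$; it has natural basis $\{T_w\mid w\in\mathfrak S_n\}$. For an interval $J=[a,b]\subseteq[n]$, $\mathfrak S_J$ is the subgroup of $\mathfrak S_n$ generated by $s_a,\dotsc,s_{b-1}$ (trivial if $a=b$), $s_J$ is its longest element, and $\widetilde C_{s_J}(q)=\sum_{w\in\mathfrak S_J}T_w$ (this is the modified signless Kazhdan-Lusztig basis element $q^{\ell(s_J)/2}C'_{s_J}(q)$).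 Induced sign characters. For $\lambda=(\lambda_1,\dotsc,\lambda_r)\vdash n$, $H_\lambda(q)$ is the subalgebra of $H_n(q)$ generated by the $T_{s_i}$ with $i\in\{1,\dotsc,n-1\}\setminus\{\lambda_1,\lambda_1+\lambda_2,\dotsc,n-\lambda_r\}$. The sign character is given by $\mathrm{sgn}(T_{s_i})=-1$, and $\epsilon_q^\lambda$ is the character of $H_n(q)$ induced from $\mathrm{sgn}$ on $H_\lambda(q)$. Star networks. For $1\le a<b\le n$, $G_{[a,b]}$ is the planar directed graph with a column of sources $1,\dotsc,n$ on the left (bottom to top), a column of sinks $1,\dotsc,n$ on the right (bottom to top), one interior (central) vertex, an edge from source $i$ to sink $i$ for $i<a$ and for $i>b$, and, for $a\le i\le b$, an edge from source $i$ to the interior vertex and an edge from the interior vertex to sink $i$. $G_{[a,a]}$ has just the $n$ edges from source $i$ to sink $i$ (no interior vertex). $G\circ H$ is the concatenation identifying sink $i$ of $G$ with source $i$ of $H$. A star network is a concatenation $G=G_{J_1}\circ\cdots\circ G_{J_m}$. Path families. A path family of type $w=w_1\cdots w_n\in\mathfrak S_n$ in $G$ is a sequence $\pi=(\pi_1,\dotsc,\pi_n)$ with $\pi_i$ a directed path from source $i$ to sink $w_i$. It covers $G$ if every edge of $G$ is contained in exactly one path, exactly once. If two distinct paths $\pi_i,\pi_j$ both pass through the central vertex of $G_{J_p}$, the triple $(\pi_i,\pi_j,p)=(\pi_j,\pi_i,p)$ is a crossing if the path which enters that vertex below the other leaves it above the other, and a noncrossing otherwise. $\mathrm{cr}(\pi)$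 is the number of crossings of $\pi$. Tableaux. For $\pi$ covering $G$, a $\pi$-tableau of shape $\mu\vdash n$ is a filling of the (French) Young diagram of $\mu$ (rows of lengths $\mu_1\ge\mu_2\ge\cdots$ from bottom to top, left-justified) by the paths $\pi_1,\dotsc,\pi_n$, each used exactly once. It is column-strict if, whenever $\pi_i$ lies below $\pi_j$ in the same column of the tableau, the path $\pi_i$ lies entirely below the path $\pi_j$ in $G$ (so $i<j$ and the two paths have no common vertex). A noncrossing $(\pi_i,\pi_j,p)$, with $\pi_i$ entering and leaving the central vertex of $G_{J_p}$ below $\pi_j$, is an inverted noncrossing of a $\pi$-tableau $U$ if $\pi_j$ appears in a strictly earlier (further left) column of $U$ than $\pi_i$. $\mathrm{invnc}(U)$ is the number of inverted noncrossings of $U$. *)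

theory Defs
  imports
    "HOL-Library.Poly_Mapping"
    "HOL-Combinatorics.Transposition"
    "HOL-Algebra.QuotRing"
    "HOL-Algebra.Generated_Rings"
    "HOL-Algebra.Sym_Groups"
    "HOL-Algebra.Module"
    "Graph_Theory.Pair_Digraph"
begin

section \<open>Ground ring\<close>

text \<open>Laurent polynomials over the integers in one variable \<open>q_half\<close>, which plays the role of
  \<open>q\<^sup>1\<^sup>/\<^sup>2\<close>; the exponent of a monomial is counted in powers of \<open>q_half\<close>.\<close>

type_synonym laurent = "int \<Rightarrow>\<^sub>0 int"

definition q_half :: laurent where
  "q_half = Poly_Mapping.single 1 1"

definition q_var :: laurent where
  "q_var = q_half ^ 2"

definition laurent_ring :: "laurent ring" where
  "laurent_ring =
     \<lparr>carrier = UNIV, monoid.mult = (*), monoid.one = 1, ring.zero = 0, ring.add = (+)\<rparr>"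


section \<open>The Hecke algebra by generators and relations\<close>

text \<open>Words in the generator indices form the free monoid, written additively here because the
  convolution product of \<^theory>\<open>HOL-Library.Poly_Mapping\<close> adds exponents.  Hence
  \<open>gword \<Rightarrow>\<^sub>0 laurent\<close> is the free associative algebra.\<close>

datatype gword = GWord (letters: "nat list")

instantiation gword :: monoid_add
begin

definition zero_gword :: gword where
  "0 = GWord []"

definition plus_gword :: "gword \<Rightarrow> gword \<Rightarrow> gword" where
  "u + v = GWord (letters u @ letters v)"

instance
  by standard (simp_all add: zero_gword_def plus_gword_def)

end

type_synonym free_elem = "gword \<Rightarrow>\<^sub>0 laurent"

definition free_algebra :: "nat \<Rightarrow> free_elem ring" where
  "free_algebra n =
     \<lparr>carrier = {f. \<forall>u \<in> Poly_Mapping.keys f. set (letters u) \<subseteq> {1..<n}},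
      monoid.mult = (*), monoid.one = 1, ring.zero = 0, ring.add = (+)\<rparr>"

definition free_scalar :: "laurent \<Rightarrow> free_elem" where
  "free_scalar c = Poly_Mapping.single 0 c"

definition free_gen :: "nat \<Rightarrow> free_elem" where
  "free_gen i = Poly_Mapping.single (GWord [i]) 1"

definition hecke_relators :: "nat \<Rightarrow> free_elem set" where
  "hecke_relators n =
     {free_gen i * free_gen i - (free_scalar (q_var - 1) * free_gen i + free_scalar q_var) | i.
        i \<in> {1..<n}}
   \<union> {free_gen i * free_gen j * free_gen i - free_gen j * free_gen i * free_gen j | i j.
        i \<in> {1..<n} \<and> j \<in> {1..<n} \<and> \<bar>int i - int j\<bar> = 1}
   \<union> {free_gen i * free_gen j - free_gen j * free_gen i | i j.
        i \<in> {1..<n} \<and> j \<in> {1..<n} \<and> \<bar>int i - int j\<bar> \<ge> 2}"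

definition hecke_ideal :: "nat \<Rightarrow> free_elem set" where
  "hecke_ideal n = Idl\<^bsub>free_algebra n\<^esub> (hecke_relators n)"

definition hecke :: "nat \<Rightarrow> free_elem set ring" where
  "hecke n = free_algebra n Quot hecke_ideal n"

text \<open>The structure map of the algebra, sending \<open>c\<close> to \<open>c\<close> times the unit.\<close>

definition hecke_scalar :: "nat \<Rightarrow> laurent \<Rightarrow> free_elem set" where
  "hecke_scalar n c = hecke_ideal n +>\<^bsub>free_algebra n\<^esub> free_scalar c"

definition hecke_gen :: "nat \<Rightarrow> nat \<Rightarrow> free_elem set" where
  "hecke_gen n i = hecke_ideal n +>\<^bsub>free_algebra n\<^esub> free_gen i"


section \<open>The natural basis and the elements attached to intervals\<close>

definition adj_transp :: "nat \<Rightarrow> nat \<Rightarrow> nat" where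
  "adj_transp i = transpose i (Suc i)"

definition word_perm :: "nat list \<Rightarrow> nat \<Rightarrow> nat" where
  "word_perm us = foldr (\<lambda>i f. adj_transp i \<circ> f) us id"

text \<open>Some reduced expression of \<open>w\<close>.  By Matsumoto's theorem the product in \<open>hecke_T\<close> does not
  depend on which one is chosen.\<close>

definition reduced_word :: "nat \<Rightarrow> (nat \<Rightarrow> nat) \<Rightarrow> nat list" where
  "reduced_word n w = arg_min length (\<lambda>us. set us \<subseteq> {1..<n} \<and> word_perm us = w)"

definition hecke_T :: "nat \<Rightarrow> (nat \<Rightarrow> nat) \<Rightarrow> free_elem set" where
  "hecke_T n w = foldr (\<lambda>i x. hecke_gen n i \<otimes>\<^bsub>hecke n\<^esub> x) (reduced_word n w) \<one>\<^bsub>hecke n\<^esub>"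

text \<open>An interval \<open>[a,b]\<close> is represented by the pair \<open>(a,b)\<close>.\<close>

definition interval_subgroup :: "nat \<Rightarrow> nat \<times> nat \<Rightarrow> (nat \<Rightarrow> nat) set" where
  "interval_subgroup n J = generate (sym_group n) (adj_transp ` {fst J..<snd J})"

definition C_tilde :: "nat \<Rightarrow> nat \<times> nat \<Rightarrow> free_elem set" where
  "C_tilde n J = finsum (hecke n) (hecke_T n) (interval_subgroup n J)"

definition hecke_prod :: "nat \<Rightarrow> free_elem set list \<Rightarrow> free_elem set" where
  "hecke_prod n xs = foldr (\<lambda>x y. x \<otimes>\<^bsub>hecke n\<^esub> y) xs \<one>\<^bsub>hecke n\<^esub>"


section \<open>Characters of modules and induction\<close>

definition module_basis ::
  "('r, 'm) ring_scheme \<Rightarrow> ('r, 'v, 'k) module_scheme \<Rightarrow> 'v set \<Rightarrow> bool" where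
  "module_basis R M B \<longleftrightarrow>
     finite B \<and> B \<subseteq> carrier M \<and>
     (\<forall>x \<in> carrier M. \<exists>!c. c \<in> (\<Pi>\<^sub>E b\<in>B. carrier R) \<and> x = (\<Oplus>\<^bsub>M\<^esub>b\<in>B. c b \<odot>\<^bsub>M\<^esub> b))"

text \<open>Trace of an endomorphism of a free module of finite rank over a commutative ring: the sum of
  the diagonal entries of its matrix \<open>C\<close> with respect to any basis.\<close>

definition module_trace ::
  "('r, 'm) ring_scheme \<Rightarrow> ('r, 'v, 'k) module_scheme \<Rightarrow> ('v \<Rightarrow> 'v) \<Rightarrow> 'r" where
  "module_trace R M f =
     (THE t. \<exists>B C. module_basis R M B
        \<and> (\<forall>a\<in>B. \<forall>b\<in>B. C a b \<in> carrier R)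
        \<and> (\<forall>b\<in>B. f b = (\<Oplus>\<^bsub>M\<^esub>a\<in>B. C a b \<odot>\<^bsub>M\<^esub> a))
        \<and> t = (\<Oplus>\<^bsub>R\<^esub>b\<in>B. C b b))"

text \<open>Let \<open>H\<close> be an algebra over \<open>R\<close> with structure map \<open>\<eta>\<close>, \<open>S\<close> a subalgebra of \<open>H\<close> and
  \<open>\<phi>\<close> an algebra homomorphism from \<open>S\<close> to \<open>R\<close>.  The module induced from the
  one-dimensional \<open>S\<close>-module afforded by \<open>\<phi>\<close> is the tensor product over \<open>S\<close> of \<open>H\<close> with that
  module.  Every tensor is of the form \<open>h \<otimes> 1\<close>, so it is the quotient of \<open>H\<close> by the
  relations \<open>h b \<otimes> 1 = h \<otimes> \<phi>(b)\<close>, on which \<open>H\<close> acts from the left.  The fields \<open>mult\<close> and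
  \<open>one\<close> of the module record carry no meaning.\<close>

definition induced_relations ::
  "('h, 'm) ring_scheme \<Rightarrow> ('r \<Rightarrow> 'h) \<Rightarrow> 'h set \<Rightarrow> ('h \<Rightarrow> 'r) \<Rightarrow> 'h set" where
  "induced_relations H \<eta> S \<phi> =
     generate (add_monoid H)
       {(h \<otimes>\<^bsub>H\<^esub> b) \<ominus>\<^bsub>H\<^esub> (h \<otimes>\<^bsub>H\<^esub> \<eta> (\<phi> b)) | h b. h \<in> carrier H \<and> b \<in> S}"

text \<open>Left multiplication by \<open>h\<close> on cosets modulo the left ideal \<open>L\<close>; the union is the single
  coset of \<open>h x\<close>.\<close>

definition left_action :: "('h, 'm) ring_scheme \<Rightarrow> 'h set \<Rightarrow> 'h \<Rightarrow> 'h set \<Rightarrow> 'h set" where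
  "left_action H L h X = (\<Union>x\<in>X. L +>\<^bsub>H\<^esub> (h \<otimes>\<^bsub>H\<^esub> x))"

definition induced_module ::
  "('h, 'm) ring_scheme \<Rightarrow> ('r \<Rightarrow> 'h) \<Rightarrow> 'h set \<Rightarrow> ('h \<Rightarrow> 'r) \<Rightarrow> ('r, 'h set) module" where
  "induced_module H \<eta> S \<phi> =
     (let L = induced_relations H \<eta> S \<phi> in
      \<lparr>carrier = a_rcosets\<^bsub>H\<^esub> L, monoid.mult = undefined, monoid.one = undefined,
       ring.zero = L, ring.add = set_add H, module.smult = (\<lambda>c. left_action H L (\<eta> c))\<rparr>)"

definition induced_character ::
  "('r, 'k) ring_scheme \<Rightarrow> ('h, 'm) ring_scheme \<Rightarrow> ('r \<Rightarrow> 'h) \<Rightarrow> 'h set \<Rightarrow> ('h \<Rightarrow> 'r) \<Rightarrow> 'h \<Rightarrow> 'r"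
  where
  "induced_character R H \<eta> S \<phi> h =
     module_trace R (induced_module H \<eta> S \<phi>) (left_action H (induced_relations H \<eta> S \<phi>) h)"

text \<open>The sign character, determined on the carrier by these conditions.\<close>

definition hecke_sgn :: "nat \<Rightarrow> free_elem set \<Rightarrow> laurent" where
  "hecke_sgn n = (SOME \<phi>. \<phi> \<in> ring_hom (hecke n) laurent_ring
     \<and> (\<forall>c. \<phi> (hecke_scalar n c) = c) \<and> (\<forall>i\<in>{1..<n}. \<phi> (hecke_gen n i) = - 1))"

definition hecke_sub :: "nat \<Rightarrow> nat list \<Rightarrow> free_elem set set" where
  "hecke_sub n lam = generate_ring (hecke n)
     (range (hecke_scalar n) \<union>
      hecke_gen n ` ({1..<n} - {sum_list (take k lam) | k. 1 \<le> k \<and> k < length lam}))"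

definition induced_sign_character :: "nat \<Rightarrow> nat list \<Rightarrow> free_elem set \<Rightarrow> laurent" where
  "induced_sign_character n lam =
     induced_character laurent_ring (hecke n) (hecke_scalar n) (hecke_sub n lam) (hecke_sgn n)"


section \<open>Partitions\<close>

definition is_partition :: "nat list \<Rightarrow> nat \<Rightarrow> bool" where
  "is_partition lam n \<longleftrightarrow> sorted_wrt (\<ge>) lam \<and> 0 \<notin> set lam \<and> sum_list lam = n"

definition conjugate :: "nat list \<Rightarrow> nat list" where
  "conjugate lam = map (\<lambda>c. length (filter (\<lambda>x. c < x) lam)) [0..<foldr max lam 0]"


section \<open>Star networks and path families\<close>

text \<open>The factors of a concatenation are numbered from \<open>0\<close>.  \<open>Bnd p i\<close> is the \<open>i\<close>-th source of
  factor \<open>p\<close>, identified with the \<open>i\<close>-th sink of factor \<open>p - 1\<close>; \<open>Ctr p\<close> is the central vertex of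
  factor \<open>p\<close>.\<close>

datatype vertex = Bnd nat nat | Ctr nat

type_synonym arc = "vertex \<times> vertex"

definition star_network :: "nat \<Rightarrow> nat \<Rightarrow> nat \<times> nat \<Rightarrow> vertex pair_pre_digraph" where
  "star_network n p J =
     (let I = (if fst J < snd J then {fst J..snd J} else {}) in
      \<lparr>pverts = Bnd p ` {1..n} \<union> Bnd (Suc p) ` {1..n} \<union> (if I = {} then {} else {Ctr p}),
       parcs = {(Bnd p i, Bnd (Suc p) i) | i. i \<in> {1..n} - I}
             \<union> {(Bnd p i, Ctr p) | i. i \<in> I} \<union> {(Ctr p, Bnd (Suc p) i) | i. i \<in> I}\<rparr>)"

text \<open>The vertices \<open>Bnd 0 i\<close> are listed separately only for the sake of the empty concatenation,
  which consists of \<open>n\<close> isolated vertices.\<close>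

definition network :: "nat \<Rightarrow> (nat \<times> nat) list \<Rightarrow> vertex pair_pre_digraph" where
  "network n Js =
     \<lparr>pverts = Bnd 0 ` {1..n} \<union> (\<Union>p<length Js. pverts (star_network n p (Js ! p))),
      parcs = (\<Union>p<length Js. parcs (star_network n p (Js ! p)))\<rparr>"

text \<open>A path is given by its list of arcs.\<close>

definition path_families ::
  "nat \<Rightarrow> (nat \<times> nat) list \<Rightarrow> (nat \<Rightarrow> nat) \<Rightarrow> (nat \<Rightarrow> arc list) set" where
  "path_families n Js w = (\<Pi>\<^sub>E i\<in>{1..n}.
     {p. pre_digraph.apath (with_proj (network n Js)) (Bnd 0 i) p (Bnd (length Js) (w i))})"

definition covers :: "nat \<Rightarrow> (nat \<times> nat) list \<Rightarrow> (nat \<Rightarrow> arc list) \<Rightarrow> bool" where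
  "covers n Js \<pi> \<longleftrightarrow>
     (\<forall>e \<in> parcs (network n Js). (\<Sum>i\<in>{1..n}. count_list (\<pi> i) e) = 1)"

definition path_vertices :: "(nat \<Rightarrow> arc list) \<Rightarrow> nat \<Rightarrow> vertex set" where
  "path_vertices \<pi> i = set (pawalk_verts (Bnd 0 i) (\<pi> i))"

text \<open>Path \<open>i\<close> enters the central vertex of factor \<open>p\<close> below path \<open>j\<close>, respectively leaves it below
  path \<open>j\<close>.\<close>

definition enters_below :: "(nat \<Rightarrow> arc list) \<Rightarrow> nat \<Rightarrow> nat \<Rightarrow> nat \<Rightarrow> bool" where
  "enters_below \<pi> p i j \<longleftrightarrow>
     (\<exists>h k. (Bnd p h, Ctr p) \<in> set (\<pi> i) \<and> (Bnd p k, Ctr p) \<in> set (\<pi> j) \<and> h < k)"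

definition leaves_below :: "(nat \<Rightarrow> arc list) \<Rightarrow> nat \<Rightarrow> nat \<Rightarrow> nat \<Rightarrow> bool" where
  "leaves_below \<pi> p i j \<longleftrightarrow>
     (\<exists>h k. (Ctr p, Bnd (Suc p) h) \<in> set (\<pi> i) \<and> (Ctr p, Bnd (Suc p) k) \<in> set (\<pi> j) \<and> h < k)"

text \<open>Crossings and noncrossings are unordered in the two paths; each is represented by the unique
  triple in which the path entering below comes first.\<close>

definition crossings ::
  "nat \<Rightarrow> (nat \<times> nat) list \<Rightarrow> (nat \<Rightarrow> arc list) \<Rightarrow> (nat \<times> nat \<times> nat) set" where
  "crossings n Js \<pi> =
     {(i, j, p). i \<in> {1..n} \<and> j \<in> {1..n} \<and> p < length Js \<and>
        enters_below \<pi> p i j \<and> leaves_below \<pi> p j i}"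

definition noncrossings ::
  "nat \<Rightarrow> (nat \<times> nat) list \<Rightarrow> (nat \<Rightarrow> arc list) \<Rightarrow> (nat \<times> nat \<times> nat) set" where
  "noncrossings n Js \<pi> =
     {(i, j, p). i \<in> {1..n} \<and> j \<in> {1..n} \<and> p < length Js \<and>
        enters_below \<pi> p i j \<and> leaves_below \<pi> p i j}"

definition cr :: "nat \<Rightarrow> (nat \<times> nat) list \<Rightarrow> (nat \<Rightarrow> arc list) \<Rightarrow> nat" where
  "cr n Js \<pi> = card (crossings n Js \<pi>)"


section \<open>Tableaux\<close>

text \<open>Cell \<open>(r, c)\<close> lies in row \<open>r\<close>, counted from the bottom, and column \<open>c\<close>, counted from the
  left, both starting at \<open>0\<close>.  An entry \<open>i\<close> of a tableau stands for the path \<open>\<pi> i\<close>.\<close>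

definition diagram :: "nat list \<Rightarrow> (nat \<times> nat) set" where
  "diagram mu = {(r, c). r < length mu \<and> c < mu ! r}"

definition tableaux :: "nat \<Rightarrow> nat list \<Rightarrow> (nat \<times> nat \<Rightarrow> nat) set" where
  "tableaux n mu = {U \<in> (\<Pi>\<^sub>E x\<in>diagram mu. {1..n}). bij_betw U (diagram mu) {1..n}}"

definition entirely_below :: "(nat \<Rightarrow> arc list) \<Rightarrow> nat \<Rightarrow> nat \<Rightarrow> bool" where
  "entirely_below \<pi> i j \<longleftrightarrow>
     path_vertices \<pi> i \<inter> path_vertices \<pi> j = {} \<and>
     (\<forall>p h k. Bnd p h \<in> path_vertices \<pi> i \<longrightarrow> Bnd p k \<in> path_vertices \<pi> j \<longrightarrow> h < k)"

definition column_strict_tableaux ::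
  "nat \<Rightarrow> (nat \<Rightarrow> arc list) \<Rightarrow> nat list \<Rightarrow> (nat \<times> nat \<Rightarrow> nat) set" where
  "column_strict_tableaux n \<pi> mu = {U \<in> tableaux n mu.
     \<forall>r s c. (r, c) \<in> diagram mu \<longrightarrow> (s, c) \<in> diagram mu \<longrightarrow> r < s \<longrightarrow>
       entirely_below \<pi> (U (r, c)) (U (s, c))}"

definition in_column :: "nat list \<Rightarrow> (nat \<times> nat \<Rightarrow> nat) \<Rightarrow> nat \<Rightarrow> nat \<Rightarrow> bool" where
  "in_column mu U i c \<longleftrightarrow> (\<exists>r. (r, c) \<in> diagram mu \<and> U (r, c) = i)"

definition invnc ::
  "nat \<Rightarrow> (nat \<times> nat) list \<Rightarrow> (nat \<Rightarrow> arc list) \<Rightarrow> nat list \<Rightarrow> (nat \<times> nat \<Rightarrow> nat) \<Rightarrow> nat" where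
  "invnc n Js \<pi> mu U =
     card {(i, j, p) \<in> noncrossings n Js \<pi>.
       \<exists>c d. in_column mu U j c \<and> in_column mu U i d \<and> c < d}"

end

theory Submission
  imports Defs
begin

text \<open>The induced module has a basis indexed by the words \<open>w\<close> in which the letter \<open>k\<close> occurs
  \<open>lam ! k\<close> times; up to scaling, \<open>T\<^sub>i\<close> negates \<open>w\<close> if its letters in positions \<open>i\<close> and \<open>i + 1\<close> are
  equal and exchanges these letters otherwise.  Because \<open>T\<^sub>i C\<^sub>J = q C\<^sub>J\<close> for the generators \<open>T\<^sub>i\<close> of
  \<open>J\<close>, the matrix of \<open>C\<^sub>J\<close> has entry \<open>q\<^sup>1\<^sup>/\<^sup>2\<close> to the power \<open>inv\<^sub>J w + inv\<^sub>J w'\<close> at \<open>(w, w')\<close> when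
  \<open>w'\<close> rearranges \<open>w\<close> inside \<open>J\<close> and the letters there are distinct, and \<open>0\<close> otherwise.

  The trace of the product is therefore a sum over closed sequences of words.  Following the letters
  through such a sequence traces a covering path family together with a labelling of its paths by
  columns.  Paths with equal labels never meet, so they keep their order; this forces the type to be
  the identity and makes each column, sorted increasingly, strict.  A pair of paths meeting in a
  central vertex contributes \<open>q\<^sup>1\<^sup>/\<^sup>2\<close> once for entering and once for leaving with inverted labels: a
  crossing contributes exactly one factor, a noncrossing both or none.\<close>

section \<open>Inversions and reduced words\<close>

text \<open>The Hecke algebra is given only as a quotient of a free algebra, and
  \<open>hecke_T n w\<close> hangs on one arbitrary reduced word, so neither a basis nor freeness of
  the induced module is at hand. One explicit representation on words supplies both. Checking the
  relators on it gives an action of the quotient; the generators of the parabolic subalgebra act by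
  -1 on the sorted word \<open>v0\<close>, so applying elements to \<open>v0\<close> factors through
  the induced module; and the elements \<open>fam f\<close>, which carry \<open>v0\<close> to the
  other words, show that this map is invertible. Sorting is thus needed twice, for operators under
  equality and for algebra elements modulo \<open>K\<close>, which is why it lives in the locale
  \<open>word_operators\<close>. The scaling of words makes each generator symmetric: on a word and
  its swap it has rows (0, q^(1/2)) and (q^(1/2), q - 1), of trace q - 1 and determinant -q. The
  relation T_i C_J = q C_J makes the rows of C_J at a word and its swap proportional, so all rows
  follow from those of increasing words, where a reduced word contributes a single term.\<close>

definition invs :: "nat \<Rightarrow> nat \<Rightarrow> (nat \<Rightarrow> nat) \<Rightarrow> (nat \<times> nat) set" where
  "invs a b f = {(i, j). a \<le> i \<and> i < j \<and> j \<le> b \<and> f j < f i}"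

definition inv_no :: "nat \<Rightarrow> nat \<Rightarrow> (nat \<Rightarrow> nat) \<Rightarrow> nat" where
  "inv_no a b f = card (invs a b f)"

lemma finite_invs [simp]: "finite (invs a b f)"
  by (rule finite_subset[of _ "{a..b} \<times> {a..b}"]) (auto simp: invs_def)

lemma adj_transp_simps [simp]:
  "adj_transp i i = Suc i" "adj_transp i (Suc i) = i"
  "j \<noteq> i \<Longrightarrow> j \<noteq> Suc i \<Longrightarrow> adj_transp i j = j"
  by (auto simp: adj_transp_def transpose_def)

lemma adj_transp_if: "adj_transp i j = (if j = i then Suc i else if j = Suc i then i else j)"
  by simp

lemma adj_transp_involutory [simp]: "adj_transp i (adj_transp i j) = j"
  by (simp add: adj_transp_def)

lemma comp_adj_transp_twice [simp]: "f \<circ> adj_transp i \<circ> adj_transp i = f"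
  by (auto simp: fun_eq_iff)

lemma adj_transp_permutes: "a \<le> i \<Longrightarrow> i < b \<Longrightarrow> adj_transp i permutes {a..b}"
  by (simp add: adj_transp_def permutes_swap_id)

lemma inv_adj_transp [simp]: "inv' (adj_transp i) = adj_transp i"
  by (simp add: adj_transp_def)

lemma adj_transp_commute:
  "Suc i < j \<or> Suc j < i \<Longrightarrow> adj_transp i \<circ> adj_transp j = adj_transp j \<circ> adj_transp i"
  by (auto simp: fun_eq_iff adj_transp_def transpose_def)

lemma adj_transp_braid:
  "adj_transp i \<circ> adj_transp (Suc i) \<circ> adj_transp i
   = adj_transp (Suc i) \<circ> adj_transp i \<circ> adj_transp (Suc i)"
  by (auto simp: fun_eq_iff adj_transp_def transpose_def)

text \<open>The swap of positions \<open>i\<close> and \<open>Suc i\<close> preserves the order of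
  every pair of positions except these two, so it matches up the remaining inversions. Words
  \<open>f\<close> with repeated letters are included.\<close>

lemma card_invs_swap:
  assumes "a \<le> i" "i < b"
  shows "card (invs a b (f \<circ> adj_transp i) - {(i, Suc i)}) = card (invs a b f - {(i, Suc i)})"
proof (rule bij_betw_same_card)
  let ?g = "map_prod (adj_transp i) (adj_transp i)"
  have *: "?g x \<in> invs a b h - {(i, Suc i)}"
    if "x \<in> invs a b (h \<circ> adj_transp i) - {(i, Suc i)}" for x h
  proof -
    obtain k l where x: "x = (k, l)" by fastforce
    have "a \<le> k" "k < l" "l \<le> b" "h (adj_transp i l) < h (adj_transp i k)" "\<not> (k = i \<and> l = Suc i)"
      using that by (auto simp: x invs_def)
    then have "a \<le> adj_transp i k" "adj_transp i k < adj_transp i l" "adj_transp i l \<le> b"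
      using assms by (auto simp: adj_transp_if)
    with \<open>h (adj_transp i l) < h (adj_transp i k)\<close> \<open>k < l\<close> show ?thesis
      by (auto simp: x invs_def adj_transp_if split: if_splits)
  qed
  have gg: "?g (?g x) = x" for x by (cases x) simp
  show "bij_betw ?g (invs a b (f \<circ> adj_transp i) - {(i, Suc i)}) (invs a b f - {(i, Suc i)})"
  proof (rule bij_betw_byWitness[where f' = ?g])
    show "?g ` (invs a b (f \<circ> adj_transp i) - {(i, Suc i)}) \<subseteq> invs a b f - {(i, Suc i)}"
      by (rule image_subsetI, rule *)
    show "?g ` (invs a b f - {(i, Suc i)}) \<subseteq> invs a b (f \<circ> adj_transp i) - {(i, Suc i)}"
      using *[of _ "f \<circ> adj_transp i"] by (simp add: image_subset_iff)
  qed (simp_all only: gg, simp_all)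
qed

lemma inv_no_asc:
  assumes "a \<le> i" "i < b" "f i < f (Suc i)"
  shows "inv_no a b (f \<circ> adj_transp i) = Suc (inv_no a b f)"
proof -
  have "(i, Suc i) \<notin> invs a b f" "(i, Suc i) \<in> invs a b (f \<circ> adj_transp i)"
    using assms by (auto simp: invs_def)
  then have "card (invs a b (f \<circ> adj_transp i)) = Suc (card (invs a b f - {(i, Suc i)}))"
    using card.remove[OF finite_invs, of "(i, Suc i)" a b "f \<circ> adj_transp i"]
    by (simp only: card_invs_swap[OF assms(1,2)])
  then show ?thesis
    using \<open>(i, Suc i) \<notin> invs a b f\<close> by (simp add: inv_no_def)
qed

lemma inv_no_desc:
  assumes "a \<le> i" "i < b" "f (Suc i) < f i"
  shows "inv_no a b f = Suc (inv_no a b (f \<circ> adj_transp i))"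
  using inv_no_asc[OF assms(1,2), of "f \<circ> adj_transp i"] assms(3) by simp

lemma comp_adj_transp_eq:
  assumes "f i = f (Suc i)"
  shows "f \<circ> adj_transp i = f"
  using assms by (auto simp: fun_eq_iff adj_transp_def transpose_def)

lemma inv_no_swap_le:
  assumes "a \<le> i" "i < b"
  shows "inv_no a b (f \<circ> adj_transp i) \<le> Suc (inv_no a b f)"
proof (cases "f i" "f (Suc i)" rule: linorder_cases)
  case less
  with inv_no_asc[OF assms, of f] show ?thesis by simp
next
  case equal
  then show ?thesis by (simp only: comp_adj_transp_eq)
next
  case greater
  with inv_no_desc[OF assms, of f] show ?thesis by simp
qed

lemma mono_on_interval:
  assumes "\<And>i. a \<le> i \<Longrightarrow> i < b \<Longrightarrow> f i \<le> f (Suc i)" "a \<le> i" "i \<le> j" "j \<le> b"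
  shows "f i \<le> (f j :: nat)"
proof -
  from \<open>i \<le> j\<close> have "j \<le> b \<longrightarrow> f i \<le> f j"
  proof (induction j rule: dec_induct)
    case (step k)
    then show ?case using assms(1)[of k] assms(2) by force
  qed simp
  then show ?thesis using assms by simp
qed

lemma strict_mono_on_interval:
  assumes "\<And>i. a \<le> i \<Longrightarrow> i < b \<Longrightarrow> f i < f (Suc i)" "a \<le> i" "i < j" "j \<le> b"
  shows "f i < (f j :: nat)"
proof -
  have "f (Suc i) \<le> f j"
    by (rule mono_on_interval[of a b f]) (use assms in \<open>auto intro: less_imp_le\<close>)
  with assms(1)[of i] assms(2-) show ?thesis by simp
qed

lemma inv_no_eq_0I:
  assumes "\<And>i. a \<le> i \<Longrightarrow> i < b \<Longrightarrow> f i \<le> f (Suc i)"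
  shows "inv_no a b f = 0"
proof -
  have "invs a b f = {}"
    using mono_on_interval[of a b f] assms by (force simp: invs_def not_less[symmetric])
  then show ?thesis by (simp add: inv_no_def)
qed

lemma inv_no_id [simp]: "inv_no a b id = 0"
  by (rule inv_no_eq_0I) simp

text \<open>Monotone and injective is strictly increasing. At a least moved point \<open>i\<close>
  the preimage of \<open>i\<close> lies to its right, so \<open>w i < i\<close> is already a fixed
  point, against injectivity.\<close>

lemma permutes_mono_on_imp_id:
  fixes w :: "nat \<Rightarrow> nat"
  assumes "w permutes {a..b}" "\<And>i. a \<le> i \<Longrightarrow> i < b \<Longrightarrow> w i \<le> w (Suc i)"
  shows "w = id"
proof -
  have mono: "w i < w j" if "a \<le> i" "i < j" "j \<le> b" for i j
  proof -
    have "w i \<le> w j" by (rule mono_on_interval[of a b]) (use assms(2) that in auto)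
    moreover have "w i \<noteq> w j" using permutes_inj[OF assms(1)] that by (auto dest: injD)
    ultimately show ?thesis by simp
  qed
  have "w i = i" for i
  proof (induction i rule: less_induct)
    case (less i)
    show ?case
    proof (rule ccontr)
      assume ne: "w i \<noteq> i"
      then have i: "i \<in> {a..b}" using assms(1) by (auto simp: permutes_def)
      obtain j where j: "w j = i" using permutes_surj[OF assms(1)] by (metis surjD)
      have "j \<noteq> i" "\<not> j < i" using less[of j] j ne by auto
      then have ij: "i < j" by simp
      have "j \<in> {a..b}" using permutes_not_in[OF assms(1), of j] j ij by fastforce
      then have "w i < i" using mono[of i j] ij i j by simp
      then have "w (w i) = w i" by (rule less)
      then have "w i = i" by (rule injD[OF permutes_inj[OF assms(1)]])
      then show False using ne by simp
    qed
  qed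
  then show ?thesis by auto
qed

section \<open>Products of adjacent transpositions and their length\<close>

lemma word_perm_simps [simp]:
  "word_perm [] = id" "word_perm (i # us) = adj_transp i \<circ> word_perm us"
  by (simp_all add: word_perm_def)

lemma word_perm_append: "word_perm (us @ vs) = word_perm us \<circ> word_perm vs"
  by (induction us) (auto simp: comp_assoc)

lemma word_perm_permutes: "set us \<subseteq> {a..<b} \<Longrightarrow> word_perm us permutes {a..b}"
  by (induction us) (auto intro!: permutes_compose permutes_id adj_transp_permutes[unfolded comp_def])

text \<open>One letter changes the number of inversions by at most one. For \<open>f = id\<close>
  this bounds word lengths from below; the case of equality later detects words all of whose letters
  create an inversion.\<close>

lemma inv_no_word_perm_le:
  "set us \<subseteq> {a..<b} \<Longrightarrow> inv_no a b (f \<circ> word_perm us) \<le> inv_no a b f + length us"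
proof (induction us arbitrary: f)
  case (Cons i us)
  have "inv_no a b (f \<circ> word_perm (i # us)) = inv_no a b ((f \<circ> adj_transp i) \<circ> word_perm us)"
    by (simp add: comp_assoc)
  also have "\<dots> \<le> inv_no a b (f \<circ> adj_transp i) + length us"
    by (rule Cons.IH) (use Cons.prems in simp)
  finally show ?case using inv_no_swap_le[of a i b f] Cons.prems by (auto simp del: o_apply)
qed simp

text \<open>Bubble sort: peeling off a descent on the right removes exactly one inversion, and a
  permutation without descents in the interval is \<open>id\<close>.\<close>

lemma ex_word_perm:
  assumes "w permutes {a..b}"
  shows "\<exists>us. set us \<subseteq> {a..<b} \<and> word_perm us = w \<and> length us = inv_no a b w"
  using assms
proof (induction "inv_no a b w" arbitrary: w rule: less_induct)
  case less
  show ?case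
  proof (cases "\<exists>i. a \<le> i \<and> i < b \<and> w (Suc i) < w i")
    case True
    then obtain i where i: "a \<le> i" "i < b" "w (Suc i) < w i" by auto
    have "w \<circ> adj_transp i permutes {a..b}"
      by (rule permutes_compose[OF adj_transp_permutes[OF i(1,2)] less(2)])
    then obtain us where us: "set us \<subseteq> {a..<b}" "word_perm us = w \<circ> adj_transp i"
       "length us = inv_no a b (w \<circ> adj_transp i)"
      using less(1)[of "w \<circ> adj_transp i"] inv_no_desc[of a i b w] i by auto
    then have "set (us @ [i]) \<subseteq> {a..<b} \<and> word_perm (us @ [i]) = w \<and> length (us @ [i]) = inv_no a b w"
      using i inv_no_desc[of a i b w] by (auto simp: word_perm_append)
    then show ?thesis by blast
  next
    case False
    then have "w = id" by (intro permutes_mono_on_imp_id[OF less(2)]) (auto simp: not_less)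
    then show ?thesis by (intro exI[of _ "[]"]) auto
  qed
qed

lemma reduced_word:
  assumes "w permutes {1..n}"
  shows "set (reduced_word n w) \<subseteq> {1..<n}" "word_perm (reduced_word n w) = w"
    "length (reduced_word n w) = inv_no 1 n w"
proof -
  let ?P = "\<lambda>us. set us \<subseteq> {1..<n} \<and> word_perm us = w"
  obtain vs where vs: "?P vs" "length vs = inv_no 1 n w"
    using ex_word_perm[OF assms] by auto
  have P: "?P (reduced_word n w)"
    unfolding reduced_word_def by (rule arg_min_natI[of ?P, OF vs(1)])
  then show "set (reduced_word n w) \<subseteq> {1..<n}" "word_perm (reduced_word n w) = w" by auto
  have "length (reduced_word n w) \<le> length vs"
    unfolding reduced_word_def by (rule arg_min_nat_le[of ?P, OF vs(1)])
  moreover have "inv_no 1 n w \<le> length (reduced_word n w)"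
    using inv_no_word_perm_le[of "reduced_word n w" 1 n id] P by simp
  ultimately show "length (reduced_word n w) = inv_no 1 n w" using vs(2) by simp
qed

lemma inv_no_inv:
  assumes "w permutes {a..b}"
  shows "inv_no a b (inv' w) = inv_no a b w"
  unfolding inv_no_def
proof (rule bij_betw_same_card)
  have *: "(v j, v i) \<in> invs a b (inv' v)" if "v permutes {a..b}" "(i, j) \<in> invs a b v" for v i j
  proof -
    have "v i \<in> {a..b}" "v j \<in> {a..b}"
      using that(2) by (simp_all only: permutes_in_image[OF that(1)]) (simp_all add: invs_def)
    then show ?thesis
      using that(2) by (simp add: invs_def permutes_inverses[OF that(1)])
  qed
  show "bij_betw (\<lambda>(i, j). (inv' w j, inv' w i)) (invs a b (inv' w)) (invs a b w)"
  proof (rule bij_betw_byWitness[where f' = "\<lambda>(i, j). (w j, w i)"])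
    show "(\<lambda>(i, j). (w j, w i)) ` invs a b w \<subseteq> invs a b (inv' w)"
      using *[OF assms] by auto
    show "(\<lambda>(i, j). (inv' w j, inv' w i)) ` invs a b (inv' w) \<subseteq> invs a b w"
      using *[OF permutes_inv[OF assms]] by (auto simp: permutes_inv_inv[OF assms])
  qed (simp_all add: split_beta permutes_inverses[OF assms])
qed

text \<open>A pair with a position outside \<open>{a..b}\<close> cannot be inverted. Hence a word
  that is reduced inside an interval is also reduced for the ambient length on
  \<open>{1..n}\<close>.\<close>

lemma inv_no_subinterval:
  assumes "w permutes {a..b}" "c \<le> a" "b \<le> d"
  shows "inv_no c d w = inv_no a b w"
proof -
  have "i \<in> {a..b} \<and> j \<in> {a..b}" if "i < j" "w j < w i" for i j
    using that permutes_in_image[OF assms(1), of i] permutes_in_image[OF assms(1), of j]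
      permutes_not_in[OF assms(1), of i] permutes_not_in[OF assms(1), of j]
    by (cases "i \<in> {a..b}"; cases "j \<in> {a..b}") auto
  then have "invs c d w = invs a b w"
    using assms(2,3) by (fastforce simp: invs_def)
  then show ?thesis by (simp add: inv_no_def)
qed

lemma interval_subgroup_eq:
  assumes "1 \<le> fst J" "snd J \<le> n"
  shows "interval_subgroup n J = {w. w permutes {fst J..snd J}}"
proof
  interpret group "sym_group n" by (rule sym_group_is_group)
  have gens: "adj_transp ` {fst J..<snd J} \<subseteq> carrier (sym_group n)"
    using assms adj_transp_permutes[of 1 _ n] by (auto simp: sym_group_carrier)
  show "interval_subgroup n J \<subseteq> {w. w permutes {fst J..snd J}}"
  proof
    fix w assume "w \<in> interval_subgroup n J"
    then have "w \<in> generate (sym_group n) (adj_transp ` {fst J..<snd J})"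
      by (simp add: interval_subgroup_def)
    then show "w \<in> {w. w permutes {fst J..snd J}}"
    proof induction
      case (inv h)
      then have "h permutes {1..n}" using gens by (auto simp: sym_group_carrier)
      then have "inv\<^bsub>sym_group n\<^esub> h = inv' h"
        by (intro sym_group_inv_equality) (simp add: sym_group_carrier)
      then show ?case using inv adj_transp_permutes by auto
    next
      case (eng h1 h2)
      then show ?case
        using permutes_compose[of h2 _ h1] by (simp add: sym_group_mult comp_def)
    qed (use permutes_id in \<open>auto simp: sym_group_one id_def adj_transp_permutes\<close>)
  qed
  show "{w. w permutes {fst J..snd J}} \<subseteq> interval_subgroup n J"
  proof
    fix w assume "w \<in> {w. w permutes {fst J..snd J}}"
    then obtain us where us: "set us \<subseteq> {fst J..<snd J}" "word_perm us = w"
      using ex_word_perm[of w "fst J" "snd J"] by auto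
    have "word_perm us \<in> generate (sym_group n) (adj_transp ` {fst J..<snd J})"
      using us(1)
    proof (induction us)
      case Nil
      then show ?case using generate.one[of "sym_group n"] by (simp add: sym_group_one id_def)
    next
      case (Cons i us)
      then show ?case
        using generate.eng[OF generate.incl, of "adj_transp i" "adj_transp ` {fst J..<snd J}" "word_perm us" "sym_group n"]
        by (simp add: sym_group_mult comp_def)
    qed
    then show "w \<in> interval_subgroup n J" using us by (simp add: interval_subgroup_def)
  qed
qed

section \<open>Operators indexed by words\<close>

text \<open>An orbit under permutation of positions, kept as total functions that agree with
  \<open>v\<close> outside \<open>{1..n}\<close>, so that equality of words is equality of
  functions.\<close>

definition words :: "nat \<Rightarrow> (nat \<Rightarrow> nat) \<Rightarrow> (nat \<Rightarrow> nat) set" where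
  "words n v = {v \<circ> p | p. p permutes {1..n}}"

lemma finite_words [simp]: "finite (words n v)"
  by (simp add: words_def setcompr_eq_image finite_permutations)

lemma words_self [simp]: "v \<in> words n v"
  by (auto simp: words_def intro!: exI[of _ id] permutes_id[unfolded id_def])

lemma words_comp:
  assumes "f \<in> words n v" "p permutes {1..n}"
  shows "f \<circ> p \<in> words n v"
proof -
  obtain r where "f = v \<circ> r" "r permutes {1..n}" using assms(1) by (auto simp: words_def)
  then show ?thesis
    using permutes_compose[OF assms(2)] by (auto simp: words_def comp_assoc)
qed

lemma words_swap: "f \<in> words n v \<Longrightarrow> i \<in> {1..<n} \<Longrightarrow> f \<circ> adj_transp i \<in> words n v"
  by (rule words_comp) (auto intro: adj_transp_permutes)

lemma mset_words:
  assumes "f \<in> words n v"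
  shows "image_mset f (mset_set {1..n}) = image_mset v (mset_set {1..n})"
proof -
  obtain p where p: "f = v \<circ> p" "p permutes {1..n}" using assms by (auto simp: words_def)
  have "image_mset p (mset_set {1..n}) = mset_set {1..n}"
    using permutes_inj_on[OF p(2)] permutes_image[OF p(2)] by (simp add: image_mset_mset_set)
  then show ?thesis by (metis p(1) multiset.map_comp)
qed

text \<open>A sorted list is determined by its multiset, and rearrangement preserves the multiset.
  Therefore sorting must end in \<open>v0\<close>.\<close>

lemma words_sorted_unique:
  assumes "f \<in> words n v" "\<And>i. i \<in> {1..<n} \<Longrightarrow> f i \<le> f (Suc i)" "\<And>i. i \<in> {1..<n} \<Longrightarrow> v i \<le> v (Suc i)"
  shows "f = v"
proof
  fix i
  have sorted: "sorted (map g [1..<Suc n])" if "\<And>i. i \<in> {1..<n} \<Longrightarrow> g i \<le> g (Suc i)" for g :: "nat \<Rightarrow> nat"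
    unfolding sorted_map
  proof (rule sorted_wrt_mono_rel[OF _ sorted_upt[of 1 "Suc n"]])
    show "g x \<le> g y" if "x \<in> set [1..<Suc n]" "y \<in> set [1..<Suc n]" "x \<le> y" for x y
      by (rule mono_on_interval[of 1 n]) (use \<open>\<And>i. i \<in> {1..<n} \<Longrightarrow> g i \<le> g (Suc i)\<close> that in auto)
  qed
  have "mset (map f [1..<Suc n]) = mset (map v [1..<Suc n])"
    using mset_words[OF assms(1)] by (simp only: mset_map mset_upt atLeastLessThanSuc_atLeastAtMost)
  then have eq: "map f [1..<Suc n] = map v [1..<Suc n]"
    using sorted[of f] sorted[of v] assms(2,3) by (metis properties_for_sort)
  show "f i = v i"
  proof (cases "i \<in> {1..n}")
    case True
    then have "i \<in> set [1..<Suc n]" by auto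
    with eq show ?thesis by (simp only: map_eq_conv)
  next
    case False
    then show ?thesis using assms(1) by (auto simp: words_def permutes_def)
  qed
qed

text \<open>The vector attached to \<open>f\<close> is obtained from \<open>m0\<close> by applying the \<open>t i\<close> along one particular way
  of sorting \<open>f\<close>.  That any other way gives the same vector up to \<open>E\<close>, by induction on the number of
  inversions, replaces Matsumoto's theorem and the theory of minimal coset representatives.\<close>

primrec sort_chain :: "(nat \<Rightarrow> 'm \<Rightarrow> 'm) \<Rightarrow> 'm \<Rightarrow> nat \<Rightarrow> nat \<Rightarrow> (nat \<Rightarrow> nat) \<Rightarrow> 'm" where
  "sort_chain t m n 0 f = m"
| "sort_chain t m n (Suc k) f =
     (let i = (LEAST i. 1 \<le> i \<and> i < n \<and> f (Suc i) < f i) in t i (sort_chain t m n k (f \<circ> adj_transp i)))"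

text \<open>Sorting never squares a generator, so only braid relations are assumed. \<open>E\<close>
  stands for equality so that the target may be the free algebra modulo \<open>K\<close>;
  \<open>neg\<close> is the scalar by which a generator acts on \<open>m0\<close> at equal letters,
  and \<open>S\<close> is the domain on which the relations hold.\<close>

locale word_operators =
  fixes n :: nat and t :: "nat \<Rightarrow> 'm \<Rightarrow> 'm" and neg :: "'m \<Rightarrow> 'm" and E :: "'m \<Rightarrow> 'm \<Rightarrow> bool"
    and S :: "'m set" and v0 :: "nat \<Rightarrow> nat" and m0 :: 'm
  assumes E_refl: "E x x" and E_sym: "E x y \<Longrightarrow> E y x" and E_trans [trans]: "E x y \<Longrightarrow> E y z \<Longrightarrow> E x z"
    and m0_closed: "m0 \<in> S" and t_closed: "i \<in> {1..<n} \<Longrightarrow> x \<in> S \<Longrightarrow> t i x \<in> S"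
    and t_cong: "i \<in> {1..<n} \<Longrightarrow> E x y \<Longrightarrow> E (t i x) (t i y)"
    and neg_cong: "E x y \<Longrightarrow> E (neg x) (neg y)"
    and t_neg: "i \<in> {1..<n} \<Longrightarrow> x \<in> S \<Longrightarrow> E (t i (neg x)) (neg (t i x))"
    and t_commute: "i \<in> {1..<n} \<Longrightarrow> j \<in> {1..<n} \<Longrightarrow> Suc i < j \<Longrightarrow> x \<in> S \<Longrightarrow>
          E (t i (t j x)) (t j (t i x))"
    and t_braid: "i \<in> {1..<n} \<Longrightarrow> Suc i \<in> {1..<n} \<Longrightarrow> x \<in> S \<Longrightarrow>
          E (t i (t (Suc i) (t i x))) (t (Suc i) (t i (t (Suc i) x)))"
    and v0_mono: "i \<in> {1..<n} \<Longrightarrow> v0 i \<le> v0 (Suc i)"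
    and t_m0: "i \<in> {1..<n} \<Longrightarrow> v0 i = v0 (Suc i) \<Longrightarrow> E (t i m0) (neg m0)"
begin

text \<open>The counter given to \<open>sort_chain\<close> is the number of inversions; every step
  removes one, so it reaches \<open>0\<close> exactly at the sorted word.\<close>

definition fam :: "(nat \<Rightarrow> nat) \<Rightarrow> 'm" where
  "fam f = sort_chain t m0 n (inv_no 1 n f) f"

lemma t_commute': "i \<in> {1..<n} \<Longrightarrow> j \<in> {1..<n} \<Longrightarrow> Suc i < j \<or> Suc j < i \<Longrightarrow> x \<in> S \<Longrightarrow>
    E (t i (t j x)) (t j (t i x))"
  using t_commute E_sym by blast

lemma t_braid': "i \<in> {1..<n} \<Longrightarrow> j \<in> {1..<n} \<Longrightarrow> j = Suc i \<or> i = Suc j \<Longrightarrow> x \<in> S \<Longrightarrow>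
    E (t i (t j (t i x))) (t j (t i (t j x)))"
  using t_braid E_sym by blast

lemma fam_cases:
  assumes "f \<in> words n v0"
  obtains "f = v0" "fam f = m0"
  | i where "i \<in> {1..<n}" "f (Suc i) < f i" "fam f = t i (fam (f \<circ> adj_transp i))"
proof (cases "inv_no 1 n f")
  case 0
  have "f i \<le> f (Suc i)" if "i \<in> {1..<n}" for i
    using inv_no_desc[of 1 i n f] 0 that by (force simp: not_less[symmetric])
  then show ?thesis
    using words_sorted_unique[OF assms _ v0_mono] 0 that(1) by (simp add: fam_def)
next
  case (Suc k)
  let ?P = "\<lambda>i. 1 \<le> i \<and> i < n \<and> f (Suc i) < f i"
  have "\<exists>i. ?P i"
    using inv_no_eq_0I[of 1 n f] Suc by (metis not_less old.nat.distinct(1))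
  then have P: "?P (Least ?P)" by (rule LeastI_ex)
  then have "fam f = t (Least ?P) (fam (f \<circ> adj_transp (Least ?P)))"
    using Suc inv_no_desc[of 1 "Least ?P" n f] by (simp add: fam_def Let_def)
  with P that(2)[of "Least ?P"] show ?thesis by auto
qed

lemma fam_v0: "fam v0 = m0"
  by (rule fam_cases[OF words_self]) (use v0_mono in \<open>auto simp: not_less[symmetric]\<close>)

lemma fam_closed: "f \<in> words n v0 \<Longrightarrow> fam f \<in> S"
proof (induction "inv_no 1 n f" arbitrary: f rule: less_induct)
  case less
  from less(2) show ?case
  proof (cases rule: fam_cases)
    case (2 i)
    then show ?thesis
      using less(1)[of "f \<circ> adj_transp i"] words_swap[OF less(2), of i] inv_no_desc[of 1 i n f]
      by (auto intro!: t_closed)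
  qed (simp add: m0_closed)
qed

text \<open>Local confluence of sorting. Distant descents are joined by commutation after one more
  swap each, neighbouring ones by the braid relation after two more each. The induction hypothesis
  of \<open>fam_descent\<close> enters as the assumption \<open>IH\<close>.\<close>

lemma fam_descent_pair:
  assumes f: "f \<in> words n v0" and i: "i \<in> {1..<n}" "f (Suc i) < f i" and j: "j \<in> {1..<n}" "f (Suc j) < f j"
    and IH: "\<And>g k. g \<in> words n v0 \<Longrightarrow> inv_no 1 n g < inv_no 1 n f \<Longrightarrow> k \<in> {1..<n} \<Longrightarrow> g (Suc k) < g k \<Longrightarrow>
      E (fam g) (t k (fam (g \<circ> adj_transp k)))"
  shows "E (t i (fam (f \<circ> adj_transp i))) (t j (fam (f \<circ> adj_transp j)))"
proof -
  have less: "inv_no 1 n (g \<circ> adj_transp k) < inv_no 1 n g" if "k \<in> {1..<n}" "g (Suc k) < g k" for g k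
    using inv_no_desc[of 1 k n g] that by simp
  have wi: "f \<circ> adj_transp i \<in> words n v0" and wj: "f \<circ> adj_transp j \<in> words n v0"
    using words_swap f i j by auto
  consider "i = j" | "Suc i < j \<or> Suc j < i" | "j = Suc i \<or> i = Suc j" by linarith
  then show ?thesis
  proof cases
    case 1
    then show ?thesis by (simp add: E_refl)
  next
    case 2
    have eq: "f \<circ> adj_transp i \<circ> adj_transp j = f \<circ> adj_transp j \<circ> adj_transp i"
      by (simp only: comp_assoc adj_transp_commute[OF 2])
    have 1: "E (fam (f \<circ> adj_transp i)) (t j (fam (f \<circ> adj_transp i \<circ> adj_transp j)))"
      by (rule IH[OF wi less[OF i] j(1)]) (use 2 j in \<open>auto simp: adj_transp_if\<close>)
    have 2: "E (fam (f \<circ> adj_transp j)) (t i (fam (f \<circ> adj_transp i \<circ> adj_transp j)))"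
      unfolding eq by (rule IH[OF wj less[OF j] i(1)]) (use 2 i in \<open>auto simp: adj_transp_if\<close>)
    have "E (t i (fam (f \<circ> adj_transp i))) (t i (t j (fam (f \<circ> adj_transp i \<circ> adj_transp j))))"
      by (rule t_cong[OF i(1) 1])
    also have "E \<dots> (t j (t i (fam (f \<circ> adj_transp i \<circ> adj_transp j))))"
      by (rule t_commute'[OF i(1) j(1) \<open>Suc i < j \<or> Suc j < i\<close>])
        (intro fam_closed words_swap[OF wi j(1)])
    also have "E \<dots> (t j (fam (f \<circ> adj_transp j)))"
      by (rule t_cong[OF j(1) E_sym[OF 2]])
    finally show ?thesis .
  next
    case 3
    have eq: "f \<circ> adj_transp i \<circ> adj_transp j \<circ> adj_transp i = f \<circ> adj_transp j \<circ> adj_transp i \<circ> adj_transp j"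
      (is "?g = ?g'")
      using 3 adj_transp_braid by (metis comp_assoc)
    have *: "E (t k (fam (f \<circ> adj_transp k)))
        (t k (t l (t k (fam (f \<circ> adj_transp k \<circ> adj_transp l \<circ> adj_transp k)))))"
      if "k = i \<and> l = j \<or> k = j \<and> l = i" for k l
    proof -
      have k: "k \<in> {1..<n}" "f (Suc k) < f k" "l \<in> {1..<n}" "f (Suc l) < f l" and
        kl: "l = Suc k \<or> k = Suc l"
        using that i j 3 by auto
      \<comment> \<open>Neighbouring descents mean three strictly decreasing letters, so both
        further swaps again act at descents.\<close>
      have d1: "(f \<circ> adj_transp k) (Suc l) < (f \<circ> adj_transp k) l"
        and d2: "(f \<circ> adj_transp k \<circ> adj_transp l) (Suc k) < (f \<circ> adj_transp k \<circ> adj_transp l) k"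
        using k kl by (auto simp: adj_transp_if)
      note w1 = words_swap[OF f k(1)] and w2 = words_swap[OF words_swap[OF f k(1)] k(3)]
      note l1 = less[OF k(1,2)] and l2 = less[OF k(3) d1]
      have "E (fam (f \<circ> adj_transp k)) (t l (fam (f \<circ> adj_transp k \<circ> adj_transp l)))"
        by (rule IH[OF w1 l1 k(3) d1])
      also have "E \<dots> (t l (t k (fam (f \<circ> adj_transp k \<circ> adj_transp l \<circ> adj_transp k))))"
        by (rule t_cong[OF k(3)], rule IH[OF w2 less_trans[OF l2 l1] k(1) d2])
      finally show ?thesis by (rule t_cong[OF k(1)])
    qed
    have "E (t i (fam (f \<circ> adj_transp i))) (t i (t j (t i (fam ?g))))"
      using * by simp
    also have "E \<dots> (t j (t i (t j (fam ?g))))"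
      by (rule t_braid'[OF i(1) j(1) 3])
        (intro fam_closed words_swap[OF words_swap[OF wi j(1)] i(1)])
    also have "E \<dots> (t j (fam (f \<circ> adj_transp j)))"
      unfolding eq by (rule E_sym, rule *) simp
    finally show ?thesis .
  qed
qed

lemma fam_descent:
  assumes "f \<in> words n v0" "i \<in> {1..<n}" "f (Suc i) < f i"
  shows "E (fam f) (t i (fam (f \<circ> adj_transp i)))"
  using assms
proof (induction "inv_no 1 n f" arbitrary: f i rule: less_induct)
  case less
  from less(2) show ?case
  proof (cases rule: fam_cases)
    case 1
    then show ?thesis using v0_mono[OF less(3)] less(4) by simp
  next
    case (2 j)
    then show ?thesis
      using fam_descent_pair[OF less(2) 2(1,2) less(3,4)] less(1) by simp
  qed
qed

text \<open>Word form of s_i w = w s_j for minimal coset representatives: the equal pair is carried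
  along while the word is sorted, until it sits in \<open>v0\<close>, where \<open>t_m0\<close>
  applies.\<close>

lemma fam_equal:
  assumes "f \<in> words n v0" "i \<in> {1..<n}" "f i = f (Suc i)"
  shows "E (t i (fam f)) (neg (fam f))"
  using assms
proof (induction "inv_no 1 n f" arbitrary: f i rule: less_induct)
  case less
  note f = less(2) and i = less(3,4)
  from f show ?case
  proof (cases rule: fam_cases)
    case 1
    then show ?thesis using t_m0 i by simp
  next
    case (2 j)
    note j = this
    let ?g = "f \<circ> adj_transp j"
    have wg: "?g \<in> words n v0" by (rule words_swap[OF f j(1)])
    have lg: "inv_no 1 n ?g < inv_no 1 n f" using inv_no_desc[of 1 j n f] j by simp
    have "i \<noteq> j" using i j by auto
    then consider "Suc i < j \<or> Suc j < i" | "j = Suc i \<or> i = Suc j" by linarith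
    then show ?thesis
    proof cases
      case 1
      have "E (t i (fam f)) (t j (t i (fam ?g)))"
        unfolding j(3) by (rule t_commute'[OF i(1) j(1) 1 fam_closed[OF wg]])
      also have "E \<dots> (t j (neg (fam ?g)))"
        by (rule t_cong[OF j(1)], rule less(1)[OF lg wg i(1)]) (use 1 i in \<open>auto simp: adj_transp_if\<close>)
      also have "E \<dots> (neg (fam f))"
        unfolding j(3) by (rule t_neg[OF j(1) fam_closed[OF wg]])
      finally show ?thesis .
    next
      case 2
      let ?h = "?g \<circ> adj_transp i"
      \<comment> \<open>The equal letters both exceed, or both fall below, the third one. After the
        swaps at \<open>j\<close> and \<open>i\<close> the equal pair stands at \<open>j\<close> and
        \<open>Suc j\<close>, so the braid relation turns \<open>t i\<close> into \<open>t j\<close>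
        acting on \<open>fam ?h\<close>.\<close>
      have dg: "?g (Suc i) < ?g i" using 2 i j by (auto simp: adj_transp_if)
      have wh: "?h \<in> words n v0" by (rule words_swap[OF wg i(1)])
      have lh: "inv_no 1 n ?h < inv_no 1 n f"
        using inv_no_desc[of 1 i n ?g] dg i lg by simp
      have eh: "E (t j (fam ?h)) (neg (fam ?h))"
        by (rule less(1)[OF lh wh j(1)]) (use 2 i j in \<open>auto simp: adj_transp_if\<close>)
      have ff: "E (fam f) (t j (t i (fam ?h)))"
        unfolding j(3) by (rule t_cong[OF j(1)], rule fam_descent[OF wg i(1) dg])
      note cl = fam_closed[OF wh]
      have "E (t i (fam f)) (t i (t j (t i (fam ?h))))"
        by (rule t_cong[OF i(1) ff])
      also have "E \<dots> (t j (t i (t j (fam ?h))))"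
        by (rule t_braid'[OF i(1) j(1) 2 cl])
      also have "E \<dots> (t j (t i (neg (fam ?h))))"
        by (intro t_cong i j eh)
      also have "E \<dots> (t j (neg (t i (fam ?h))))"
        by (intro t_cong t_neg i j cl)
      also have "E \<dots> (neg (t j (t i (fam ?h))))"
        by (intro t_neg t_closed i j cl)
      also have "E \<dots> (neg (fam f))"
        by (rule neg_cong[OF E_sym[OF ff]])
      finally show ?thesis .
    qed
  qed
qed

end

section \<open>The action on coefficient functions of words\<close>

type_synonym word_fun = "(nat \<Rightarrow> nat) \<Rightarrow> laurent"

text \<open>An element of \<open>word_fun\<close> lists the coefficients of a linear combination of words.  Words are scaled
  by powers of \<open>q_half\<close> so that both off-diagonal entries of a generator are \<open>q_half\<close>.\<close>

definition diag_coeff :: "nat \<Rightarrow> word_fun" where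
  "diag_coeff i w = (if w i = w (Suc i) then - 1 else if w i < w (Suc i) then 0 else q_var - 1)"

definition swap_coeff :: "nat \<Rightarrow> word_fun" where
  "swap_coeff i w = (if w i = w (Suc i) then 0 else q_half)"

definition tact :: "nat \<Rightarrow> word_fun \<Rightarrow> word_fun" where
  "tact i v w = diag_coeff i w * v w + swap_coeff i w * v (w \<circ> adj_transp i)"

lemma q_var_eq: "q_var = q_half * q_half"
  by (simp add: q_var_def power2_eq_square)

text \<open>Cayley-Hamilton on each block: eigenvalues q and -1 on a word and its swap, -1 alone at
  equal letters.\<close>

lemma tact_quadratic: "tact i (tact i v) w = (q_var - 1) * tact i v w + q_var * v w"
  by (cases "w i" "w (Suc i)" rule: linorder_cases)
    (simp_all add: tact_def diag_coeff_def swap_coeff_def q_var_eq algebra_simps)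

lemma tact_commute:
  assumes "Suc i < j \<or> Suc j < i"
  shows "tact i (tact j v) = tact j (tact i v)"
proof
  fix w :: "nat \<Rightarrow> nat"
  have eq: "w \<circ> adj_transp i \<circ> adj_transp j = w \<circ> adj_transp j \<circ> adj_transp i"
    by (simp only: comp_assoc adj_transp_commute[OF assms])
  have "diag_coeff i (w \<circ> adj_transp j) = diag_coeff i w" "swap_coeff i (w \<circ> adj_transp j) = swap_coeff i w"
    "diag_coeff j (w \<circ> adj_transp i) = diag_coeff j w" "swap_coeff j (w \<circ> adj_transp i) = swap_coeff j w"
    using assms by (auto simp: diag_coeff_def swap_coeff_def)
  then show "tact i (tact j v) w = tact j (tact i v) w"
    by (simp add: tact_def eq algebra_simps del: o_apply)
qed

text \<open>Only the relative order of the three letters at \<open>i\<close>, \<open>i + 1\<close>,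
  \<open>i + 2\<close> matters, ties included, so a finite case check suffices; \<open>eq\<close>
  identifies the two names of the word with these letters reversed.\<close>

lemma tact_braid: "tact i (tact (Suc i) (tact i v)) = tact (Suc i) (tact i (tact (Suc i) v))"
proof
  fix w :: "nat \<Rightarrow> nat"
  have eq: "w \<circ> adj_transp i \<circ> adj_transp (Suc i) \<circ> adj_transp i
      = w \<circ> adj_transp (Suc i) \<circ> adj_transp i \<circ> adj_transp (Suc i)"
    by (simp only: comp_assoc adj_transp_braid[unfolded comp_assoc])
  show "tact i (tact (Suc i) (tact i v)) w = tact (Suc i) (tact i (tact (Suc i) v)) w"
    by (cases "w i" "w (Suc i)" rule: linorder_cases;
        cases "w (Suc i)" "w (Suc (Suc i))" rule: linorder_cases;
        cases "w i" "w (Suc (Suc i))" rule: linorder_cases)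
      (simp_all add: tact_def diag_coeff_def swap_coeff_def eq q_var_eq algebra_simps)
qed

definition tword :: "nat list \<Rightarrow> word_fun \<Rightarrow> word_fun" where
  "tword us = foldr tact us"

lemma tword_simps [simp]: "tword [] v = v" "tword (i # us) v = tact i (tword us v)"
  by (simp_all add: tword_def)

lemma tword_append: "tword (us @ vs) v = tword us (tword vs v)"
  by (simp add: tword_def)

lemma tact_sum: "tact i (\<lambda>w. \<Sum>k\<in>A. c k * x k w) = (\<lambda>w. \<Sum>k\<in>A. c k * tact i (x k) w)"
  by (auto simp: tact_def sum_distrib_left sum.distrib[symmetric] algebra_simps intro!: sum.cong)

lemma tword_sum: "tword us (\<lambda>w. \<Sum>k\<in>A. c k * x k w) = (\<lambda>w. \<Sum>k\<in>A. c k * tword us (x k) w)"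
  by (induction us) (simp_all add: tact_sum)

lemma inv_word_perm_Cons: "inv' (word_perm (i # us)) = inv' (word_perm us) \<circ> adj_transp i"
proof -
  have "bij (word_perm us)"
    by (rule permutes_bij[OF word_perm_permutes[of us 0 "Suc (Max (set us))"]]) (auto simp: less_Suc_eq_le)
  moreover have "bij (adj_transp i)" by (simp add: adj_transp_def)
  ultimately show ?thesis by (simp add: o_inv_distrib del: o_apply)
qed

text \<open>Matsumoto's theorem for the operators \<open>tact\<close>: both words compute
  \<open>fam\<close> of the inverse permutation. A word is peeled from its front while
  \<open>fam\<close> peels on the right, and inversion exchanges the two sides.\<close>

lemma tword_reduced_unique:
  assumes "set us \<subseteq> {1..<n}" "length us = inv_no 1 n (word_perm us)"
    and "set vs \<subseteq> {1..<n}" "length vs = inv_no 1 n (word_perm vs)" "word_perm us = word_perm vs"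
  shows "tword us = tword vs"
proof -
  \<comment> \<open>With base word \<open>id\<close> the words are the permutations themselves,
    whose letters are distinct; \<open>m0 = id\<close> is the identity operator.\<close>
  interpret word_operators n "\<lambda>i A. tact i \<circ> A" id "(=)" UNIV id id
    by unfold_locales (simp_all add: comp_def tact_commute tact_braid)
  have "tword us = fam (inv' (word_perm us))"
    if "set us \<subseteq> {1..<n}" "length us = inv_no 1 n (word_perm us)" for us
    using that
  proof (induction us)
    case Nil
    have "tword [] = id" by (simp add: fun_eq_iff)
    then show ?case by (simp only: word_perm_simps inv_id fam_v0)
  next
    case (Cons i us)
    have perm: "word_perm us permutes {1..n}" by (rule word_perm_permutes) (use Cons.prems in auto)
    define f where "f = inv' (word_perm us)"
    have f: "f permutes {1..n}" unfolding f_def by (rule permutes_inv[OF perm])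
    have i: "i \<in> {1..<n}" using Cons.prems by simp
    have "Suc (length us) = inv_no 1 n (inv' (word_perm (i # us)))"
      using Cons.prems(2) inv_no_inv[OF word_perm_permutes[OF Cons.prems(1)]]
      by (simp del: o_apply word_perm_simps)
    then have len: "Suc (length us) = inv_no 1 n (f \<circ> adj_transp i)"
      unfolding inv_word_perm_Cons f_def .
    have le: "inv_no 1 n f \<le> length us"
      using inv_no_word_perm_le[of us 1 n id] Cons.prems(1) inv_no_inv[OF perm] by (simp add: f_def)
    \<comment> \<open>Otherwise the remaining word \<open>us\<close> would be shorter than the
      number of inversions of its own permutation.\<close>
    have "f i < f (Suc i)"
    proof (rule ccontr)
      assume "\<not> f i < f (Suc i)"
      moreover have "f i \<noteq> f (Suc i)" by (simp add: inj_eq[OF permutes_inj[OF f]])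
      ultimately have "inv_no 1 n f = Suc (inv_no 1 n (f \<circ> adj_transp i))"
        using i by (intro inv_no_desc) auto
      then show False using len le by simp
    qed
    then have asc: "(f \<circ> adj_transp i) (Suc i) < (f \<circ> adj_transp i) i" by simp
    have "length us = inv_no 1 n f"
      using inv_no_asc[of 1 i n f] i \<open>f i < f (Suc i)\<close> len by simp
    then have IH: "tword us = fam f"
      unfolding f_def by (intro Cons.IH) (use Cons.prems(1) inv_no_inv[OF perm] in \<open>auto simp: f_def\<close>)
    have "f \<circ> adj_transp i \<in> words n id"
      by (rule words_swap[OF _ i]) (use f in \<open>auto simp: words_def\<close>)
    from fam_descent[OF this i asc] have "fam (f \<circ> adj_transp i) = tact i \<circ> fam f"
      by (simp only: comp_adj_transp_twice)
    moreover have "tword (i # us) = tact i \<circ> tword us" by (simp add: fun_eq_iff)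
    ultimately show ?case
      by (simp only: inv_word_perm_Cons f_def[symmetric] IH)
  qed
  then show ?thesis using assms by metis
qed

section \<open>Basis elements and interval sums as operators on words\<close>

definition perm_op :: "nat \<Rightarrow> (nat \<Rightarrow> nat) \<Rightarrow> word_fun \<Rightarrow> word_fun" where
  "perm_op n w = tword (reduced_word n w)"

lemma perm_op_eq:
  assumes "set us \<subseteq> {1..<n}" "word_perm us = w" "length us = inv_no 1 n w"
  shows "perm_op n w = tword us"
  unfolding perm_op_def
  by (rule tword_reduced_unique)
    (use reduced_word[of w n] word_perm_permutes[OF assms(1)] assms in auto)

text \<open>Prepending \<open>i\<close> keeps a reduced word of \<open>w\<close> reduced when the
  value \<open>i\<close> occurs before \<open>Suc i\<close> in \<open>w\<close>; this order is read
  off \<open>inv' w\<close>.\<close>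

lemma perm_op_left:
  assumes "w permutes {1..n}" "i \<in> {1..<n}" "inv' w i < inv' w (Suc i)"
  shows "perm_op n (adj_transp i \<circ> w) v = tact i (perm_op n w v)"
proof -
  note r = reduced_word[OF assms(1)]
  have p: "adj_transp i \<circ> w permutes {1..n}"
    by (rule permutes_compose[OF assms(1) adj_transp_permutes]) (use assms(2) in auto)
  have "inv_no 1 n (adj_transp i \<circ> w) = inv_no 1 n (inv' (adj_transp i \<circ> w))"
    by (rule inv_no_inv[OF p, symmetric])
  also have "inv' (adj_transp i \<circ> w) = inv' w \<circ> adj_transp i"
    using inv_word_perm_Cons[of i "reduced_word n w"] r(2) by simp
  also have "inv_no 1 n \<dots> = Suc (inv_no 1 n (inv' w))"
    by (rule inv_no_asc) (use assms in auto)
  also have "inv_no 1 n (inv' w) = inv_no 1 n w" by (rule inv_no_inv[OF assms(1)])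
  finally have "perm_op n (adj_transp i \<circ> w) = tword (i # reduced_word n w)"
    using r assms(2) by (intro perm_op_eq) (auto simp del: o_apply)
  then show ?thesis by (simp add: perm_op_def)
qed

definition interval_op :: "nat \<Rightarrow> nat \<times> nat \<Rightarrow> word_fun \<Rightarrow> word_fun" where
  "interval_op n J v w = (\<Sum>u | u permutes {fst J..snd J}. perm_op n u v w)"

lemma permutes_interval_mono: "w permutes {a..b} \<Longrightarrow> 1 \<le> a \<Longrightarrow> b \<le> n \<Longrightarrow> w permutes {1..(n::nat)}"
  by (rule permutes_subset) auto

text \<open>The sum splits into pairs \<open>u\<close> and \<open>adj_transp i \<circ> u\<close>,
  and on each pair the quadratic relation gives T_i (T_u + T_i T_u) = q (T_u + T_i T_u).\<close>

lemma tact_interval_op: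
  assumes "1 \<le> a" "b \<le> n" "a \<le> i" "i < b"
  shows "tact i (interval_op n (a, b) v) w = q_var * interval_op n (a, b) v w"
proof -
  let ?P = "{u. u permutes {a..b}}"
  let ?A = "{u. u permutes {a..b} \<and> inv' u i < inv' u (Suc i)}"
  let ?B = "{u. u permutes {a..b} \<and> \<not> inv' u i < inv' u (Suc i)}"
  have fin: "finite ?P" by (simp add: finite_permutations)
  have i: "i \<in> {1..<n}" using assms by auto
  have s: "adj_transp i permutes {a..b}" using assms adj_transp_permutes by simp
  have inv: "inv' (adj_transp i \<circ> u) = inv' u \<circ> adj_transp i" if "u permutes {a..b}" for u
    using permutes_bij[OF that] permutes_bij[OF s] by (simp add: o_inv_distrib del: o_apply)
  have ne: "inv' u i \<noteq> inv' u (Suc i)" if "u permutes {a..b}" for u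
    by (simp add: inj_eq[OF permutes_inj[OF permutes_inv[OF that]]])
  have invol: "adj_transp i \<circ> (adj_transp i \<circ> u) = u" for u :: "nat \<Rightarrow> nat"
    by (simp add: fun_eq_iff)
  have fins: "finite ?A" "finite ?B" by (auto intro: finite_subset[OF _ fin])
  have disj: "?A \<inter> ?B = {}" by blast
  have union: "?P = ?A \<union> ?B" by blast
  \<comment> \<open>\<open>?A\<close> holds the shorter member of each pair; left multiplication by
    the swap exchanges \<open>?A\<close> and \<open>?B\<close>.\<close>
  have split: "(\<Sum>u\<in>?P. g u) = (\<Sum>u\<in>?A. g u + g (adj_transp i \<circ> u))"
    for g :: "(nat \<Rightarrow> nat) \<Rightarrow> laurent"
  proof -
    have "(\<Sum>u\<in>?P. g u) = (\<Sum>u\<in>?A. g u) + (\<Sum>u\<in>?B. g u)"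
      unfolding union by (rule sum.union_disjoint[OF fins disj])
    also have "(\<Sum>u\<in>?B. g u) = (\<Sum>u\<in>?A. g (adj_transp i \<circ> u))"
    proof (rule sum.reindex_bij_witness[where i = "\<lambda>u. adj_transp i \<circ> u" and j = "\<lambda>u. adj_transp i \<circ> u"])
      fix u assume u: "u \<in> ?A"
      then show "adj_transp i \<circ> u \<in> ?B"
        using inv[of u] permutes_compose[OF _ s, of u] by simp
    next
      fix u assume u: "u \<in> ?B"
      then show "adj_transp i \<circ> u \<in> ?A"
        using inv[of u] permutes_compose[OF _ s, of u] ne[of u] by auto
    qed (simp_all only: invol)
    finally show ?thesis by (simp only: sum.distrib)
  qed
  have lin: "tact i (\<lambda>w. \<Sum>k\<in>A. x k w) = (\<lambda>w. \<Sum>k\<in>A. tact i (x k) w)"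
    for A :: "(nat \<Rightarrow> nat) set" and x
    using tact_sum[of i "\<lambda>_. 1" x A] by simp
  have "tact i (interval_op n (a, b) v) w = (\<Sum>u\<in>?P. tact i (perm_op n u v) w)"
    unfolding interval_op_def[abs_def] by (simp add: lin)
  also have "\<dots> = (\<Sum>u\<in>?A. q_var * (perm_op n u v w + perm_op n (adj_transp i \<circ> u) v w))"
    unfolding split
  proof (rule sum.cong[OF refl])
    fix u assume "u \<in> ?A"
    then have "perm_op n (adj_transp i \<circ> u) v = tact i (perm_op n u v)"
      using permutes_interval_mono[OF _ assms(1,2)] i by (intro perm_op_left) auto
    then show "tact i (perm_op n u v) w + tact i (perm_op n (adj_transp i \<circ> u) v) w
       = q_var * (perm_op n u v w + perm_op n (adj_transp i \<circ> u) v w)"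
      by (simp add: tact_quadratic algebra_simps)
  qed
  also have "\<dots> = q_var * interval_op n (a, b) v w"
    by (simp add: interval_op_def split sum_distrib_left)
  finally show ?thesis .
qed

text \<open>The diagonal coefficient vanishes at an ascent, so the expansion does not branch as long
  as each letter creates an inversion. Equality in \<open>inv_no_word_perm_le\<close> says that
  every letter does.\<close>

lemma tword_ascending:
  assumes "set us \<subseteq> {a..<b}" "inv_no a b (w \<circ> word_perm us) = inv_no a b w + length us"
  shows "tword us v w = q_half ^ length us * v (w \<circ> word_perm us)"
  using assms
proof (induction us arbitrary: w)
  case (Cons i us)
  have i: "a \<le> i" "i < b" using Cons.prems(1) by auto
  have comp: "w \<circ> word_perm (i # us) = (w \<circ> adj_transp i) \<circ> word_perm us"
    by (simp add: comp_assoc)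
  have le: "inv_no a b w + Suc (length us) \<le> inv_no a b (w \<circ> adj_transp i) + length us"
    using inv_no_word_perm_le[of us a b "w \<circ> adj_transp i"] Cons.prems unfolding comp by simp
  have asc: "w i < w (Suc i)"
  proof (rule ccontr)
    assume "\<not> ?thesis"
    then have "inv_no a b (w \<circ> adj_transp i) \<le> inv_no a b w"
      using inv_no_desc[OF i, of w] comp_adj_transp_eq[of w i] by (cases "w i = w (Suc i)") auto
    then show False using le by simp
  qed
  have "tword us v (w \<circ> adj_transp i) = q_half ^ length us * v (w \<circ> adj_transp i \<circ> word_perm us)"
    by (rule Cons.IH)
      (use Cons.prems inv_no_asc[OF i, of w, OF asc] in \<open>simp_all add: comp[symmetric] del: word_perm_simps o_apply\<close>)
  then show ?case
    using asc unfolding comp by (simp add: tact_def diag_coeff_def swap_coeff_def algebra_simps del: o_apply)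
qed simp

lemma q_half_neq_0 [simp]: "q_half \<noteq> 0"
  by (metis keys_single keys_zero insert_not_empty q_half_def zero_neq_one)

lemma one_plus_q_var_neq_0: "1 + q_var \<noteq> 0"
proof
  assume "1 + q_var = 0"
  then have "Poly_Mapping.lookup (1 + q_var) 0 = 0" by simp
  then show False
    by (simp add: q_var_eq q_half_def mult_single lookup_add lookup_single lookup_one when_def)
qed

lemma inv_no_strict_comp:
  assumes "\<And>i j. a \<le> i \<Longrightarrow> i < j \<Longrightarrow> j \<le> b \<Longrightarrow> w i < (w j :: nat)" "u permutes {a..b}"
  shows "inv_no a b (w \<circ> u) = inv_no a b u"
proof -
  have "w k < w l \<longleftrightarrow> k < l" if "k \<in> {a..b}" "l \<in> {a..b}" for k l
    using assms(1)[of k l] assms(1)[of l k] that by (cases k l rule: linorder_cases) auto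
  moreover have "u k \<in> {a..b}" if "a \<le> k" "k \<le> b" for k
    using that by (simp only: permutes_in_image[OF assms(2)]) simp
  ultimately have "invs a b (w \<circ> u) = invs a b u"
    by (auto simp: invs_def)
  then show ?thesis by (simp add: inv_no_def)
qed

text \<open>Induction on the inversions of \<open>w\<close> inside the interval:
  \<open>tact_interval_op\<close> reduces a descent to the swapped word and makes the row of a word
  with an equal neighbouring pair vanish; increasing words are computed directly.\<close>

lemma interval_op_eq:
  assumes "1 \<le> a" "b \<le> n"
  shows "interval_op n (a, b) v w =
    (if inj_on w {a..b}
     then \<Sum>u | u permutes {a..b}. q_half ^ (inv_no a b w + inv_no a b (w \<circ> u)) * v (w \<circ> u) else 0)"
proof (induction "inv_no a b w" arbitrary: w rule: less_induct)
  case less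
  let ?x = "interval_op n (a, b) v"
  consider (desc) i where "a \<le> i" "i < b" "w (Suc i) < w i"
    | (eq) i where "a \<le> i" "i < b" "w (Suc i) = w i"
    | (strict) "\<And>i. a \<le> i \<Longrightarrow> i < b \<Longrightarrow> w i < w (Suc i)"
    by (meson linorder_neqE_nat)
  then show ?case
  proof cases
    case desc
    let ?w = "w \<circ> adj_transp i"
    note s = adj_transp_permutes[OF desc(1,2)]
    have inv: "inv_no a b w = Suc (inv_no a b ?w)" by (rule inv_no_desc[of a i b w, OF desc])
    have "tact i ?x ?w = q_var * ?x ?w" using tact_interval_op assms desc by simp
    \<comment> \<open>At \<open>?w\<close> position \<open>i\<close> is an ascent, so
      \<open>tact\<close> reduces to its off-diagonal term; one \<open>q_half\<close> then cancels
      because Laurent polynomials have no zero divisors.\<close>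
    then have "q_half * ?x w = q_half * (q_half * ?x ?w)"
      using desc(3) by (simp add: tact_def diag_coeff_def swap_coeff_def q_var_eq algebra_simps)
    then have x: "?x w = q_half * ?x ?w" by simp
    have inj: "inj_on ?w {a..b} \<longleftrightarrow> inj_on w {a..b}"
    proof -
      have "inj_on ?w {a..b} \<longleftrightarrow> inj_on w (adj_transp i ` {a..b})"
        using permutes_inj_on[OF s] comp_inj_on_iff by blast
      then show ?thesis using permutes_image[OF s] by simp
    qed
    have "(\<Sum>u | u permutes {a..b}. q_half ^ (inv_no a b ?w + inv_no a b (?w \<circ> u)) * v (?w \<circ> u))
        = (\<Sum>u | u permutes {a..b}. q_half ^ (inv_no a b ?w + inv_no a b (w \<circ> u)) * v (w \<circ> u))"
      by (rule sum.reindex_bij_witness[where i = "\<lambda>u. adj_transp i \<circ> u" and j = "\<lambda>u. adj_transp i \<circ> u"])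
        (use permutes_compose[OF _ s] in \<open>auto simp: fun_eq_iff comp_def\<close>)
    with less[of ?w] inv x inj show ?thesis
      by (simp add: sum_distrib_left mult.assoc del: o_apply)
  next
    case eq
    have "tact i ?x w = q_var * ?x w" using tact_interval_op assms eq by simp
    then have "- ?x w = q_var * ?x w"
      using eq(3) by (simp add: tact_def diag_coeff_def swap_coeff_def)
    \<comment> \<open>The generator would scale the entry both by -1, from the equal letters, and by
      q.\<close>
    then have "(1 + q_var) * ?x w = 0"
      by (metis add.right_inverse distrib_right mult_1)
    then have "?x w = 0" using one_plus_q_var_neq_0 by simp
    moreover have "\<not> inj_on w {a..b}" using inj_onD[of w "{a..b}" "Suc i" i] eq by auto
    ultimately show ?thesis by simp
  next
    case strict
    have mono: "w i < w j" if "a \<le> i" "i < j" "j \<le> b" for i j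
      by (rule strict_mono_on_interval[of a b]) (use strict that in auto)
    then have inj: "inj_on w {a..b}"
      by (metis atLeastAtMost_iff inj_onI less_irrefl linorder_neqE_nat)
    have w0: "inv_no a b w = 0" by (rule inv_no_eq_0I) (use strict in \<open>auto intro: less_imp_le\<close>)
    have "perm_op n u v w = q_half ^ inv_no a b (w \<circ> u) * v (w \<circ> u)" if u: "u permutes {a..b}" for u
    proof -
      obtain us where us: "set us \<subseteq> {a..<b}" "word_perm us = u" "length us = inv_no a b u"
        using ex_word_perm[OF u] by auto
      have wu: "inv_no a b (w \<circ> u) = inv_no a b u" by (rule inv_no_strict_comp[OF mono u])
      have "perm_op n u = tword us"
        by (rule perm_op_eq) (use us assms inv_no_subinterval[OF u assms] in auto)
      then show ?thesis
        using tword_ascending[of us a b w v] us wu w0 by simp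
    qed
    then show ?thesis using inj w0 by (simp add: interval_op_def del: o_apply)
  qed
qed

section \<open>Traces\<close>

lemma laurent_ring_simps [simp]:
  "carrier laurent_ring = UNIV" "a \<otimes>\<^bsub>laurent_ring\<^esub> b = a * b" "a \<oplus>\<^bsub>laurent_ring\<^esub> b = a + b"
  "\<one>\<^bsub>laurent_ring\<^esub> = 1" "\<zero>\<^bsub>laurent_ring\<^esub> = 0"
  by (simp_all add: laurent_ring_def)

lemma cring_laurent_ring: "cring laurent_ring"
proof (rule cringI)
  show "abelian_group laurent_ring"
  proof (rule abelian_groupI)
    show "\<exists>y\<in>carrier laurent_ring. y \<oplus>\<^bsub>laurent_ring\<^esub> x = \<zero>\<^bsub>laurent_ring\<^esub>" for x
      by (intro bexI[of _ "- x"]) simp_all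
  qed (simp_all add: algebra_simps)
  show "comm_monoid laurent_ring"
    by (rule comm_monoidI) (simp_all add: algebra_simps)
qed (simp add: algebra_simps)

text \<open>Bridge between the record-based \<open>finsum\<close> and the type-class sum. The set
  \<open>S\<close> is there because additivity of \<open>hproj\<close> is known on the carrier of
  the free algebra.\<close>

lemma finsum_hom:
  assumes "abelian_monoid M" "finite A" "\<And>a. a \<in> A \<Longrightarrow> g a \<in> S"
    and "0 \<in> S" "\<And>x y. x \<in> S \<Longrightarrow> y \<in> S \<Longrightarrow> x + y \<in> S"
    and "\<And>x. x \<in> S \<Longrightarrow> h x \<in> carrier M" "h 0 = \<zero>\<^bsub>M\<^esub>"
    and "\<And>x y. x \<in> S \<Longrightarrow> y \<in> S \<Longrightarrow> h (x + y) = h x \<oplus>\<^bsub>M\<^esub> h y"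
  shows "(\<Oplus>\<^bsub>M\<^esub>a\<in>A. h (g a)) = h (\<Sum>a\<in>A. g a :: 'b :: comm_monoid_add)"
proof -
  interpret abelian_monoid M by fact
  have "(\<Sum>a\<in>A. g a) \<in> S \<and> (\<Oplus>\<^bsub>M\<^esub>a\<in>A. h (g a)) = h (\<Sum>a\<in>A. g a)"
    using assms(2,3)
  proof (induction A rule: finite_induct)
    case (insert a A)
    moreover have "(\<Oplus>\<^bsub>M\<^esub>a\<in>insert a A. h (g a)) = h (g a) \<oplus>\<^bsub>M\<^esub> (\<Oplus>\<^bsub>M\<^esub>a\<in>A. h (g a))"
      using insert assms(6) by (intro finsum_insert) auto
    ultimately show ?case using assms(5,8) by simp
  qed (simp_all add: assms)
  then show ?thesis by simp
qed

lemma finsum_laurent_ring: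
  assumes "finite A"
  shows "(\<Oplus>\<^bsub>laurent_ring\<^esub>a\<in>A. g a) = (\<Sum>a\<in>A. g a)"
proof -
  have "abelian_monoid laurent_ring"
    by (rule abelian_group.axioms(1)[OF ring.is_abelian_group[OF cring.axioms(1)[OF cring_laurent_ring]]])
  then show ?thesis
    by (rule finsum_hom[where h = "\<lambda>x. x" and S = UNIV, OF _ assms])
      (simp_all only: laurent_ring_simps UNIV_I)
qed

text \<open>A coordinate map \<open>k\<close> identifies \<open>M\<close> with functions on the finite set \<open>W\<close>.  For two bases the
  change of basis matrices \<open>P\<close> and \<open>Q\<close> are mutually inverse, so \<open>tr C = tr (P C' Q) = tr C'\<close>,
  without any appeal to invariance of the rank.\<close>

lemma module_trace_coordinates:
  fixes M :: "(laurent, 'v, 'k) module_scheme" and W :: "'w set" and k :: "'v \<Rightarrow> 'w \<Rightarrow> laurent"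
  assumes M: "abelian_monoid M" and W: "finite W"
    and smult: "\<And>c x. x \<in> carrier M \<Longrightarrow> c \<odot>\<^bsub>M\<^esub> x \<in> carrier M"
    and k_zero: "\<And>w. w \<in> W \<Longrightarrow> k \<zero>\<^bsub>M\<^esub> w = 0"
    and k_add: "\<And>x y w. x \<in> carrier M \<Longrightarrow> y \<in> carrier M \<Longrightarrow> w \<in> W \<Longrightarrow> k (x \<oplus>\<^bsub>M\<^esub> y) w = k x w + k y w"
    and k_smult: "\<And>c x w. x \<in> carrier M \<Longrightarrow> w \<in> W \<Longrightarrow> k (c \<odot>\<^bsub>M\<^esub> x) w = c * k x w"
    and k_inj: "\<And>x y. x \<in> carrier M \<Longrightarrow> y \<in> carrier M \<Longrightarrow> (\<And>w. w \<in> W \<Longrightarrow> k x w = k y w) \<Longrightarrow> x = y"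
    and e: "\<And>u. u \<in> W \<Longrightarrow> e u \<in> carrier M"
    and k_e: "\<And>u w. u \<in> W \<Longrightarrow> w \<in> W \<Longrightarrow> k (e u) w = (if w = u then 1 else 0)"
    and f: "\<And>x. x \<in> carrier M \<Longrightarrow> f x \<in> carrier M"
    and k_f: "\<And>x w. x \<in> carrier M \<Longrightarrow> w \<in> W \<Longrightarrow> k (f x) w = (\<Sum>u\<in>W. A w u * k x u)"
  shows "module_trace laurent_ring M f = (\<Sum>w\<in>W. A w w)"
proof -
  interpret abelian_monoid M by fact
  have sum_closed: "(\<Oplus>\<^bsub>M\<^esub>b\<in>B. c b \<odot>\<^bsub>M\<^esub> b) \<in> carrier M" if "B \<subseteq> carrier M" for c B
    by (rule finsum_closed) (use that smult in auto)
  have k_sum: "k (\<Oplus>\<^bsub>M\<^esub>b\<in>B. c b \<odot>\<^bsub>M\<^esub> b) w = (\<Sum>b\<in>B. c b * k b w)"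
    if "finite B" "B \<subseteq> carrier M" "w \<in> W" for B c w
    using that
  proof (induction B rule: finite_induct)
    case (insert a B)
    then have "(\<Oplus>\<^bsub>M\<^esub>b\<in>insert a B. c b \<odot>\<^bsub>M\<^esub> b) = c a \<odot>\<^bsub>M\<^esub> a \<oplus>\<^bsub>M\<^esub> (\<Oplus>\<^bsub>M\<^esub>b\<in>B. c b \<odot>\<^bsub>M\<^esub> b)"
      using smult by (intro finsum_insert) auto
    with insert show ?case using smult sum_closed[of B c] by (simp add: k_add k_smult)
  qed (simp add: k_zero)
  have inj_e: "inj_on e W"
    by (rule inj_onI) (metis k_e zero_neq_one)
  define B0 where "B0 = e ` W"
  have B0: "finite B0" "B0 \<subseteq> carrier M" using W e by (auto simp: B0_def)
  have k_B0: "(\<Sum>b\<in>B0. g b * k b w) = g (e w)" if "w \<in> W" for g w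
  proof -
    have "(\<Sum>b\<in>B0. g b * k b w) = (\<Sum>u\<in>W. g (e u) * k (e u) w)"
      by (simp add: B0_def sum.reindex[OF inj_e])
    also have "\<dots> = (\<Sum>u\<in>W. if w = u then g (e u) else 0)"
      by (rule sum.cong[OF refl]) (simp add: k_e that)
    finally show ?thesis using that W by simp
  qed
  have basis: "module_basis laurent_ring M B0"
    unfolding module_basis_def
  proof (intro conjI ballI B0)
    fix x assume x: "x \<in> carrier M"
    define c where "c = restrict (\<lambda>b. k x (inv_into W e b)) B0"
    have ce: "c (e w) = k x w" if "w \<in> W" for w
      using that by (simp add: c_def B0_def inv_into_f_f[OF inj_e])
    show "\<exists>!c. c \<in> (\<Pi>\<^sub>E b\<in>B0. carrier laurent_ring) \<and> x = (\<Oplus>\<^bsub>M\<^esub>b\<in>B0. c b \<odot>\<^bsub>M\<^esub> b)"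
    proof (rule ex1I[of _ c])
      show "c \<in> (\<Pi>\<^sub>E b\<in>B0. carrier laurent_ring) \<and> x = (\<Oplus>\<^bsub>M\<^esub>b\<in>B0. c b \<odot>\<^bsub>M\<^esub> b)"
      proof
        show "x = (\<Oplus>\<^bsub>M\<^esub>b\<in>B0. c b \<odot>\<^bsub>M\<^esub> b)"
          by (rule k_inj[OF x sum_closed[OF B0(2)]]) (simp add: k_sum[OF B0] k_B0 ce)
      qed (simp add: c_def)
    next
      fix d assume d: "d \<in> (\<Pi>\<^sub>E b\<in>B0. carrier laurent_ring) \<and> x = (\<Oplus>\<^bsub>M\<^esub>b\<in>B0. d b \<odot>\<^bsub>M\<^esub> b)"
      then have "k x w = d (e w)" if "w \<in> W" for w
        using k_sum[OF B0 that, of d] k_B0[OF that] by metis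
      then have "d b = c b" if "b \<in> B0" for b using that ce by (auto simp: B0_def)
      then show "d = c"
        using d by (intro PiE_ext[of d B0 "\<lambda>_. UNIV"]) (auto simp: c_def)
    qed
  qed
  have unique: "t = (\<Sum>w\<in>W. A w w)"
    if B: "module_basis laurent_ring M B" and C: "\<forall>b\<in>B. f b = (\<Oplus>\<^bsub>M\<^esub>a\<in>B. C a b \<odot>\<^bsub>M\<^esub> a)"
      and t: "t = (\<Oplus>\<^bsub>laurent_ring\<^esub>b\<in>B. C b b)" for t B C
  proof -
    have fin: "finite B" "B \<subseteq> carrier M" using B by (auto simp: module_basis_def)
    have coord: "\<exists>!c. c \<in> (\<Pi>\<^sub>E b\<in>B. UNIV) \<and> x = (\<Oplus>\<^bsub>M\<^esub>b\<in>B. c b \<odot>\<^bsub>M\<^esub> b)" if "x \<in> carrier M" for x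
      using B that by (simp add: module_basis_def)
    define Q where "Q x = (SOME c. x = (\<Oplus>\<^bsub>M\<^esub>b\<in>B. c b \<odot>\<^bsub>M\<^esub> b))" for x
    have Q: "x = (\<Oplus>\<^bsub>M\<^esub>b\<in>B. Q x b \<odot>\<^bsub>M\<^esub> b)" if "x \<in> carrier M" for x
    proof -
      from coord[OF that] obtain c where "x = (\<Oplus>\<^bsub>M\<^esub>b\<in>B. c b \<odot>\<^bsub>M\<^esub> b)" by (elim ex1E conjE)
      then show ?thesis
        unfolding Q_def by (rule someI[where P = "\<lambda>c. x = (\<Oplus>\<^bsub>M\<^esub>b\<in>B. c b \<odot>\<^bsub>M\<^esub> b)"])
    qed
    have Q_unique: "c b = d b"
      if "\<And>w. w \<in> W \<Longrightarrow> (\<Sum>b\<in>B. c b * k b w) = (\<Sum>b\<in>B. d b * k b w)" "b \<in> B" for c d b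
    proof -
      have "(\<Oplus>\<^bsub>M\<^esub>b\<in>B. c b \<odot>\<^bsub>M\<^esub> b) = (\<Oplus>\<^bsub>M\<^esub>b\<in>B. d b \<odot>\<^bsub>M\<^esub> b)"
        by (rule k_inj) (use that(1) sum_closed[OF fin(2)] k_sum[OF fin] in auto)
      \<comment> \<open>\<open>module_basis\<close> promises uniqueness among coefficient functions
        that are \<open>undefined\<close> off \<open>B\<close>, hence the restriction.\<close>
      moreover have "(\<Oplus>\<^bsub>M\<^esub>b\<in>B. restrict c B b \<odot>\<^bsub>M\<^esub> b) = (\<Oplus>\<^bsub>M\<^esub>b\<in>B. c b \<odot>\<^bsub>M\<^esub> b)" for c
        by (rule finsum_cong') (use fin smult in auto)
      ultimately have eq: "(\<Oplus>\<^bsub>M\<^esub>b\<in>B. restrict c B b \<odot>\<^bsub>M\<^esub> b) = (\<Oplus>\<^bsub>M\<^esub>b\<in>B. restrict d B b \<odot>\<^bsub>M\<^esub> b)"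
        by simp
      define x where "x = (\<Oplus>\<^bsub>M\<^esub>b\<in>B. restrict c B b \<odot>\<^bsub>M\<^esub> b)"
      have "x \<in> carrier M" unfolding x_def by (rule sum_closed[OF fin(2)])
      define P where "P c \<longleftrightarrow> c \<in> (\<Pi>\<^sub>E b\<in>B. UNIV) \<and> x = (\<Oplus>\<^bsub>M\<^esub>b\<in>B. c b \<odot>\<^bsub>M\<^esub> b)" for c
      have "\<exists>!c. P c" unfolding P_def by (rule coord) fact
      moreover have "P (restrict c B)" "P (restrict d B)"
        using eq by (simp_all add: P_def x_def)
      ultimately have "restrict c B = restrict d B" by blast
      with that(2) show ?thesis by (metis restrict_apply')
    qed
    have kQ: "k x w = (\<Sum>b\<in>B. Q x b * k b w)" if "x \<in> carrier M" "w \<in> W" for x w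
      by (subst Q[OF that(1)]) (rule k_sum[OF fin that(2)])
    \<comment> \<open>Both sides are coordinates of the same element \<open>b\<close> with respect
      to \<open>B\<close>: expand \<open>b\<close> in the \<open>e w\<close>, then each
      \<open>e w\<close> in \<open>B\<close>.\<close>
    have QP: "(\<Sum>w\<in>W. k b w * Q (e w) a) = (if a = b then 1 else 0)" if "a \<in> B" "b \<in> B" for a b
    proof (rule Q_unique[of "\<lambda>a. \<Sum>w\<in>W. k b w * Q (e w) a" "\<lambda>a. if a = b then 1 else 0" a])
      fix v assume v: "v \<in> W"
      have "(\<Sum>a\<in>B. (\<Sum>w\<in>W. k b w * Q (e w) a) * k a v) = (\<Sum>w\<in>W. \<Sum>a\<in>B. k b w * (Q (e w) a * k a v))"
        by (simp add: sum_distrib_right mult.assoc sum.swap[of _ W])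
      also have "\<dots> = (\<Sum>w\<in>W. k b w * k (e w) v)"
        by (intro sum.cong refl) (simp add: sum_distrib_left[symmetric] kQ[OF e v])
      also have "\<dots> = k b v"
        using v W by (simp add: k_e if_distrib cong: if_cong)
      also have "\<dots> = (\<Sum>a\<in>B. (if a = b then 1 else 0) * k a v)"
        using fin that(2) by (simp add: if_distrib[of "\<lambda>x. x * _"] cong: if_cong)
      finally show "(\<Sum>a\<in>B. (\<Sum>w\<in>W. k b w * Q (e w) a) * k a v) = (\<Sum>a\<in>B. (if a = b then 1 else 0) * k a v)" .
    qed fact
    have AP: "(\<Sum>u\<in>W. A w u * k b u) = (\<Sum>a\<in>B. C a b * k a w)" if "w \<in> W" "b \<in> B" for w b
      using k_f[of b w] C k_sum[OF fin that(1), of "\<lambda>a. C a b"] that fin by auto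
    have PQ: "(\<Sum>b\<in>B. k b u * Q (e w) b) = (if u = w then 1 else 0)" if "u \<in> W" "w \<in> W" for u w
      using kQ[OF e[OF that(2)] that(1)] k_e[OF that(2,1)] by (simp add: mult.commute)
    have "(\<Sum>w\<in>W. A w w) = (\<Sum>w\<in>W. \<Sum>u\<in>W. A w u * (\<Sum>b\<in>B. k b u * Q (e w) b))"
      using W by (intro sum.cong refl) (simp add: PQ if_distrib cong: if_cong)
    also have "\<dots> = (\<Sum>w\<in>W. \<Sum>b\<in>B. (\<Sum>u\<in>W. A w u * k b u) * Q (e w) b)"
      by (simp add: sum_distrib_left sum_distrib_right mult.assoc sum.swap[of _ B])
    also have "\<dots> = (\<Sum>w\<in>W. \<Sum>b\<in>B. \<Sum>a\<in>B. C a b * (k a w * Q (e w) b))"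
      by (intro sum.cong refl) (simp add: AP sum_distrib_right mult.assoc)
    also have "\<dots> = (\<Sum>b\<in>B. \<Sum>a\<in>B. C a b * (\<Sum>w\<in>W. k a w * Q (e w) b))"
      by (simp add: sum_distrib_left sum.swap[of _ _ W])
    also have "\<dots> = (\<Sum>b\<in>B. C b b)"
      using fin by (intro sum.cong refl) (simp add: QP if_distrib cong: if_cong)
    finally show ?thesis using t fin by (simp add: finsum_laurent_ring)
  qed
  show ?thesis
    unfolding module_trace_def
  proof (rule the_equality)
    define C where "C a b = A (inv_into W e a) (inv_into W e b)" for a b
    have C: "C (e u) (e w) = A u w" if "u \<in> W" "w \<in> W" for u w
      using that by (simp add: C_def inv_into_f_f[OF inj_e])
    have "f b = (\<Oplus>\<^bsub>M\<^esub>a\<in>B0. C a b \<odot>\<^bsub>M\<^esub> a)" if "b \<in> B0" for b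
    proof (rule k_inj[OF f sum_closed[OF B0(2)]])
      show "k (f b) w = k (\<Oplus>\<^bsub>M\<^esub>a\<in>B0. C a b \<odot>\<^bsub>M\<^esub> a) w" if w: "w \<in> W" for w
      proof -
        obtain u where u: "u \<in> W" "b = e u" using \<open>b \<in> B0\<close> by (auto simp: B0_def)
        have "k (f b) w = A w u" using u w W e by (simp add: k_f k_e if_distrib cong: if_cong)
        then show ?thesis using u w by (simp add: k_sum[OF B0] k_B0 C)
      qed
    qed (use that B0 in auto)
    moreover have "(\<Sum>w\<in>W. A w w) = (\<Oplus>\<^bsub>laurent_ring\<^esub>b\<in>B0. C b b)"
      using B0 by (simp add: finsum_laurent_ring B0_def sum.reindex[OF inj_e] C)
    ultimately show "\<exists>B C. module_basis laurent_ring M B \<and> (\<forall>a\<in>B. \<forall>b\<in>B. C a b \<in> carrier laurent_ring)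
        \<and> (\<forall>b\<in>B. f b = (\<Oplus>\<^bsub>M\<^esub>a\<in>B. C a b \<odot>\<^bsub>M\<^esub> a)) \<and> (\<Sum>w\<in>W. A w w) = (\<Oplus>\<^bsub>laurent_ring\<^esub>b\<in>B. C b b)"
      using basis by auto
  qed (use unique in blast)
qed

section \<open>The free algebra and the Hecke algebra acting on words\<close>

definition ract :: "free_elem \<Rightarrow> word_fun \<Rightarrow> word_fun" where
  "ract x v w = (\<Sum>u\<in>Poly_Mapping.keys x. Poly_Mapping.lookup x u * tword (letters u) v w)"

lemma ract_superset:
  assumes "finite A" "Poly_Mapping.keys x \<subseteq> A"
  shows "ract x v w = (\<Sum>u\<in>A. Poly_Mapping.lookup x u * tword (letters u) v w)"
  unfolding ract_def by (rule sum.mono_neutral_left) (use assms in \<open>auto simp: in_keys_iff\<close>)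

lemma ract_zero [simp]: "ract 0 v w = 0"
  by (simp add: ract_def)

lemma ract_add: "ract (x + y) v w = ract x v w + ract y v w"
proof -
  let ?A = "Poly_Mapping.keys x \<union> Poly_Mapping.keys y"
  have "finite ?A" by simp
  then show ?thesis
    using ract_superset[of ?A x v w] ract_superset[of ?A y v w] ract_superset[of ?A "x + y" v w] keys_add[of x y]
    by (simp add: lookup_add algebra_simps sum.distrib)
qed

lemma ract_diff: "ract (x - y) v w = ract x v w - ract y v w"
  using ract_add[of "x - y" y v w] by simp

lemma ract_uminus: "ract (- x) v w = - ract x v w"
  using ract_diff[of 0 x v w] by simp

lemma ract_sum: "ract (\<Sum>a\<in>A. g a) v w = (\<Sum>a\<in>A. ract (g a) v w)"
  by (induction A rule: infinite_finite_induct) (simp_all add: ract_add)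

lemma ract_single [simp]: "ract (Poly_Mapping.single u c) v w = c * tword (letters u) v w"
  by (cases "c = 0") (simp_all add: ract_def)

lemma poly_mapping_expand: "x = (\<Sum>u\<in>Poly_Mapping.keys x. Poly_Mapping.single u (Poly_Mapping.lookup x u))"
  by (rule poly_mapping_eqI) (simp add: lookup_sum lookup_single when_def sum.delta in_keys_iff)

lemma ract_lin: "ract x (\<lambda>w. \<Sum>k\<in>A. c k * y k w) = (\<lambda>w. \<Sum>k\<in>A. c k * ract x (y k) w)"
proof
  fix w
  have "ract x (\<lambda>w. \<Sum>k\<in>A. c k * y k w) w
      = (\<Sum>u\<in>Poly_Mapping.keys x. \<Sum>k\<in>A. c k * (Poly_Mapping.lookup x u * tword (letters u) (y k) w))"
    by (simp add: ract_def tword_sum sum_distrib_left mult.left_commute)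
  also have "\<dots> = (\<Sum>k\<in>A. \<Sum>u\<in>Poly_Mapping.keys x. c k * (Poly_Mapping.lookup x u * tword (letters u) (y k) w))"
    by (rule sum.swap)
  finally show "ract x (\<lambda>w. \<Sum>k\<in>A. c k * y k w) w = (\<Sum>k\<in>A. c k * ract x (y k) w)"
    by (simp add: ract_def sum_distrib_left)
qed

lemma ract_scale: "ract x (\<lambda>w. c * y w) w = c * ract x y w"
  using ract_lin[of x "\<lambda>_::unit. c" "\<lambda>_. y" UNIV] by (simp add: fun_eq_iff)

lemma ract_zero_fun [simp]: "ract x (\<lambda>w. 0) w = 0"
  using ract_lin[of x "\<lambda>_. 0" "\<lambda>_. undefined" "{}"] by simp

lemma letters_plus [simp]: "letters (u + v) = letters u @ letters v"
  by (simp add: plus_gword_def)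

lemma letters_zero [simp]: "letters 0 = []"
  by (simp add: zero_gword_def)

lemma ract_mult: "ract (x * y) v w = ract x (ract y v) w"
proof -
  let ?X = "Poly_Mapping.keys x" and ?Y = "Poly_Mapping.keys y"
  have xy: "x * y = (\<Sum>a\<in>?X. \<Sum>b\<in>?Y. Poly_Mapping.single a (Poly_Mapping.lookup x a) *
      Poly_Mapping.single b (Poly_Mapping.lookup y b))"
    by (simp flip: sum_product poly_mapping_expand)
  have y: "ract y v = (\<lambda>w. \<Sum>b\<in>?Y. Poly_Mapping.lookup y b * tword (letters b) v w)"
    by (simp add: ract_def fun_eq_iff)
  show ?thesis
    unfolding xy y ract_def[of x] tword_sum
    by (simp add: ract_sum mult_single tword_append sum_distrib_left mult.assoc)
qed

lemma ract_one [simp]: "ract 1 v w = v w"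
  by (simp flip: single_one)

lemma ract_free_gen [simp]: "ract (free_gen i) v w = tact i v w"
  by (simp add: free_gen_def)

lemma ract_free_scalar [simp]: "ract (free_scalar c) v w = c * v w"
  by (simp add: free_scalar_def)

lemma free_scalar_commute: "free_scalar c * x = x * free_scalar c"
proof -
  have "free_scalar c * (\<Sum>u\<in>A. Poly_Mapping.single u (h u)) = (\<Sum>u\<in>A. Poly_Mapping.single u (h u)) * free_scalar c"
    for A and h :: "gword \<Rightarrow> laurent"
    by (simp add: sum_distrib_left sum_distrib_right free_scalar_def mult_single mult.commute)
  then show ?thesis by (metis poly_mapping_expand)
qed

lemma free_scalar_mult: "free_scalar (c * d) = free_scalar c * free_scalar d"
  by (simp add: free_scalar_def mult_single)

lemma free_scalar_add: "free_scalar (c + d) = free_scalar c + free_scalar d"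
  by (simp add: free_scalar_def single_add)

lemma free_scalar_0 [simp]: "free_scalar 0 = 0" and free_scalar_1 [simp]: "free_scalar 1 = 1"
  by (simp_all add: free_scalar_def)

lemma free_scalar_uminus: "free_scalar (- c) = - free_scalar c"
  by (simp add: free_scalar_def single_uminus)

lemma free_scalar_sum: "free_scalar (\<Sum>a\<in>A. g a) = (\<Sum>a\<in>A. free_scalar (g a))"
  by (induction A rule: infinite_finite_induct) (simp_all add: free_scalar_add)

abbreviation "free_carrier n \<equiv> carrier (free_algebra n)"

section \<open>The free algebra as a ring and the ideal of relations\<close>

lemma free_algebra_simps [simp]:
  "a \<otimes>\<^bsub>free_algebra n\<^esub> b = a * b" "a \<oplus>\<^bsub>free_algebra n\<^esub> b = a + b"
  "\<one>\<^bsub>free_algebra n\<^esub> = 1" "\<zero>\<^bsub>free_algebra n\<^esub> = 0"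
  by (simp_all add: free_algebra_def)

lemma free_carrier_iff: "f \<in> free_carrier n \<longleftrightarrow> (\<forall>u \<in> Poly_Mapping.keys f. set (letters u) \<subseteq> {1..<n})"
  by (simp add: free_algebra_def)

lemma free_carrier_add [simp]: "x \<in> free_carrier n \<Longrightarrow> y \<in> free_carrier n \<Longrightarrow> x + y \<in> free_carrier n"
  using keys_add[of x y] by (force simp: free_carrier_iff)

lemma free_carrier_mult [simp]: "x \<in> free_carrier n \<Longrightarrow> y \<in> free_carrier n \<Longrightarrow> x * y \<in> free_carrier n"
  using keys_mult[of x y] by (fastforce simp: free_carrier_iff)

lemma free_carrier_uminus [simp]: "x \<in> free_carrier n \<Longrightarrow> - x \<in> free_carrier n"
  by (simp add: free_carrier_iff in_keys_iff)

lemma free_carrier_diff [simp]: "x \<in> free_carrier n \<Longrightarrow> y \<in> free_carrier n \<Longrightarrow> x - y \<in> free_carrier n"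
  using free_carrier_add[of x n "- y"] by simp

lemma free_carrier_single: "set (letters u) \<subseteq> {1..<n} \<Longrightarrow> Poly_Mapping.single u c \<in> free_carrier n"
  by (cases "c = 0") (simp_all add: free_carrier_iff)

lemma free_carrier_consts [simp]: "0 \<in> free_carrier n" "1 \<in> free_carrier n" "free_scalar c \<in> free_carrier n"
  using free_carrier_single[of 0 n 1] free_carrier_single[of 0 n c]
  by (simp_all add: free_carrier_iff free_scalar_def)

lemma free_carrier_gen [simp]: "i \<in> {1..<n} \<Longrightarrow> free_gen i \<in> free_carrier n"
  by (simp add: free_gen_def free_carrier_single)

lemma free_carrier_sum: "(\<And>a. a \<in> A \<Longrightarrow> g a \<in> free_carrier n) \<Longrightarrow> (\<Sum>a\<in>A. g a) \<in> free_carrier n"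
  by (induction A rule: infinite_finite_induct) simp_all

lemma ring_free_algebra: "ring (free_algebra n)"
proof (rule ringI)
  show "abelian_group (free_algebra n)"
  proof (rule abelian_groupI)
    show "\<exists>y\<in>free_carrier n. y \<oplus>\<^bsub>free_algebra n\<^esub> x = \<zero>\<^bsub>free_algebra n\<^esub>" if "x \<in> free_carrier n" for x
      by (rule bexI[of _ "- x"]) (use that in simp_all)
  qed (simp_all add: add.assoc add.commute)
  show "monoid (free_algebra n)"
    by (rule monoidI) (simp_all add: mult.assoc)
qed (simp_all add: algebra_simps)

lemma a_inv_free_algebra [simp]:
  assumes "x \<in> free_carrier n"
  shows "\<ominus>\<^bsub>free_algebra n\<^esub> x = - x"
proof -
  interpret ring "free_algebra n" by (rule ring_free_algebra)
  show ?thesis using assms by (intro minus_equality) simp_all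
qed

lemma a_minus_free_algebra [simp]:
  "x \<in> free_carrier n \<Longrightarrow> y \<in> free_carrier n \<Longrightarrow> x \<ominus>\<^bsub>free_algebra n\<^esub> y = x - y"
  by (simp add: a_minus_def)

lemma hecke_relators_subset: "hecke_relators n \<subseteq> free_carrier n"
  by (auto simp: hecke_relators_def)

lemma ract_relators: "x \<in> hecke_relators n \<Longrightarrow> ract x v w = 0"
proof -
  have [simp]: "ract (free_gen i) v = tact i v" for i v by (simp add: fun_eq_iff)
  have *: "tact i (tact j (tact i v)) = tact j (tact i (tact j v))" if "\<bar>int i - int j\<bar> = 1" for i j
  proof -
    have "j = Suc i \<or> i = Suc j" using that by linarith
    then show ?thesis using tact_braid by metis
  qed
  have **: "tact i (tact j v) = tact j (tact i v)" if "\<bar>int i - int j\<bar> \<ge> 2" for i j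
    by (rule tact_commute) (use that in linarith)
  assume "x \<in> hecke_relators n"
  then show "ract x v w = 0"
    by (auto simp: hecke_relators_def ract_diff ract_add ract_mult tact_quadratic * **)
qed

lemma hecke_ideal_ideal: "ideal (hecke_ideal n) (free_algebra n)"
  unfolding hecke_ideal_def by (rule ring.genideal_ideal[OF ring_free_algebra hecke_relators_subset])

lemma relators_in_ideal: "hecke_relators n \<subseteq> hecke_ideal n"
  unfolding hecke_ideal_def by (rule ring.genideal_self[OF ring_free_algebra hecke_relators_subset])

text \<open>The elements acting by zero form a two-sided ideal, which contains the relators and
  hence the ideal that they generate.\<close>

lemma ract_hecke_ideal: "x \<in> hecke_ideal n \<Longrightarrow> ract x v w = 0"
proof -
  let ?K = "{x \<in> free_carrier n. \<forall>v w. ract x v w = 0}"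
  interpret ring "free_algebra n" by (rule ring_free_algebra)
  have "ideal ?K (free_algebra n)"
  proof (rule idealI[OF ring_free_algebra])
    show "subgroup ?K (add_monoid (free_algebra n))"
    proof (rule group.subgroupI)
      show "group (add_monoid (free_algebra n))" by (rule a_group)
      show "?K \<noteq> {}" by (auto intro!: exI[of _ 0])
      fix x assume "x \<in> ?K"
      then show "inv\<^bsub>add_monoid (free_algebra n)\<^esub> x \<in> ?K"
        unfolding a_inv_def[symmetric] by (simp add: ract_uminus)
    qed (auto simp: ract_add)
    fix x y assume x: "x \<in> ?K" and y: "y \<in> free_carrier n"
    have 0: "ract x v = (\<lambda>w. 0)" for v using x by (simp add: fun_eq_iff)
    show "y \<otimes>\<^bsub>free_algebra n\<^esub> x \<in> ?K" "x \<otimes>\<^bsub>free_algebra n\<^esub> y \<in> ?K"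
      using x y by (simp_all add: ract_mult 0)
  qed
  moreover have "hecke_relators n \<subseteq> ?K" using hecke_relators_subset ract_relators by blast
  ultimately have "hecke_ideal n \<subseteq> ?K"
    unfolding hecke_ideal_def by (rule genideal_minimal)
  then show "x \<in> hecke_ideal n \<Longrightarrow> ract x v w = 0" by blast
qed

lemma a_inv_laurent_ring: "\<ominus>\<^bsub>laurent_ring\<^esub> c = - c"
proof -
  interpret cring laurent_ring by (rule cring_laurent_ring)
  show ?thesis by (rule minus_equality) simp_all
qed

section \<open>The Hecke algebra as a quotient and its action on words\<close>

definition hproj :: "nat \<Rightarrow> free_elem \<Rightarrow> free_elem set" where
  "hproj n x = hecke_ideal n +>\<^bsub>free_algebra n\<^esub> x"

lemma hproj_ring_hom_ring: "ring_hom_ring (free_algebra n) (hecke n) (hproj n)"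
  unfolding hproj_def[abs_def] hecke_def by (rule ideal.rcos_ring_hom_ring[OF hecke_ideal_ideal])

lemma ring_hecke: "ring (hecke n)"
  unfolding hecke_def by (rule ideal.quotient_is_ring[OF hecke_ideal_ideal])

lemma carrier_hecke: "carrier (hecke n) = hproj n ` free_carrier n"
  by (auto simp: hecke_def FactRing_def A_RCOSETS_def' hproj_def)

lemma hproj_closed [simp]: "x \<in> free_carrier n \<Longrightarrow> hproj n x \<in> carrier (hecke n)"
  by (simp add: carrier_hecke)

lemma hproj_add: "x \<in> free_carrier n \<Longrightarrow> y \<in> free_carrier n \<Longrightarrow> hproj n (x + y) = hproj n x \<oplus>\<^bsub>hecke n\<^esub> hproj n y"
  using ring_hom_add[OF ring_hom_ring.homh[OF hproj_ring_hom_ring], of x n y] by simp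

lemma hproj_mult: "x \<in> free_carrier n \<Longrightarrow> y \<in> free_carrier n \<Longrightarrow> hproj n (x * y) = hproj n x \<otimes>\<^bsub>hecke n\<^esub> hproj n y"
  using ring_hom_mult[OF ring_hom_ring.homh[OF hproj_ring_hom_ring], of x n y] by simp

lemma hproj_one: "hproj n 1 = \<one>\<^bsub>hecke n\<^esub>"
  using ring_hom_one[OF ring_hom_ring.homh[OF hproj_ring_hom_ring], of n] by simp

lemma hproj_zero: "hproj n 0 = \<zero>\<^bsub>hecke n\<^esub>"
proof -
  interpret ring_hom_ring "free_algebra n" "hecke n" "hproj n" by (rule hproj_ring_hom_ring)
  show ?thesis using hom_zero by simp
qed

lemma hproj_uminus: "x \<in> free_carrier n \<Longrightarrow> hproj n (- x) = \<ominus>\<^bsub>hecke n\<^esub> hproj n x"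
proof -
  interpret ring_hom_ring "free_algebra n" "hecke n" "hproj n" by (rule hproj_ring_hom_ring)
  show "x \<in> free_carrier n \<Longrightarrow> ?thesis" using hom_a_inv[of x] by simp
qed

lemma hproj_diff: "x \<in> free_carrier n \<Longrightarrow> y \<in> free_carrier n \<Longrightarrow> hproj n (x - y) = hproj n x \<ominus>\<^bsub>hecke n\<^esub> hproj n y"
  using hproj_add[of x n "- y"] by (simp add: hproj_uminus a_minus_def)

lemma hproj_eq_iff:
  "x \<in> free_carrier n \<Longrightarrow> y \<in> free_carrier n \<Longrightarrow> hproj n x = hproj n y \<longleftrightarrow> x - y \<in> hecke_ideal n"
  using ring.quotient_eq_iff_same_a_r_cos[OF ring_free_algebra hecke_ideal_ideal, of x n y]
  by (simp add: hproj_def)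

lemma hecke_carrierE:
  assumes "X \<in> carrier (hecke n)"
  obtains x where "x \<in> free_carrier n" "X = hproj n x"
  using assms by (auto simp: carrier_hecke)

text \<open>The choice of representative is immaterial because the ideal acts by zero.\<close>

definition hact :: "free_elem set \<Rightarrow> word_fun \<Rightarrow> word_fun" where
  "hact X = ract (SOME x. x \<in> X)"

lemma hact_hproj:
  assumes "x \<in> free_carrier n"
  shows "hact (hproj n x) v w = ract x v w"
proof -
  let ?y = "SOME y. y \<in> hproj n x"
  interpret ideal "hecke_ideal n" "free_algebra n" by (rule hecke_ideal_ideal)
  have "x \<in> hproj n x" unfolding hproj_def by (rule a_rcos_self[OF assms])
  then have "?y \<in> hproj n x" by (rule someI)
  then obtain i where "i \<in> hecke_ideal n" "?y = i + x"
    by (auto simp: hproj_def a_r_coset_def')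
  then show ?thesis by (simp add: hact_def ract_add ract_hecke_ideal)
qed

lemma hact_add:
  "X \<in> carrier (hecke n) \<Longrightarrow> Y \<in> carrier (hecke n) \<Longrightarrow> hact (X \<oplus>\<^bsub>hecke n\<^esub> Y) v w = hact X v w + hact Y v w"
  by (elim hecke_carrierE) (simp add: hact_hproj ract_add flip: hproj_add)

lemma hact_mult:
  assumes "X \<in> carrier (hecke n)" "Y \<in> carrier (hecke n)"
  shows "hact (X \<otimes>\<^bsub>hecke n\<^esub> Y) v w = hact X (hact Y v) w"
proof -
  obtain x y where "x \<in> free_carrier n" "X = hproj n x" "y \<in> free_carrier n" "Y = hproj n y"
    using assms by (elim hecke_carrierE)
  moreover from this have "hact Y v = ract y v" by (simp add: fun_eq_iff hact_hproj)
  ultimately show ?thesis by (simp add: hact_hproj ract_mult flip: hproj_mult)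
qed

lemma hact_uminus: "X \<in> carrier (hecke n) \<Longrightarrow> hact (\<ominus>\<^bsub>hecke n\<^esub> X) v w = - hact X v w"
  by (elim hecke_carrierE) (simp add: hact_hproj ract_uminus flip: hproj_uminus)

lemma hact_one: "hact \<one>\<^bsub>hecke n\<^esub> v w = v w"
  by (simp add: hact_hproj flip: hproj_one)

lemma hact_zero: "hact \<zero>\<^bsub>hecke n\<^esub> v w = 0"
  by (simp add: hact_hproj flip: hproj_zero)

lemma hact_hecke_gen: "i \<in> {1..<n} \<Longrightarrow> hact (hecke_gen n i) v w = tact i v w"
  by (simp add: hecke_gen_def hact_hproj flip: hproj_def)

lemma hact_hecke_scalar: "hact (hecke_scalar n c) v w = c * v w"
  by (simp add: hecke_scalar_def hact_hproj flip: hproj_def)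

lemma hecke_scalar_closed [simp]: "hecke_scalar n c \<in> carrier (hecke n)"
  by (simp add: hecke_scalar_def flip: hproj_def)

lemma hecke_gen_closed [simp]: "i \<in> {1..<n} \<Longrightarrow> hecke_gen n i \<in> carrier (hecke n)"
  by (simp add: hecke_gen_def flip: hproj_def)

text \<open>The constant words span copies of the sign representation, which provides the homomorphism
  chosen in \<open>hecke_sgn\<close>.\<close>

lemma hact_const:
  assumes "X \<in> carrier (hecke n)"
  shows "hact X v (\<lambda>_. c) = hact X (\<lambda>_. 1) (\<lambda>_. c) * v (\<lambda>_. c)"
proof -
  have "tword us v (\<lambda>_. c) = (- 1) ^ length us * v (\<lambda>_. c)" for us v
    by (induction us) (simp_all add: tact_def diag_coeff_def swap_coeff_def)
  then have "ract x v (\<lambda>_. c) = ract x (\<lambda>_. 1) (\<lambda>_. c) * v (\<lambda>_. c)" for x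
    by (simp add: ract_def sum_distrib_right mult.assoc)
  then show ?thesis using assms by (elim hecke_carrierE) (simp add: hact_hproj)
qed

text \<open>\<open>hecke_sgn\<close> is a choice among homomorphisms, so one must be exhibited
  before any property of it is known: the scalar by which an element acts at the constant word
  \<open>0\<close>.\<close>

lemma hecke_sgn:
  shows hecke_sgn_hom: "hecke_sgn n \<in> ring_hom (hecke n) laurent_ring"
    and hecke_sgn_scalar: "hecke_sgn n (hecke_scalar n c) = c"
    and hecke_sgn_gen: "i \<in> {1..<n} \<Longrightarrow> hecke_sgn n (hecke_gen n i) = - 1"
proof -
  let ?P = "\<lambda>\<phi>. \<phi> \<in> ring_hom (hecke n) laurent_ring
     \<and> (\<forall>c. \<phi> (hecke_scalar n c) = c) \<and> (\<forall>i\<in>{1..<n}. \<phi> (hecke_gen n i) = - 1)"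
  have "?P (\<lambda>X. hact X (\<lambda>_. 1) (\<lambda>_. 0))"
  proof (intro conjI ballI allI)
    show "(\<lambda>X. hact X (\<lambda>_. 1) (\<lambda>_. 0)) \<in> ring_hom (hecke n) laurent_ring"
    proof (rule ring_hom_memI)
      fix X Y assume "X \<in> carrier (hecke n)" "Y \<in> carrier (hecke n)"
      then show "hact (X \<otimes>\<^bsub>hecke n\<^esub> Y) (\<lambda>_. 1) (\<lambda>_. 0)
          = hact X (\<lambda>_. 1) (\<lambda>_. 0) \<otimes>\<^bsub>laurent_ring\<^esub> hact Y (\<lambda>_. 1) (\<lambda>_. 0)"
        using hact_const[of X n "hact Y (\<lambda>_. 1)" 0] by (simp add: hact_mult)
    qed (simp_all add: hact_add hact_one)
  qed (simp_all add: hact_hecke_scalar hact_hecke_gen tact_def diag_coeff_def swap_coeff_def)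
  then have "?P (hecke_sgn n)" unfolding hecke_sgn_def by (rule someI[of ?P])
  then show "hecke_sgn n \<in> ring_hom (hecke n) laurent_ring" "hecke_sgn n (hecke_scalar n c) = c"
    "i \<in> {1..<n} \<Longrightarrow> hecke_sgn n (hecke_gen n i) = - 1" by auto
qed

section \<open>The induced module\<close>

definition delta :: "(nat \<Rightarrow> nat) \<Rightarrow> word_fun" where
  "delta f w = (if w = f then 1 else 0)"

definition q_half_inv :: laurent where
  "q_half_inv = Poly_Mapping.single (- 1) 1"

lemma q_half_inv: "q_half_inv * q_half = 1"
  by (simp add: q_half_inv_def q_half_def mult_single)

lemma tact_delta_equal:
  assumes "f i = f (Suc i)"
  shows "tact i (delta f) w = - delta f w"
proof -
  have "w \<circ> adj_transp i = f \<longleftrightarrow> w = f"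
    using comp_adj_transp_eq[of f i] assms by (metis comp_adj_transp_twice)
  then show ?thesis using assms by (auto simp: tact_def delta_def diag_coeff_def swap_coeff_def)
qed

text \<open>The ascent kills the diagonal term, so a generator moves a word to its swap without
  remainder. This is how the other words are reached from \<open>v0\<close>.\<close>

lemma tact_delta_ascent:
  assumes "f i < f (Suc i)"
  shows "tact i (delta f) w = q_half * delta (f \<circ> adj_transp i) w"
proof -
  have eq: "w \<circ> adj_transp i = f \<longleftrightarrow> w = f \<circ> adj_transp i"
    by (metis comp_adj_transp_twice)
  have "w i \<noteq> w (Suc i)" if "w = f \<circ> adj_transp i" using that assms by simp
  then show ?thesis using assms eq by (auto simp: tact_def delta_def diag_coeff_def swap_coeff_def simp del: o_apply)
qed

lemma ract_supported:
  assumes "x \<in> free_carrier n" "\<And>w. w \<notin> words n v0 \<Longrightarrow> v w = 0" "w \<notin> words n v0"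
  shows "ract x v w = 0"
proof -
  have "\<forall>w. w \<notin> words n v0 \<longrightarrow> tword us v w = 0" if "set us \<subseteq> {1..<n}" for us
    using that
  proof (induction us)
    case (Cons i us)
    have "w \<circ> adj_transp i \<notin> words n v0" if "w \<notin> words n v0" for w
      using words_swap[of "w \<circ> adj_transp i" n v0 i] that Cons.prems by auto
    with Cons show ?case by (auto simp: tact_def simp del: o_apply)
  qed (simp add: assms(2))
  then show ?thesis
    using assms(1,3) by (auto simp: ract_def free_carrier_iff intro!: sum.neutral)
qed

text \<open>\<open>v0\<close> is the sorted word whose constant stretches are the blocks of
  \<open>lam\<close>; the generators of the parabolic subalgebra sit at the positions where it does
  not increase.\<close>

locale sign_induction =
  fixes n :: nat and lam :: "nat list" and v0 :: "nat \<Rightarrow> nat"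
  assumes v0_mono: "i \<in> {1..<n} \<Longrightarrow> v0 i \<le> v0 (Suc i)"
    and v0_cut: "i \<in> {1..<n} \<Longrightarrow> v0 i = v0 (Suc i) \<longleftrightarrow> i \<notin> {sum_list (take k lam) | k. 1 \<le> k \<and> k < length lam}"
begin

sublocale H: ring "hecke n" by (rule ring_hecke)

definition L :: "free_elem set set" where
  "L = induced_relations (hecke n) (hecke_scalar n) (hecke_sub n lam) (hecke_sgn n)"

definition L_gens :: "free_elem set set" where
  "L_gens = {(h \<otimes>\<^bsub>hecke n\<^esub> b) \<ominus>\<^bsub>hecke n\<^esub> (h \<otimes>\<^bsub>hecke n\<^esub> hecke_scalar n (hecke_sgn n b)) | h b.
     h \<in> carrier (hecke n) \<and> b \<in> hecke_sub n lam}"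

lemma L_eq: "L = generate (add_monoid (hecke n)) L_gens"
  by (simp add: L_def induced_relations_def L_gens_def)

lemma sub_gens: "range (hecke_scalar n) \<union>
      hecke_gen n ` ({1..<n} - {sum_list (take k lam) | k. 1 \<le> k \<and> k < length lam}) \<subseteq> carrier (hecke n)"
  by auto

lemma hecke_sub_closed: "b \<in> hecke_sub n lam \<Longrightarrow> b \<in> carrier (hecke n)"
  unfolding hecke_sub_def by (rule H.generate_ring_in_carrier[OF sub_gens])

lemma L_gens_subset: "L_gens \<subseteq> carrier (hecke n)"
  using hecke_sub_closed by (auto simp: L_gens_def)

lemma L_subgroup: "abelian_subgroup L (hecke n)"
proof (rule abelian_subgroupI3)
  have "subgroup L (add_monoid (hecke n))"
    unfolding L_eq by (rule group.generate_is_subgroup[OF H.a_group]) (simp add: L_gens_subset)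
  then show "additive_subgroup L (hecke n)" by (rule additive_subgroup.intro)
qed (rule H.abelian_group_axioms)

sublocale Ls: abelian_subgroup L "hecke n" by (rule L_subgroup)

lemma L_induct [consumes 1, case_names zero gen uminus add]:
  assumes "X \<in> L" "P \<zero>\<^bsub>hecke n\<^esub>"
    and "\<And>h b. h \<in> carrier (hecke n) \<Longrightarrow> b \<in> hecke_sub n lam \<Longrightarrow>
      P ((h \<otimes>\<^bsub>hecke n\<^esub> b) \<ominus>\<^bsub>hecke n\<^esub> (h \<otimes>\<^bsub>hecke n\<^esub> hecke_scalar n (hecke_sgn n b)))"
    and "\<And>X. X \<in> L \<Longrightarrow> P X \<Longrightarrow> P (\<ominus>\<^bsub>hecke n\<^esub> X)"
    and "\<And>X Y. X \<in> L \<Longrightarrow> Y \<in> L \<Longrightarrow> P X \<Longrightarrow> P Y \<Longrightarrow> P (X \<oplus>\<^bsub>hecke n\<^esub> Y)"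
  shows "P X"
proof -
  have gen: "P h" if "h \<in> L_gens" for h using that assms(3) by (auto simp: L_gens_def)
  have "X \<in> generate (add_monoid (hecke n)) L_gens" using assms(1) by (simp add: L_eq)
  then show ?thesis
  proof induction
    case one
    then show ?case using assms(2) by simp
  next
    case (incl h)
    then show ?case by (rule gen)
  next
    case (inv h)
    then have "h \<in> L" unfolding L_eq by (rule generate.incl)
    then have "P (\<ominus>\<^bsub>hecke n\<^esub> h)" using gen[OF inv] by (rule assms(4))
    then show ?case by (simp add: a_inv_def)
  next
    case (eng h1 h2)
    then show ?case using assms(5)[of h1 h2] by (simp add: L_eq)
  qed
qed

text \<open>On a generating relation left multiplication merely replaces \<open>h\<close> by a
  multiple, so \<open>L\<close> is a left ideal.\<close>

lemma L_left_closed: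
  assumes "X \<in> L" "h \<in> carrier (hecke n)"
  shows "h \<otimes>\<^bsub>hecke n\<^esub> X \<in> L"
  using assms(1)
proof (induction rule: L_induct)
  case (gen g b)
  have b: "b \<in> carrier (hecke n)" by (rule hecke_sub_closed[OF gen(2)])
  have "h \<otimes>\<^bsub>hecke n\<^esub> (g \<otimes>\<^bsub>hecke n\<^esub> b \<ominus>\<^bsub>hecke n\<^esub> g \<otimes>\<^bsub>hecke n\<^esub> hecke_scalar n (hecke_sgn n b))
      = ((h \<otimes>\<^bsub>hecke n\<^esub> g) \<otimes>\<^bsub>hecke n\<^esub> b) \<ominus>\<^bsub>hecke n\<^esub> ((h \<otimes>\<^bsub>hecke n\<^esub> g) \<otimes>\<^bsub>hecke n\<^esub> hecke_scalar n (hecke_sgn n b))"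
    using assms(2) gen(1) b by (simp add: a_minus_def H.r_distr H.m_assoc H.r_minus)
  also have "\<dots> \<in> L_gens" using assms(2) gen by (auto simp: L_gens_def)
  finally show ?case unfolding L_eq by (rule generate.incl)
next
  case (uminus X)
  then show ?case using assms(2) Ls.a_Hcarr[of X] by (simp add: H.r_minus)
next
  case (add X Y)
  then show ?case using assms(2) Ls.a_Hcarr by (simp add: H.r_distr)
qed (use assms(2) in simp)

text \<open>\<open>delta v0\<close> affords the sign representation of the parabolic subalgebra:
  \<open>v0_cut\<close> settles the generators, and the claim passes through the ring
  operations.\<close>

lemma hact_sub:
  assumes "b \<in> hecke_sub n lam"
  shows "hact b (delta v0) w = hecke_sgn n b * delta v0 w"
proof -
  interpret sgn: ring_hom_ring "hecke n" laurent_ring "hecke_sgn n"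
    by (rule ring_hom_ringI2[OF ring_hecke cring.axioms(1)[OF cring_laurent_ring] hecke_sgn_hom])
  have uminus: "hecke_sgn n (\<ominus>\<^bsub>hecke n\<^esub> X) = - hecke_sgn n X" if "X \<in> carrier (hecke n)" for X
    using sgn.hom_a_inv[OF that] by (simp add: a_inv_laurent_ring)
  show ?thesis
    using assms unfolding hecke_sub_def
  proof (induction arbitrary: w)
    case one
    then show ?case using sgn.hom_one by (simp add: hact_one)
  next
    case (incl h)
    then consider c where "h = hecke_scalar n c"
      | i where "i \<in> {1..<n}" "v0 i = v0 (Suc i)" "h = hecke_gen n i"
      using v0_cut by blast
    then show ?case
      by cases (simp_all add: hact_hecke_scalar hecke_sgn_scalar hact_hecke_gen hecke_sgn_gen tact_delta_equal)
  next
    case (a_inv h)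
    then have "h \<in> carrier (hecke n)" using hecke_sub_closed by (simp add: hecke_sub_def)
    with a_inv show ?case by (simp add: hact_uminus uminus a_inv_laurent_ring)
  next
    case (eng_add h1 h2)
    then have "h1 \<in> carrier (hecke n)" "h2 \<in> carrier (hecke n)" using hecke_sub_closed by (simp_all add: hecke_sub_def)
    with eng_add show ?case using sgn.hom_add[of h1 h2] by (simp add: hact_add algebra_simps)
  next
    case (eng_mult h1 h2)
    then have c: "h1 \<in> carrier (hecke n)" "h2 \<in> carrier (hecke n)" using hecke_sub_closed by (simp_all add: hecke_sub_def)
    have "hact h1 (\<lambda>w. hecke_sgn n h2 * delta v0 w) w = hecke_sgn n h2 * hact h1 (delta v0) w"
      unfolding hact_def by (rule ract_scale)
    moreover have "hact h2 (delta v0) = (\<lambda>w. hecke_sgn n h2 * delta v0 w)"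
      by (rule ext) (rule eng_mult.IH(2))
    ultimately show ?case
      using c eng_mult.IH(1) sgn.hom_mult[of h1 h2] by (simp add: hact_mult mult.left_commute mult.commute)
  qed
qed

text \<open>Application to \<open>delta v0\<close> thereby factors through the induced module; this
  is the universal property of the tensor product.\<close>

lemma hact_L:
  assumes "X \<in> L"
  shows "hact X (delta v0) w = 0"
  using assms
proof (induction rule: L_induct)
  case (gen h b)
  have b: "b \<in> carrier (hecke n)" by (rule hecke_sub_closed[OF gen(2)])
  have "hact b (delta v0) = hact (hecke_scalar n (hecke_sgn n b)) (delta v0)"
    by (simp add: fun_eq_iff hact_sub[OF gen(2)] hact_hecke_scalar)
  then show ?case using gen(1) b by (simp add: a_minus_def hact_add hact_uminus hact_mult)
next
  case (uminus X)
  then show ?case using Ls.a_Hcarr by (simp add: hact_uminus)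
next
  case (add X Y)
  then show ?case using Ls.a_Hcarr by (simp add: hact_add)
qed (simp add: hact_zero)

text \<open>Working in the free algebra modulo \<open>K\<close> avoids cosets of cosets.\<close>

definition K :: "free_elem set" where
  "K = {x \<in> free_carrier n. hproj n x \<in> L}"

lemma K_zero [simp]: "0 \<in> K"
  by (simp add: K_def hproj_zero)

lemma K_add: "x \<in> K \<Longrightarrow> y \<in> K \<Longrightarrow> x + y \<in> K"
  by (simp add: K_def hproj_add)

lemma K_uminus: "x \<in> K \<Longrightarrow> - x \<in> K"
  by (simp add: K_def hproj_uminus)

lemma K_diff: "x \<in> K \<Longrightarrow> y \<in> K \<Longrightarrow> x - y \<in> K"
  using K_add[of x "- y"] K_uminus[of y] by simp

lemma K_left: "x \<in> K \<Longrightarrow> a \<in> free_carrier n \<Longrightarrow> a * x \<in> K"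
  by (simp add: K_def hproj_mult L_left_closed)

lemma K_sum: "(\<And>a. a \<in> A \<Longrightarrow> g a \<in> K) \<Longrightarrow> (\<Sum>a\<in>A. g a) \<in> K"
  by (induction A rule: infinite_finite_induct) (simp_all add: K_add)

text \<open>\<open>K\<close> is closed under left multiplication; right multiples of a relator lie
  in it because they already vanish in the Hecke algebra.\<close>

lemma K_ideal:
  assumes "r \<in> hecke_relators n" "x \<in> free_carrier n"
  shows "r * x \<in> K"
proof -
  have r: "r \<in> hecke_ideal n" using relators_in_ideal assms(1) by blast
  then have "r * x \<in> hecke_ideal n"
    using ideal.I_r_closed[OF hecke_ideal_ideal r, of x] assms(2) by simp
  moreover have c: "r * x \<in> free_carrier n" using hecke_relators_subset[of n] assms by (intro free_carrier_mult) blast+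
  ultimately have "hproj n (r * x) = \<zero>\<^bsub>hecke n\<^esub>"
    using hproj_eq_iff[of "r * x" n 0] by (simp add: hproj_zero)
  then show ?thesis using c by (simp add: K_def)
qed

lemma ract_K: "x \<in> K \<Longrightarrow> ract x (delta v0) w = 0"
  using hact_L[of "hproj n x" w] by (simp add: K_def hact_hproj)

text \<open>The defining relation of \<open>L\<close> with \<open>h\<close> the unit and
  \<open>b\<close> the generator, read in the free algebra.\<close>

lemma gen_plus_one_K:
  assumes "i \<in> {1..<n}" "v0 i = v0 (Suc i)"
  shows "free_gen i + 1 \<in> K"
proof -
  have i: "hecke_gen n i \<in> hecke_sub n lam"
    unfolding hecke_sub_def by (rule generate_ring.incl) (use assms v0_cut in blast)
  have sgn: "hecke_sgn n (hecke_gen n i) = - 1" by (rule hecke_sgn_gen[OF assms(1)])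
  have eqs: "hecke_gen n i = hproj n (free_gen i)" "hecke_scalar n c = hproj n (free_scalar c)" for c
    by (simp_all add: hecke_gen_def hecke_scalar_def hproj_def)
  have "hproj n (1 * free_gen i - 1 * free_scalar (- 1))
     = \<one>\<^bsub>hecke n\<^esub> \<otimes>\<^bsub>hecke n\<^esub> hecke_gen n i \<ominus>\<^bsub>hecke n\<^esub> \<one>\<^bsub>hecke n\<^esub> \<otimes>\<^bsub>hecke n\<^esub> hecke_scalar n (hecke_sgn n (hecke_gen n i))"
    unfolding sgn unfolding eqs hproj_one[symmetric] using assms(1) by (simp flip: hproj_mult hproj_diff)
  also have "\<dots> \<in> L_gens" unfolding L_gens_def using i H.one_closed by blast
  finally have "hproj n (1 * free_gen i - 1 * free_scalar (- 1)) \<in> L"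
    unfolding L_eq by (rule generate.incl)
  then show ?thesis using assms(1) by (simp add: K_def free_scalar_uminus)
qed

text \<open>The factor \<open>q_half_inv\<close> compensates the \<open>q_half\<close> of
  \<open>tact_delta_ascent\<close>, so that \<open>fam f\<close> will carry \<open>delta v0\<close>
  to \<open>delta f\<close> exactly.\<close>

definition tgen :: "nat \<Rightarrow> free_elem \<Rightarrow> free_elem" where
  "tgen i x = free_scalar q_half_inv * (free_gen i * x)"

lemma tgen_diff: "tgen i x - tgen i y = free_scalar q_half_inv * free_gen i * (x - y)"
  by (simp add: tgen_def algebra_simps)

lemma gen_scalar: "free_gen i * (free_scalar c * x) = free_scalar c * (free_gen i * x)"
  using free_scalar_commute[of c "free_gen i"] by (simp flip: mult.assoc)

lemma scalar_scalar: "free_scalar c * (free_scalar d * x) = free_scalar d * (free_scalar c * x)"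
  using free_scalar_commute[of c "free_scalar d"] by (simp flip: mult.assoc)

lemma K_trans: "x - y \<in> K \<Longrightarrow> y - z \<in> K \<Longrightarrow> x - z \<in> K"
  using K_add[of "x - y" "y - z"] by simp

lemma K_sym: "x - y \<in> K \<Longrightarrow> y - x \<in> K"
  using K_uminus[of "x - y"] by simp

text \<open>The braid relations are homogeneous, so the factors \<open>q_half_inv\<close> come out
  as a common scalar and a relator times \<open>x\<close> remains. \<open>neg\<close> carries
  \<open>q_half_inv\<close> because \<open>tgen\<close> is scaled while the sign relation is
  not.\<close>

sublocale W: word_operators n tgen "\<lambda>x. - (free_scalar q_half_inv * x)" "\<lambda>x y. x - y \<in> K" "free_carrier n" v0 1
proof unfold_locales
  fix i j x assume i: "i \<in> {1..<n}" and j: "j \<in> {1..<n}" "Suc i < j" and x: "x \<in> free_carrier n"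
  have "free_gen i * free_gen j - free_gen j * free_gen i \<in> hecke_relators n"
    unfolding hecke_relators_def using i j by (intro UnI2 CollectI exI[of _ i] exI[of _ j]) simp
  from K_left[OF K_ideal[OF this x], of "free_scalar (q_half_inv * q_half_inv)"]
  show "tgen i (tgen j x) - tgen j (tgen i x) \<in> K"
    by (simp add: tgen_def gen_scalar free_scalar_mult left_diff_distrib right_diff_distrib mult.assoc)
next
  fix i x assume i: "i \<in> {1..<n}" "Suc i \<in> {1..<n}" and x: "x \<in> free_carrier n"
  let ?j = "Suc i"
  have "free_gen i * free_gen ?j * free_gen i - free_gen ?j * free_gen i * free_gen ?j \<in> hecke_relators n"
    unfolding hecke_relators_def using i by (intro UnI1 UnI2 CollectI exI[of _ i] exI[of _ ?j]) simp
  from K_left[OF K_ideal[OF this x], of "free_scalar (q_half_inv * (q_half_inv * q_half_inv))"]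
  show "tgen i (tgen ?j (tgen i x)) - tgen ?j (tgen i (tgen ?j x)) \<in> K"
    by (simp add: tgen_def gen_scalar free_scalar_mult left_diff_distrib right_diff_distrib mult.assoc)
next
  fix i x assume i: "i \<in> {1..<n}" "x \<in> free_carrier n"
  from i have "tgen i (- (free_scalar q_half_inv * x)) = - (free_scalar q_half_inv * tgen i x)"
    by (simp add: tgen_def gen_scalar)
  then show "tgen i (- (free_scalar q_half_inv * x)) - - (free_scalar q_half_inv * tgen i x) \<in> K"
    by simp
next
  fix i assume i: "i \<in> {1..<n}" "v0 i = v0 (Suc i)"
  from K_left[OF gen_plus_one_K[OF i], of "free_scalar q_half_inv"]
  show "tgen i 1 - - (free_scalar q_half_inv * 1) \<in> K"
    by (simp add: tgen_def algebra_simps)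
next
  fix i x y assume i: "i \<in> {1..<n}" "x - y \<in> K"
  then show "tgen i x - tgen i y \<in> K"
    unfolding tgen_diff by (intro K_left) auto
next
  fix x y assume "x - y \<in> K"
  then show "- (free_scalar q_half_inv * x) - - (free_scalar q_half_inv * y) \<in> K"
    using K_left[OF K_uminus[of "x - y"], of "free_scalar q_half_inv"] by (simp add: algebra_simps)
next
  fix x y assume "x - y \<in> K"
  then show "y - x \<in> K" by (rule K_sym)
next
  fix x y z assume "x - y \<in> K" "y - z \<in> K"
  then show "x - z \<in> K" by (rule K_trans)
qed (simp_all add: tgen_def v0_mono)

lemma scalar_cancel: "free_scalar q_half * (free_scalar q_half_inv * x) = x"
  using q_half_inv by (simp add: mult.commute flip: mult.assoc free_scalar_mult)

text \<open>Equal letters and ascents are \<open>fam_equal\<close> and \<open>fam_descent\<close>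
  with the scaling undone; at a descent the generator meets itself and the quadratic relation is
  needed.\<close>

lemma gen_fam:
  assumes f: "f \<in> words n v0" and i: "i \<in> {1..<n}"
  shows "free_gen i * W.fam f -
    (free_scalar (diag_coeff i f) * W.fam f + free_scalar (swap_coeff i f) * W.fam (f \<circ> adj_transp i)) \<in> K"
proof (cases "f i" "f (Suc i)" rule: linorder_cases)
  case equal
  from K_left[OF W.fam_equal[OF f i equal], of "free_scalar q_half"] show ?thesis
    using equal by (simp add: tgen_def distrib_left scalar_cancel diag_coeff_def swap_coeff_def free_scalar_uminus)
next
  case less
  let ?g = "f \<circ> adj_transp i"
  have "W.fam ?g - tgen i (W.fam f) \<in> K"
    using W.fam_descent[OF words_swap[OF f i] i] less by simp
  from K_left[OF this, of "free_scalar q_half"]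
  have "free_scalar q_half * W.fam ?g - free_gen i * W.fam f \<in> K"
    by (simp add: tgen_def right_diff_distrib scalar_cancel)
  from K_sym[OF this] show ?thesis
    using less by (simp add: diag_coeff_def swap_coeff_def)
next
  case greater
  let ?g = "f \<circ> adj_transp i"
  let ?x = "W.fam ?g"
  have 1: "W.fam f - tgen i ?x \<in> K"
    using W.fam_descent[OF f i] greater by simp
  have x: "?x \<in> free_carrier n" by (rule W.fam_closed[OF words_swap[OF f i]])
  \<comment> \<open>The quadratic relator applied to \<open>?x\<close> and scaled by
    \<open>q_half_inv\<close>: the square becomes \<open>free_gen i * tgen i ?x\<close>, and the
    coefficient q becomes \<open>q_half\<close>.\<close>
  have "free_gen i * free_gen i - (free_scalar (q_var - 1) * free_gen i + free_scalar q_var) \<in> hecke_relators n"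
    unfolding hecke_relators_def using i by blast
  from K_left[OF K_ideal[OF this x], of "free_scalar q_half_inv"]
  have 2: "free_scalar q_half_inv * ((free_gen i * free_gen i - (free_scalar (q_var - 1) * free_gen i + free_scalar q_var)) * ?x) \<in> K"
    by simp
  have qq: "free_scalar q_half_inv * (free_scalar q_var * y) = free_scalar q_half * y" for y
  proof -
    have "q_half_inv * q_var = q_half" using q_half_inv by (simp add: q_var_eq flip: mult.assoc)
    then show ?thesis by (simp flip: mult.assoc free_scalar_mult)
  qed
  have 3: "free_gen i * tgen i ?x - (free_scalar (q_var - 1) * tgen i ?x + free_scalar q_half * ?x) \<in> K"
  proof -
    have "free_scalar q_half_inv * ((free_gen i * free_gen i - (free_scalar (q_var - 1) * free_gen i + free_scalar q_var)) * ?x)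
      = free_gen i * tgen i ?x - (free_scalar (q_var - 1) * tgen i ?x + free_scalar q_half * ?x)"
      by (simp add: tgen_def gen_scalar left_diff_distrib distrib_right right_diff_distrib distrib_left
          mult.assoc qq scalar_scalar[of "q_var - 1" q_half_inv])
    with 2 show ?thesis by simp
  qed
  have 4: "free_gen i * (W.fam f - tgen i ?x) \<in> K" using K_left[OF 1] i by simp
  have 5: "free_scalar (q_var - 1) * (W.fam f - tgen i ?x) \<in> K" using K_left[OF 1] by simp
  have "free_gen i * W.fam f - (free_scalar (q_var - 1) * W.fam f + free_scalar q_half * ?x)
     = free_gen i * (W.fam f - tgen i ?x) - free_scalar (q_var - 1) * (W.fam f - tgen i ?x)
       + (free_gen i * tgen i ?x - (free_scalar (q_var - 1) * tgen i ?x + free_scalar q_half * ?x))"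
    by (simp add: right_diff_distrib)
  also have "\<dots> \<in> K" by (rule K_add[OF K_diff[OF 4 5] 3])
  finally show ?thesis using greater by (simp add: diag_coeff_def swap_coeff_def)
qed

text \<open>\<open>Theta\<close> is inverse to \<open>x \<mapsto> x v0\<close> modulo \<open>K\<close>; this yields freeness of the induced module.\<close>

definition Theta :: "word_fun \<Rightarrow> free_elem" where
  "Theta v = (\<Sum>f\<in>words n v0. free_scalar (v f) * W.fam f)"

lemma Theta_tact:
  assumes i: "i \<in> {1..<n}"
  shows "free_gen i * Theta v - Theta (tact i v) \<in> K"
proof -
  let ?s = "\<lambda>f. f \<circ> adj_transp i"
  \<comment> \<open>\<open>swap_coeff i\<close> takes the same value at \<open>f\<close> and at its
    swap, so reindexing moves the swap from coefficients to vectors. Here the symmetric scaling pays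
    off.\<close>
  have swap: "(\<Sum>f\<in>words n v0. free_scalar (swap_coeff i f * v (?s f)) * W.fam f)
      = (\<Sum>f\<in>words n v0. free_scalar (swap_coeff i f * v f) * W.fam (?s f))"
  proof (rule sum.reindex_bij_witness[where i = ?s and j = ?s])
    fix f assume "f \<in> words n v0"
    have "swap_coeff i (?s f) = swap_coeff i f" by (simp add: swap_coeff_def eq_commute)
    then show "free_scalar (swap_coeff i (?s f) * v (?s f)) * W.fam (?s (?s f)) =
        free_scalar (swap_coeff i f * v (?s f)) * W.fam f"
      by (simp del: o_apply)
  qed (use words_swap i in \<open>auto simp del: o_apply\<close>)
  have "Theta (tact i v) = (\<Sum>f\<in>words n v0. free_scalar (diag_coeff i f * v f) * W.fam f)
      + (\<Sum>f\<in>words n v0. free_scalar (swap_coeff i f * v (?s f)) * W.fam f)"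
    by (simp add: Theta_def tact_def free_scalar_add distrib_right sum.distrib del: o_apply)
  also have "\<dots> = (\<Sum>f\<in>words n v0. free_scalar (v f) *
      (free_scalar (diag_coeff i f) * W.fam f + free_scalar (swap_coeff i f) * W.fam (?s f)))"
    unfolding swap sum.distrib[symmetric]
    by (rule sum.cong[OF refl]) (simp only: distrib_left free_scalar_mult mult.assoc scalar_scalar)
  finally have "Theta (tact i v) = \<dots>" .
  moreover have "free_gen i * Theta v = (\<Sum>f\<in>words n v0. free_scalar (v f) * (free_gen i * W.fam f))"
    by (simp add: Theta_def sum_distrib_left gen_scalar)
  ultimately have "free_gen i * Theta v - Theta (tact i v) = (\<Sum>f\<in>words n v0. free_scalar (v f) *
      (free_gen i * W.fam f - (free_scalar (diag_coeff i f) * W.fam f + free_scalar (swap_coeff i f) * W.fam (?s f))))"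
    by (simp add: sum_subtractf right_diff_distrib del: o_apply)
  also have "\<dots> \<in> K"
    by (intro K_sum K_left gen_fam i) auto
  finally show ?thesis .
qed

lemma Theta_lin: "Theta (\<lambda>w. \<Sum>k\<in>A. c k * y k w) = (\<Sum>k\<in>A. free_scalar (c k) * Theta (y k))"
proof -
  have "Theta (\<lambda>w. \<Sum>k\<in>A. c k * y k w) = (\<Sum>f\<in>words n v0. \<Sum>k\<in>A. free_scalar (c k) * (free_scalar (y k f) * W.fam f))"
    by (simp add: Theta_def free_scalar_sum free_scalar_mult sum_distrib_right mult.assoc)
  also have "\<dots> = (\<Sum>k\<in>A. \<Sum>f\<in>words n v0. free_scalar (c k) * (free_scalar (y k f) * W.fam f))"
    by (rule sum.swap)
  finally show ?thesis by (simp add: Theta_def sum_distrib_left)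
qed

lemma Theta_delta: "Theta (delta v0) = 1"
proof -
  have "Theta (delta v0) = (\<Sum>f\<in>words n v0. if f = v0 then W.fam f else 0)"
    unfolding Theta_def by (rule sum.cong) (auto simp: delta_def)
  then show ?thesis by (simp add: W.fam_v0)
qed

lemma word_Theta:
  "set us \<subseteq> {1..<n} \<Longrightarrow> Poly_Mapping.single (GWord us) 1 - Theta (tword us (delta v0)) \<in> K"
proof (induction us)
  case Nil
  then show ?case by (simp add: Theta_delta flip: zero_gword_def)
next
  case (Cons i us)
  have i: "i \<in> {1..<n}" using Cons.prems by simp
  have eq: "Poly_Mapping.single (GWord (i # us)) 1 = free_gen i * Poly_Mapping.single (GWord us) 1"
    by (simp add: free_gen_def mult_single plus_gword_def)
  have "free_gen i * (Poly_Mapping.single (GWord us) 1 - Theta (tword us (delta v0))) \<in> K"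
    using Cons i by (intro K_left) auto
  from K_add[OF this Theta_tact[OF i, of "tword us (delta v0)"]] show ?case
    by (simp add: eq right_diff_distrib)
qed

text \<open>The spanning half: every class is a combination of the \<open>fam f\<close>. It holds
  for words letter by letter, starting from \<open>Theta (delta v0) = 1\<close>, and extends
  linearly.\<close>

lemma Theta_ract:
  assumes "x \<in> free_carrier n"
  shows "x - Theta (ract x (delta v0)) \<in> K"
proof -
  let ?X = "Poly_Mapping.keys x"
  have x: "x = (\<Sum>u\<in>?X. free_scalar (Poly_Mapping.lookup x u) * Poly_Mapping.single u 1)"
    by (subst poly_mapping_expand[of x]) (simp add: free_scalar_def mult_single)
  have "Theta (ract x (delta v0)) = (\<Sum>u\<in>?X. free_scalar (Poly_Mapping.lookup x u) * Theta (tword (letters u) (delta v0)))"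
    unfolding ract_def[abs_def] by (rule Theta_lin)
  then have "x - Theta (ract x (delta v0)) =
      (\<Sum>u\<in>?X. free_scalar (Poly_Mapping.lookup x u) * (Poly_Mapping.single u 1 - Theta (tword (letters u) (delta v0))))"
    by (subst x) (simp add: sum_subtractf right_diff_distrib)
  also have "\<dots> \<in> K"
  proof (intro K_sum K_left)
    fix u assume "u \<in> ?X"
    then show "Poly_Mapping.single u 1 - Theta (tword (letters u) (delta v0)) \<in> K"
      using word_Theta[of "letters u"] assms by (simp add: free_carrier_iff)
  qed simp
  finally show ?thesis .
qed

text \<open>The independence half: \<open>fam f\<close> takes \<open>delta v0\<close> to a single
  word, since \<open>q_half_inv\<close> and \<open>q_half\<close> cancel at each sorting
  step.\<close>

lemma ract_fam: "f \<in> words n v0 \<Longrightarrow> ract (W.fam f) (delta v0) w = delta f w"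
proof (induction "inv_no 1 n f" arbitrary: f w rule: less_induct)
  case less
  from less(2) show ?case
  proof (cases rule: W.fam_cases)
    case 1
    then show ?thesis by simp
  next
    case (2 i)
    let ?g = "f \<circ> adj_transp i"
    have g: "?g \<in> words n v0" by (rule words_swap[OF less(2) 2(1)])
    have "ract (W.fam ?g) (delta v0) = delta ?g"
      using less(1)[OF _ g] inv_no_desc[of 1 i n f] 2 by (simp add: fun_eq_iff[of "ract _ _"])
    then have "ract (W.fam f) (delta v0) w = q_half_inv * tact i (delta ?g) w"
      unfolding 2(3) tgen_def by (simp add: ract_mult)
    also have "tact i (delta ?g) w = q_half * delta f w"
      using tact_delta_ascent[of ?g i w] 2 by simp
    finally show ?thesis by (simp add: q_half_inv flip: mult.assoc)
  qed
qed

section \<open>Classes in the induced module, their coordinates and the trace\<close>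

definition cl :: "free_elem \<Rightarrow> free_elem set set" where
  "cl x = L +>\<^bsub>hecke n\<^esub> hproj n x"

lemma cl_eq_iff:
  assumes "x \<in> free_carrier n" "y \<in> free_carrier n"
  shows "cl x = cl y \<longleftrightarrow> x - y \<in> K"
proof
  assume "cl x = cl y"
  then have "hproj n x \<in> L +>\<^bsub>hecke n\<^esub> hproj n y"
    using Ls.a_rcos_self[of "hproj n x"] assms by (simp add: cl_def)
  then obtain l where l: "l \<in> L" "hproj n x = l \<oplus>\<^bsub>hecke n\<^esub> hproj n y"
    by (auto simp: a_r_coset_def')
  have "hproj n (x - y) = l"
    using assms l Ls.a_Hcarr[OF l(1)] by (simp add: hproj_diff a_minus_def H.a_assoc H.r_neg)
  then show "x - y \<in> K" using l assms by (simp add: K_def)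
next
  assume "x - y \<in> K"
  then have "hproj n (x - y) \<in> L" by (simp add: K_def)
  moreover have "hproj n x = hproj n (x - y) \<oplus>\<^bsub>hecke n\<^esub> hproj n y"
    using hproj_add[of "x - y" n y] assms by simp
  ultimately have "hproj n x \<in> L +>\<^bsub>hecke n\<^esub> hproj n y"
    by (auto simp: a_r_coset_def')
  then show "cl x = cl y"
    unfolding cl_def using H.a_repr_independence[OF _ _ Ls.a_subgroup] assms by simp
qed

definition Ind :: "(laurent, free_elem set set) module" where
  "Ind = induced_module (hecke n) (hecke_scalar n) (hecke_sub n lam) (hecke_sgn n)"

lemma Ind_simps:
  "carrier Ind = cl ` free_carrier n" "\<zero>\<^bsub>Ind\<^esub> = L" "X \<oplus>\<^bsub>Ind\<^esub> Y = X <+>\<^bsub>hecke n\<^esub> Y"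
  "c \<odot>\<^bsub>Ind\<^esub> X = left_action (hecke n) L (hecke_scalar n c) X"
  by (auto simp: Ind_def induced_module_def Let_def cl_def carrier_hecke A_RCOSETS_def' simp flip: L_def)

lemma cl_zero: "cl 0 = L"
  using Ls.a_subset by (simp add: cl_def hproj_zero)

lemma cl_add:
  "x \<in> free_carrier n \<Longrightarrow> y \<in> free_carrier n \<Longrightarrow> cl x \<oplus>\<^bsub>Ind\<^esub> cl y = cl (x + y)"
  by (simp add: Ind_simps cl_def Ls.a_rcos_sum hproj_add)

text \<open>Representatives of a class differ by elements of \<open>K\<close>, which is stable under
  left multiplication, so all members of the union coincide.\<close>

lemma left_action_cl:
  assumes h: "h \<in> free_carrier n" and x: "x \<in> free_carrier n"
  shows "left_action (hecke n) L (hproj n h) (cl x) = cl (h * x)"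
proof -
  have *: "L +>\<^bsub>hecke n\<^esub> (hproj n h \<otimes>\<^bsub>hecke n\<^esub> X) = cl (h * x)" if X: "X \<in> cl x" for X
  proof -
    obtain l where l: "l \<in> L" "X = l \<oplus>\<^bsub>hecke n\<^esub> hproj n x"
      using X by (auto simp: cl_def a_r_coset_def')
    obtain y where y: "y \<in> free_carrier n" "l = hproj n y"
      using Ls.a_Hcarr[OF l(1)] by (rule hecke_carrierE)
    have X_eq: "X = hproj n (y + x)" using l y x by (simp add: hproj_add)
    have "L +>\<^bsub>hecke n\<^esub> (hproj n h \<otimes>\<^bsub>hecke n\<^esub> X) = cl (h * (y + x))"
      unfolding X_eq cl_def using h x y by (simp add: hproj_mult)
    also have "\<dots> = cl (h * x)"
    proof -
      have "y \<in> K" using y l by (simp add: K_def)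
      then have "h * (y + x) - h * x \<in> K"
        using K_left[of y h] h by (simp add: distrib_left)
      then show ?thesis using h x y by (simp add: cl_eq_iff)
    qed
    finally show ?thesis .
  qed
  have "hproj n x \<in> cl x" unfolding cl_def using x by (intro Ls.a_rcos_self) simp
  with * show ?thesis unfolding left_action_def by blast
qed

lemma abelian_monoid_Ind: "abelian_monoid Ind"
proof (rule abelian_monoidI)
  fix X Y Z assume "X \<in> carrier Ind" "Y \<in> carrier Ind" "Z \<in> carrier Ind"
  then show "X \<oplus>\<^bsub>Ind\<^esub> Y \<oplus>\<^bsub>Ind\<^esub> Z = X \<oplus>\<^bsub>Ind\<^esub> (Y \<oplus>\<^bsub>Ind\<^esub> Z)"
    by (auto simp: Ind_simps(1) cl_add add.assoc)
next
  fix X Y assume "X \<in> carrier Ind" "Y \<in> carrier Ind"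
  then show "X \<oplus>\<^bsub>Ind\<^esub> Y \<in> carrier Ind" "X \<oplus>\<^bsub>Ind\<^esub> Y = Y \<oplus>\<^bsub>Ind\<^esub> X"
    by (auto simp: Ind_simps(1) cl_add add.commute)
next
  show "\<zero>\<^bsub>Ind\<^esub> \<in> carrier Ind" unfolding Ind_simps(1,2) cl_zero[symmetric] by simp
next
  fix X assume "X \<in> carrier Ind"
  then show "\<zero>\<^bsub>Ind\<^esub> \<oplus>\<^bsub>Ind\<^esub> X = X"
    unfolding Ind_simps(2) cl_zero[symmetric] by (auto simp: Ind_simps(1) cl_add)
qed

lemma smult_cl: "x \<in> free_carrier n \<Longrightarrow> c \<odot>\<^bsub>Ind\<^esub> cl x = cl (free_scalar c * x)"
  using left_action_cl[of "free_scalar c" x] by (simp add: Ind_simps hecke_scalar_def flip: hproj_def)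

text \<open>Independent of the chosen representative because \<open>K\<close> annihilates
  \<open>delta v0\<close>.\<close>

definition coords :: "free_elem set set \<Rightarrow> word_fun" where
  "coords X = ract (SOME x. x \<in> free_carrier n \<and> cl x = X) (delta v0)"

lemma coords_cl:
  assumes "x \<in> free_carrier n"
  shows "coords (cl x) w = ract x (delta v0) w"
proof -
  let ?P = "\<lambda>y. y \<in> free_carrier n \<and> cl y = cl x"
  have P: "?P (SOME y. ?P y)" by (rule someI[of ?P x]) (use assms in simp)
  then have "(SOME y. ?P y) - x \<in> K" using assms cl_eq_iff by blast
  from ract_K[OF this, of w] show ?thesis by (simp add: coords_def ract_diff)
qed

lemma ract_expand:
  assumes "x \<in> free_carrier n"
  shows "ract x (delta v0) = (\<lambda>w. \<Sum>u\<in>words n v0. ract x (delta v0) u * delta u w)"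
proof
  fix w
  show "ract x (delta v0) w = (\<Sum>u\<in>words n v0. ract x (delta v0) u * delta u w)"
  proof (cases "w \<in> words n v0")
    case True
    then show ?thesis by (simp add: delta_def if_distrib[of "(*) _"] cong: if_cong)
  next
    case False
    then have "ract x (delta v0) w = 0"
      by (intro ract_supported[OF assms, of v0]) (auto simp: delta_def)
    moreover have "(\<Sum>u\<in>words n v0. ract x (delta v0) u * delta u w) = 0"
      using False by (intro sum.neutral) (auto simp: delta_def)
    ultimately show ?thesis by simp
  qed
qed

text \<open>A class is identified by what it does to \<open>delta v0\<close>. The classes of the
  \<open>fam f\<close> are dual to these coordinates by \<open>ract_fam\<close>, and the coordinates
  separate classes by \<open>Theta_ract\<close>; so \<open>h\<close> has the same matrix as on
  words.\<close>

lemma induced_sign_character_eq: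
  assumes h: "h \<in> free_carrier n"
  shows "induced_sign_character n lam (hproj n h) = (\<Sum>w\<in>words n v0. ract h (delta w) w)"
  unfolding induced_sign_character_def induced_character_def
  unfolding Ind_def[symmetric] L_def[symmetric]
proof (rule module_trace_coordinates[where k = coords and e = "\<lambda>f. cl (W.fam f)" and A = "\<lambda>w u. ract h (delta u) w"])
  show "abelian_monoid Ind" by (rule abelian_monoid_Ind)
  show "finite (words n v0)" by simp
  show "c \<odot>\<^bsub>Ind\<^esub> X \<in> carrier Ind" if "X \<in> carrier Ind" for c X
    using that by (auto simp: Ind_simps(1) smult_cl)
  show "coords \<zero>\<^bsub>Ind\<^esub> w = 0" for w
    using coords_cl[of 0 w] by (simp add: Ind_simps(2) cl_zero)
  show "coords (X \<oplus>\<^bsub>Ind\<^esub> Y) w = coords X w + coords Y w" if "X \<in> carrier Ind" "Y \<in> carrier Ind" for X Y w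
    using that by (auto simp: Ind_simps(1) cl_add coords_cl ract_add)
  show "coords (c \<odot>\<^bsub>Ind\<^esub> X) w = c * coords X w" if "X \<in> carrier Ind" for c X w
    using that by (auto simp: Ind_simps(1) smult_cl coords_cl ract_mult)
  show "cl (W.fam f) \<in> carrier Ind" if "f \<in> words n v0" for f
    using that by (simp add: Ind_simps(1) W.fam_closed)
  show "coords (cl (W.fam u)) w = (if w = u then 1 else 0)" if "u \<in> words n v0" for u w
    using that by (simp add: coords_cl W.fam_closed ract_fam delta_def)
  show "left_action (hecke n) L (hproj n h) X \<in> carrier Ind" if "X \<in> carrier Ind" for X
    using that h by (auto simp: Ind_simps(1) left_action_cl)
  show "coords (left_action (hecke n) L (hproj n h) X) w = (\<Sum>u\<in>words n v0. ract h (delta u) w * coords X u)"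
    if X: "X \<in> carrier Ind" for X w
  proof -
    obtain x where x: "x \<in> free_carrier n" "X = cl x" using X by (auto simp: Ind_simps(1))
    have "coords (left_action (hecke n) L (hproj n h) X) w = ract h (ract x (delta v0)) w"
      using h x by (simp add: left_action_cl coords_cl ract_mult)
    also have "\<dots> = (\<Sum>u\<in>words n v0. ract x (delta v0) u * ract h (delta u) w)"
      by (subst ract_expand[OF x(1)], subst ract_lin) simp
    finally show ?thesis using x by (simp add: coords_cl mult.commute)
  qed
  show "X = Y" if X: "X \<in> carrier Ind" and Y: "Y \<in> carrier Ind"
    and eq: "\<And>w. w \<in> words n v0 \<Longrightarrow> coords X w = coords Y w" for X Y
  proof -
    obtain x where x: "x \<in> free_carrier n" "X = cl x" using X by (auto simp: Ind_simps(1))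
    obtain y where y: "y \<in> free_carrier n" "Y = cl y" using Y by (auto simp: Ind_simps(1))
    have "Theta (ract x (delta v0)) = Theta (ract y (delta v0))"
      unfolding Theta_def by (rule sum.cong) (use eq x y in \<open>simp_all add: coords_cl\<close>)
    then have "x - y \<in> K"
      using K_diff[OF Theta_ract[OF x(1)] Theta_ract[OF y(1)]] by simp
    then show ?thesis using x y by (simp add: cl_eq_iff)
  qed
qed

end

section \<open>Closed chains of permutations\<close>

lemma hecke_T_eq:
  assumes "w permutes {1..n}"
  shows "hecke_T n w = hproj n (Poly_Mapping.single (GWord (reduced_word n w)) 1)"
proof -
  have "foldr (\<lambda>i x. hecke_gen n i \<otimes>\<^bsub>hecke n\<^esub> x) us \<one>\<^bsub>hecke n\<^esub> = hproj n (Poly_Mapping.single (GWord us) 1)"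
    if "set us \<subseteq> {1..<n}" for us
    using that
  proof (induction us)
    case Nil
    then show ?case by (simp add: hproj_one flip: zero_gword_def)
  next
    case (Cons i us)
    have eq: "Poly_Mapping.single (GWord (i # us)) 1 = free_gen i * Poly_Mapping.single (GWord us) 1"
      by (simp add: free_gen_def mult_single plus_gword_def)
    show ?case
      using Cons by (simp add: eq hproj_mult free_carrier_single hecke_gen_def flip: hproj_def)
  qed
  then show ?thesis using reduced_word(1)[OF assms] by (simp add: hecke_T_def)
qed

definition C_free :: "nat \<Rightarrow> nat \<times> nat \<Rightarrow> free_elem" where
  "C_free n J = (\<Sum>w | w permutes {fst J..snd J}. Poly_Mapping.single (GWord (reduced_word n w)) 1)"

lemma C_free_closed:
  assumes "1 \<le> fst J" "snd J \<le> n"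
  shows "C_free n J \<in> free_carrier n"
  unfolding C_free_def
  by (rule free_carrier_sum, rule free_carrier_single)
    (use reduced_word(1) permutes_interval_mono[OF _ assms] in auto)

lemma ract_C_free: "ract (C_free n J) v w = interval_op n J v w"
  by (simp add: C_free_def ract_sum interval_op_def perm_op_def)

lemma C_tilde_eq:
  assumes "1 \<le> fst J" "snd J \<le> n"
  shows "C_tilde n J = hproj n (C_free n J)"
proof -
  interpret H: ring "hecke n" by (rule ring_hecke)
  let ?g = "\<lambda>w. Poly_Mapping.single (GWord (reduced_word n w)) (1 :: laurent)"
  let ?P = "{w. w permutes {fst J..snd J}}"
  have closed: "?g w \<in> free_carrier n" if "w \<in> ?P" for w
    using that reduced_word(1) permutes_interval_mono[OF _ assms] by (intro free_carrier_single) auto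
  have "C_tilde n J = (\<Oplus>\<^bsub>hecke n\<^esub>w\<in>?P. hproj n (?g w))"
    unfolding C_tilde_def interval_subgroup_eq[OF assms]
    by (rule H.finsum_cong') (use closed hecke_T_eq permutes_interval_mono[OF _ assms] in auto)
  also have "\<dots> = hproj n (\<Sum>w\<in>?P. ?g w)"
    by (rule finsum_hom[where S = "free_carrier n"])
      (use closed in \<open>auto simp: finite_permutations hproj_zero hproj_add H.abelian_monoid_axioms\<close>)
  finally show ?thesis by (simp add: C_free_def)
qed

lemma hecke_prod_eq:
  assumes "\<forall>J \<in> set Js. 1 \<le> fst J \<and> snd J \<le> n"
  shows "hecke_prod n (map (C_tilde n) Js) = hproj n (prod_list (map (C_free n) Js))
    \<and> prod_list (map (C_free n) Js) \<in> free_carrier n"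
  using assms
proof (induction Js)
  case Nil
  then show ?case by (simp add: hecke_prod_def hproj_one)
next
  case (Cons J Js)
  then show ?case
    by (simp add: hecke_prod_def C_tilde_eq hproj_mult C_free_closed)
qed

lemma ract_prod_C_free: "ract (prod_list (map (C_free n) Js)) v = foldr (interval_op n) Js v"
proof (induction Js)
  case (Cons J Js)
  have "ract (C_free n J) v = interval_op n J v" for v by (simp add: fun_eq_iff ract_C_free)
  then show ?case using Cons by (simp add: fun_eq_iff[of "ract (_ * _) _"] ract_mult)
qed (simp add: fun_eq_iff)

text \<open>From a starting word \<open>c\<close>, the word seen before factor \<open>p\<close> is
  \<open>c \<circ> prefix_comp ts p\<close>; permutations act on positions, hence on the
  right.\<close>

primrec prefix_comp :: "(nat \<Rightarrow> nat) list \<Rightarrow> nat \<Rightarrow> nat \<Rightarrow> nat" where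
  "prefix_comp ts 0 = id"
| "prefix_comp ts (Suc p) = prefix_comp ts p \<circ> ts ! p"

lemma prefix_comp_Cons: "prefix_comp (t # ts) (Suc p) = t \<circ> prefix_comp ts p"
  by (induction p) (simp_all only: prefix_comp.simps comp_id id_comp comp_assoc nth_Cons_0 nth_Cons_Suc)

definition perm_lists :: "(nat \<times> nat) list \<Rightarrow> (nat \<Rightarrow> nat) list set" where
  "perm_lists Js = {ts. list_all2 (\<lambda>t J. t permutes {fst J..snd J}) ts Js}"

lemma perm_lists_simps:
  "perm_lists [] = {[]}"
  "perm_lists (J # Js) = (\<lambda>(t, ts). t # ts) ` ({t. t permutes {fst J..snd J}} \<times> perm_lists Js)"
  by (auto simp: perm_lists_def list_all2_Cons2)

lemma finite_perm_lists: "finite (perm_lists Js)"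
  by (induction Js) (auto simp: perm_lists_simps finite_permutations)

definition chain_ok :: "(nat \<times> nat) list \<Rightarrow> (nat \<Rightarrow> nat) list \<Rightarrow> (nat \<Rightarrow> nat) \<Rightarrow> bool" where
  "chain_ok Js ts c \<longleftrightarrow> (\<forall>p<length Js. inj_on (c \<circ> prefix_comp ts p) {fst (Js ! p)..snd (Js ! p)})"

definition chain_weight :: "(nat \<times> nat) list \<Rightarrow> (nat \<Rightarrow> nat) list \<Rightarrow> (nat \<Rightarrow> nat) \<Rightarrow> nat" where
  "chain_weight Js ts c = (\<Sum>p<length Js. inv_no (fst (Js ! p)) (snd (Js ! p)) (c \<circ> prefix_comp ts p)
     + inv_no (fst (Js ! p)) (snd (Js ! p)) (c \<circ> prefix_comp ts (Suc p)))"

lemma foldr_interval_op: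
  assumes "\<forall>J\<in>set Js. 1 \<le> fst J \<and> snd J \<le> n"
  shows "foldr (interval_op n) Js v c = (\<Sum>ts\<in>perm_lists Js.
    (if chain_ok Js ts c then q_half ^ chain_weight Js ts c else 0) * v (c \<circ> prefix_comp ts (length Js)))"
  using assms
proof (induction Js arbitrary: c)
  case Nil
  then show ?case by (simp add: perm_lists_simps chain_ok_def chain_weight_def)
next
  case (Cons J Js)
  let ?P = "{t. t permutes {fst J..snd J}}"
  let ?inv = "inv_no (fst J) (snd J)"
  let ?F = "\<lambda>Js ts c. (if chain_ok Js ts c then q_half ^ chain_weight Js ts c else 0) * v (c \<circ> prefix_comp ts (length Js))"
  have ok: "chain_ok (J # Js) (t # ts) c \<longleftrightarrow> inj_on c {fst J..snd J} \<and> chain_ok Js ts (c \<circ> t)" for t ts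
    by (simp add: chain_ok_def All_less_Suc2 prefix_comp_Cons comp_assoc del: o_apply prefix_comp.simps(2))
  have wt: "chain_weight (J # Js) (t # ts) c = ?inv c + ?inv (c \<circ> t) + chain_weight Js ts (c \<circ> t)" for t ts
    unfolding chain_weight_def
    by (simp add: sum.lessThan_Suc_shift prefix_comp_Cons comp_assoc del: o_apply prefix_comp.simps(2) sum.lessThan_Suc)
  have F: "?F (J # Js) (t # ts) c = (if inj_on c {fst J..snd J} then q_half ^ (?inv c + ?inv (c \<circ> t)) * ?F Js ts (c \<circ> t) else 0)"
    for t ts
    by (simp add: ok wt power_add prefix_comp_Cons comp_assoc del: o_apply prefix_comp.simps(2))
  have "(\<Sum>ts\<in>perm_lists (J # Js). ?F (J # Js) ts c) = (\<Sum>(t, ts)\<in>?P \<times> perm_lists Js. ?F (J # Js) (t # ts) c)"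
    unfolding perm_lists_simps by (subst sum.reindex) (auto simp: inj_on_def split_beta intro!: sum.cong)
  also have "\<dots> = (\<Sum>t\<in>?P. \<Sum>ts\<in>perm_lists Js. ?F (J # Js) (t # ts) c)"
    by (rule sum.cartesian_product[symmetric])
  also have "\<dots> = (if inj_on c {fst J..snd J} then \<Sum>t\<in>?P. q_half ^ (?inv c + ?inv (c \<circ> t)) *
      foldr (interval_op n) Js v (c \<circ> t) else 0)"
  proof -
    have "foldr (interval_op n) Js v (c \<circ> t) = (\<Sum>ts\<in>perm_lists Js. ?F Js ts (c \<circ> t))" for t
      by (rule Cons.IH) (use Cons.prems in simp)
    then show ?thesis
      unfolding F by (simp add: sum_distrib_left del: o_apply)
  qed
  also have "\<dots> = interval_op n (fst J, snd J) (foldr (interval_op n) Js v) c"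
    by (rule interval_op_eq[symmetric]) (use Cons.prems in auto)
  also have "\<dots> = foldr (interval_op n) (J # Js) v c" by simp
  finally show ?case by (rule sym)
qed

section \<open>Covering path families\<close>

text \<open>A one-point interval is sent to the empty set, since its star has no central
  vertex.\<close>

definition centre_interval :: "nat \<times> nat \<Rightarrow> nat set" where
  "centre_interval J = (if fst J < snd J then {fst J..snd J} else {})"

definition segment :: "nat \<Rightarrow> nat \<times> nat \<Rightarrow> nat \<Rightarrow> nat \<Rightarrow> arc list" where
  "segment p J x y = (if x \<in> centre_interval J then [(Bnd p x, Ctr p), (Ctr p, Bnd (Suc p) y)]
     else [(Bnd p x, Bnd (Suc p) y)])"

text \<open>\<open>y\<close> records the height of the path at each level. The starting level is a
  parameter so that inductions can run from the right end of the network.\<close>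

definition trace_path :: "(nat \<times> nat) list \<Rightarrow> (nat \<Rightarrow> nat) \<Rightarrow> nat \<Rightarrow> arc list" where
  "trace_path Js y p = concat (map (\<lambda>p. segment p (Js ! p) (y p) (y (Suc p))) [p..<length Js])"

lemma trace_path_end: "length Js \<le> p \<Longrightarrow> trace_path Js y p = []"
  by (simp add: trace_path_def)

lemma trace_path_step:
  "p < length Js \<Longrightarrow> trace_path Js y p = segment p (Js ! p) (y p) (y (Suc p)) @ trace_path Js y (Suc p)"
  by (simp add: trace_path_def upt_conv_Cons)

lemma trace_path_cong: "(\<And>r. p \<le> r \<Longrightarrow> y r = z r) \<Longrightarrow> trace_path Js y p = trace_path Js z p"
  unfolding trace_path_def by (intro arg_cong[where f = concat] map_cong) auto

definition admissible :: "nat \<Rightarrow> (nat \<times> nat) list \<Rightarrow> (nat \<Rightarrow> nat) \<Rightarrow> nat \<Rightarrow> bool" where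
  "admissible n Js y p \<longleftrightarrow> (\<forall>r. p \<le> r \<and> r < length Js \<longrightarrow>
     y r \<in> {1..n} \<and> y (Suc r) \<in> {1..n} \<and>
     (if y r \<in> centre_interval (Js ! r) then y (Suc r) \<in> centre_interval (Js ! r) else y (Suc r) = y r))"

lemma count_list_distinct: "distinct xs \<Longrightarrow> count_list xs x = (if x \<in> set xs then 1 else 0)"
  by (induction xs) (auto simp: count_list_0_iff)

lemma card_Collect_eq_1_iff: "card {x. P x} = 1 \<longleftrightarrow> (\<exists>!x. P x)"
proof -
  have "card {x. P x} = 1 \<longleftrightarrow> (\<exists>a. \<forall>x. P x \<longleftrightarrow> x = a)"
    by (simp add: card_1_singleton_iff set_eq_iff)
  then show ?thesis by metis
qed

text \<open>An arc repeated later would repeat its tail. Multiplicities on a simple path are thus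
  \<open>0\<close> or \<open>1\<close>, which turns \<open>covers\<close> into unique
  existence.\<close>

lemma distinct_pawalk_verts:
  fixes es :: "arc list"
  shows "distinct (pawalk_verts u es) \<Longrightarrow> pcas u es v \<Longrightarrow> distinct es"
proof (induction es arbitrary: u)
  case (Cons e es)
  have "fst e' \<in> set (pawalk_verts w fs)" if "e' \<in> set fs" for e' w and fs :: "arc list"
    using that by (induction fs arbitrary: w) auto
  from this[of e es "snd e"] Cons show ?case by auto
qed simp

locale star_net =
  fixes n :: nat and Js :: "(nat \<times> nat) list"
  assumes bounds: "J \<in> set Js \<Longrightarrow> 1 \<le> fst J \<and> fst J \<le> snd J \<and> snd J \<le> n"
begin

abbreviation m :: nat where "m \<equiv> length Js"

abbreviation I :: "nat \<Rightarrow> nat set" where "I p \<equiv> centre_interval (Js ! p)"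

lemma I_subset: "p < m \<Longrightarrow> I p \<subseteq> {1..n}"
  using bounds[of "Js ! p"] by (auto simp: centre_interval_def)

lemma arc_iff:
  "e \<in> parcs (network n Js) \<longleftrightarrow> (\<exists>p i. p < m \<and>
     (i \<in> {1..n} - I p \<and> e = (Bnd p i, Bnd (Suc p) i) \<or> i \<in> I p \<and> e = (Bnd p i, Ctr p)
      \<or> i \<in> I p \<and> e = (Ctr p, Bnd (Suc p) i)))"
  by (auto simp: network_def star_network_def Let_def centre_interval_def)

lemma Bnd_vertex: "p \<le> m \<Longrightarrow> i \<in> {1..n} \<Longrightarrow> Bnd p i \<in> pverts (network n Js)"
proof (cases p)
  case (Suc r)
  assume "p \<le> m" "i \<in> {1..n}"
  then have "Bnd p i \<in> pverts (star_network n r (Js ! r))" "r < m"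
    using Suc by (simp_all add: star_network_def Let_def)
  then show ?thesis by (auto simp: network_def)
qed (simp add: network_def)

lemma apath_iff_pcas:
  "pre_digraph.apath (with_proj (network n Js)) u es v \<longleftrightarrow>
     u \<in> pverts (network n Js) \<and> set es \<subseteq> parcs (network n Js) \<and> pcas u es v \<and> distinct (pawalk_verts u es)"
  unfolding pre_digraph.apath_def pre_digraph.awalk_def cas_with_proj_eq awalk_verts_with_proj_eq with_proj_simps
  by auto

text \<open>Induction on the length rather than the structure of the list, because a visit to a
  central vertex uses two arcs.\<close>

lemma pcas_imp_trace_path:
  assumes "pcas (Bnd p x) es (Bnd m k)" "set es \<subseteq> parcs (network n Js)" "p \<le> m" "x \<in> {1..n}"
  shows "\<exists>y. y p = x \<and> y m = k \<and> admissible n Js y p \<and> es = trace_path Js y p"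
  using assms
proof (induction es arbitrary: p x rule: length_induct)
  case (1 es)
  show ?case
  proof (cases es)
    case Nil
    then have "p = m" "x = k" using 1(2) by auto
    with Nil show ?thesis
      by (intro exI[of _ "\<lambda>_. x"]) (auto simp: admissible_def trace_path_end)
  next
    case (Cons e fs)
    then have e: "e \<in> parcs (network n Js)" "fst e = Bnd p x" and fs: "set fs \<subseteq> parcs (network n Js)"
      "pcas (snd e) fs (Bnd m k)" using 1(2,3) by auto
    have extend: ?thesis
      if p: "p < m" and gs: "length gs < length es" "pcas (Bnd (Suc p) x') gs (Bnd m k)" "set gs \<subseteq> parcs (network n Js)"
        and x': "x' \<in> {1..n}" "if x \<in> I p then x' \<in> I p else x' = x"
        and es: "es = segment p (Js ! p) x x' @ gs" for x' gs
    proof -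
      obtain y where y: "y (Suc p) = x'" "y m = k" "admissible n Js y (Suc p)" "gs = trace_path Js y (Suc p)"
        using 1(1)[rule_format, OF gs(1), of "Suc p" x'] gs x' p by auto
      \<comment> \<open>The trace from level \<open>Suc p\<close> on does not look at the height at
        level \<open>p\<close>, which may therefore be set afterwards.\<close>
      let ?y = "y(p := x)"
      have "trace_path Js ?y (Suc p) = gs" using y(4) trace_path_cong[of "Suc p" ?y y Js] by simp
      then have "es = trace_path Js ?y p" using es y(1) p by (simp add: trace_path_step)
      moreover have "admissible n Js ?y p"
        unfolding admissible_def
      proof (intro allI impI)
        fix r assume r: "p \<le> r \<and> r < m"
        show "?y r \<in> {1..n} \<and> ?y (Suc r) \<in> {1..n} \<and> (if ?y r \<in> I r then ?y (Suc r) \<in> I r else ?y (Suc r) = ?y r)"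
          using y(1,3) x' 1(5) r by (cases "r = p") (auto simp: admissible_def)
      qed
      moreover have "?y p = x" "?y m = k" using y(2) p by simp_all
      ultimately show ?thesis by blast
    qed
    from e consider (out) "p < m" "x \<in> {1..n} - I p" "e = (Bnd p x, Bnd (Suc p) x)"
      | (inn) "p < m" "x \<in> I p" "e = (Bnd p x, Ctr p)"
      by (auto simp: arc_iff)
    then show ?thesis
    proof cases
      case out
      then show ?thesis
        using extend[of fs x] fs Cons by (auto simp: segment_def)
    next
      case inn
      then obtain e' gs where gs: "fs = e' # gs" using fs by (cases fs) auto
      then have e': "e' \<in> parcs (network n Js)" "fst e' = Ctr p" using fs inn by auto
      then obtain x' where x': "e' = (Ctr p, Bnd (Suc p) x')" "x' \<in> I p" by (auto simp: arc_iff)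
      then show ?thesis
        using extend[of gs x'] fs Cons gs inn subsetD[OF I_subset, of p x'] by (auto simp: segment_def)
    qed
  qed
qed

text \<open>The exact vertex set belongs to the induction because simplicity of the path needs it:
  all later vertices have a higher level.\<close>

lemma trace_path_apath_aux:
  assumes "admissible n Js y p" "p \<le> m"
  shows "pcas (Bnd p (y p)) (trace_path Js y p) (Bnd m (y m)) \<and> set (trace_path Js y p) \<subseteq> parcs (network n Js)
    \<and> distinct (pawalk_verts (Bnd p (y p)) (trace_path Js y p))
    \<and> set (pawalk_verts (Bnd p (y p)) (trace_path Js y p)) =
        {Bnd r (y r) | r. p \<le> r \<and> r \<le> m} \<union> {Ctr r | r. p \<le> r \<and> r < m \<and> y r \<in> I r}"
  using assms(2,1)
proof (induction p rule: inc_induct)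
  case base
  then show ?case by (auto simp: trace_path_end)
next
  case (step p)
  have adm: "admissible n Js y (Suc p)" using step.prems by (auto simp: admissible_def)
  note IH = step.IH[OF adm]
  have here: "y p \<in> {1..n}" "y (Suc p) \<in> {1..n}" "if y p \<in> I p then y (Suc p) \<in> I p else y (Suc p) = y p"
    using step.prems step.hyps by (auto simp: admissible_def)
  have notin: "Bnd p x \<notin> set (pawalk_verts (Bnd (Suc p) (y (Suc p))) (trace_path Js y (Suc p)))"
    "Ctr p \<notin> set (pawalk_verts (Bnd (Suc p) (y (Suc p))) (trace_path Js y (Suc p)))" for x
    using IH by auto
  have split: "{Bnd r (y r) | r. p \<le> r \<and> r \<le> m} = insert (Bnd p (y p)) {Bnd r (y r) | r. Suc p \<le> r \<and> r \<le> m}"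
    "{Ctr r | r. p \<le> r \<and> r < m \<and> y r \<in> I r} =
       (if y p \<in> I p then insert (Ctr p) {Ctr r | r. Suc p \<le> r \<and> r < m \<and> y r \<in> I r}
        else {Ctr r | r. Suc p \<le> r \<and> r < m \<and> y r \<in> I r})"
    using step.hyps by (auto simp: le_less Suc_le_eq intro: Suc_leI)
  show ?case
  proof (cases "y p \<in> I p")
    case True
    then have "(Bnd p (y p), Ctr p) \<in> parcs (network n Js)" "(Ctr p, Bnd (Suc p) (y (Suc p))) \<in> parcs (network n Js)"
      using here step.hyps by (auto simp: arc_iff)
    then show ?thesis
      unfolding split using True IH notin step.hyps
      by (simp add: trace_path_step segment_def insert_commute[of "Ctr p"])
  next
    case False
    then have "(Bnd p (y p), Bnd (Suc p) (y (Suc p))) \<in> parcs (network n Js)"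
      using here step.hyps by (auto simp: arc_iff)
    then show ?thesis
      unfolding split using False IH notin step.hyps by (simp add: trace_path_step segment_def)
  qed
qed

lemma apath_iff:
  assumes "i \<in> {1..n}"
  shows "pre_digraph.apath (with_proj (network n Js)) (Bnd 0 i) es (Bnd m k) \<longleftrightarrow>
    (\<exists>y. y 0 = i \<and> y m = k \<and> admissible n Js y 0 \<and> es = trace_path Js y 0)"
  unfolding apath_iff_pcas
  using pcas_imp_trace_path[of 0 i es k] trace_path_apath_aux[of _ 0] Bnd_vertex[of 0 i] assms
  by auto

lemma arcs_trace_path:
  "e \<in> set (trace_path Js y 0) \<longleftrightarrow> (\<exists>p<m. e \<in> set (segment p (Js ! p) (y p) (y (Suc p))))"
  by (auto simp: trace_path_def)

lemma in_arc_iff: "(Bnd p h, Ctr p) \<in> set (trace_path Js y 0) \<longleftrightarrow> p < m \<and> y p = h \<and> h \<in> I p"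
  by (auto simp: arcs_trace_path segment_def split: if_splits)

lemma out_arc_iff: "(Ctr p, Bnd (Suc p) h) \<in> set (trace_path Js y 0) \<longleftrightarrow> p < m \<and> y p \<in> I p \<and> y (Suc p) = h"
  by (auto simp: arcs_trace_path segment_def split: if_splits)

lemma through_arc_iff:
  "(Bnd p h, Bnd (Suc p) k) \<in> set (trace_path Js y 0) \<longleftrightarrow> p < m \<and> y p = h \<and> h \<notin> I p \<and> y (Suc p) = k"
  by (auto simp: arcs_trace_path segment_def split: if_splits)

lemma path_familiesE:
  assumes "\<pi> \<in> path_families n Js id"
  obtains y where "\<And>i. i \<in> {1..n} \<Longrightarrow> y i 0 = i \<and> y i m = i \<and> admissible n Js (y i) 0 \<and> \<pi> i = trace_path Js (y i) 0"
proof -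
  have "\<forall>i\<in>{1..n}. \<exists>y. y 0 = i \<and> y m = i \<and> admissible n Js y 0 \<and> \<pi> i = trace_path Js y 0"
  proof
    fix i assume i: "i \<in> {1..n}"
    then have "pre_digraph.apath (with_proj (network n Js)) (Bnd 0 i) (\<pi> i) (Bnd m i)"
      using PiE_mem[OF assms[unfolded path_families_def] i] by simp
    then show "\<exists>y. y 0 = i \<and> y m = i \<and> admissible n Js y 0 \<and> \<pi> i = trace_path Js y 0"
      unfolding apath_iff[OF i] .
  qed
  then obtain y where "\<forall>i\<in>{1..n}. y i 0 = i \<and> y i m = i \<and> admissible n Js (y i) 0 \<and> \<pi> i = trace_path Js (y i) 0"
    by (rule bchoice[THEN exE])
  with that show ?thesis by blast
qed

lemma covers_iff:
  assumes "\<pi> \<in> path_families n Js id"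
  shows "covers n Js \<pi> \<longleftrightarrow> (\<forall>e\<in>parcs (network n Js). \<exists>!i. i \<in> {1..n} \<and> e \<in> set (\<pi> i))"
proof -
  have "(\<Sum>i\<in>{1..n}. count_list (\<pi> i) e) = card {i \<in> {1..n}. e \<in> set (\<pi> i)}" for e
  proof -
    have "count_list (\<pi> i) e = (if e \<in> set (\<pi> i) then 1 else 0)" if "i \<in> {1..n}" for i
    proof -
      have "distinct (\<pi> i)"
        using assms that distinct_pawalk_verts by (fastforce simp: path_families_def apath_iff_pcas)
      then show ?thesis by (rule count_list_distinct)
    qed
    then have "(\<Sum>i\<in>{1..n}. count_list (\<pi> i) e) = (\<Sum>i\<in>{1..n}. if e \<in> set (\<pi> i) then 1 else 0)"
      by (rule sum.cong[OF refl])
    then show ?thesis by (simp add: sum.If_cases Int_def)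
  qed
  then show ?thesis
    by (simp only: covers_def card_Collect_eq_1_iff)
qed

section \<open>Covering families as lists of permutations\<close>

lemma perm_lists_nth: "ts \<in> perm_lists Js \<Longrightarrow> p < m \<Longrightarrow> ts ! p permutes {fst (Js ! p)..snd (Js ! p)}"
  by (auto simp: perm_lists_def list_all2_conv_all_nth)

lemma prefix_comp_permutes:
  assumes "ts \<in> perm_lists Js"
  shows "p \<le> m \<Longrightarrow> prefix_comp ts p permutes {1..n}"
proof (induction p)
  case 0
  show ?case by (simp only: prefix_comp.simps permutes_id)
next
  case (Suc p)
  have "ts ! p permutes {1..n}"
    by (rule permutes_interval_mono[OF perm_lists_nth[OF assms]])
      (use Suc.prems bounds[of "Js ! p"] in auto)
  then have "prefix_comp ts p \<circ> ts ! p permutes {1..n}" using Suc by (intro permutes_compose) auto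
  then show ?case by (simp only: prefix_comp.simps)
qed

text \<open>\<open>prefix_comp ts p\<close> sends a height at level \<open>p\<close> to the path found there, \<open>pos ts p\<close> sends a path to
  its height.\<close>

definition pos :: "(nat \<Rightarrow> nat) list \<Rightarrow> nat \<Rightarrow> nat \<Rightarrow> nat" where
  "pos ts p = inv' (prefix_comp ts p)"

lemma pos_0 [simp]: "pos ts 0 = id"
  by (simp add: pos_def)

lemma pos_permutes: "ts \<in> perm_lists Js \<Longrightarrow> p \<le> m \<Longrightarrow> pos ts p permutes {1..n}"
  unfolding pos_def by (intro permutes_inv prefix_comp_permutes)

lemma pos_Suc:
  assumes "ts \<in> perm_lists Js" "p < m"
  shows "pos ts (Suc p) i = inv' (ts ! p) (pos ts p i)"
  using permutes_bij[OF prefix_comp_permutes[OF assms(1), of p]] permutes_bij[OF perm_lists_nth[OF assms]] assms(2)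
  by (simp add: pos_def o_inv_distrib)

lemma prefix_comp_pos: "ts \<in> perm_lists Js \<Longrightarrow> p \<le> m \<Longrightarrow> prefix_comp ts p (pos ts p i) = i"
  unfolding pos_def by (simp add: permutes_inverses[OF prefix_comp_permutes])

lemma pos_prefix_comp: "ts \<in> perm_lists Js \<Longrightarrow> p \<le> m \<Longrightarrow> pos ts p (prefix_comp ts p i) = i"
  unfolding pos_def by (simp add: permutes_inverses[OF prefix_comp_permutes])

text \<open>A permutation of an interval preserves the interval and fixes the rest. For a one-point
  interval it is \<open>id\<close>, in accordance with the missing centre.\<close>

lemma pos_centre:
  assumes "ts \<in> perm_lists Js" "p < m"
  shows "if pos ts p i \<in> I p then pos ts (Suc p) i \<in> I p else pos ts (Suc p) i = pos ts p i"
proof -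
  have u: "inv' (ts ! p) permutes {fst (Js ! p)..snd (Js ! p)}"
    by (rule permutes_inv[OF perm_lists_nth[OF assms]])
  have "fst (Js ! p) \<le> snd (Js ! p)" using bounds[of "Js ! p"] assms(2) by simp
  then consider "I p = {fst (Js ! p)..snd (Js ! p)}" | "I p = {}" "fst (Js ! p) = snd (Js ! p)"
    by (force simp: centre_interval_def)
  then show ?thesis
  proof cases
    case 1
    then show ?thesis
      using permutes_in_image[OF u, of "pos ts p i"] permutes_not_in[OF u, of "pos ts p i"]
      by (simp add: pos_Suc[OF assms])
  next
    case 2
    then have "inv' (ts ! p) = id" using u by simp
    then show ?thesis using 2 by (simp add: pos_Suc[OF assms])
  qed
qed

lemma pos_centre_iff: "ts \<in> perm_lists Js \<Longrightarrow> p < m \<Longrightarrow> pos ts (Suc p) i \<in> I p \<longleftrightarrow> pos ts p i \<in> I p"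
  using pos_centre[of ts p i] by (auto split: if_splits)

lemma admissible_pos:
  assumes "ts \<in> perm_lists Js" "i \<in> {1..n}"
  shows "admissible n Js (\<lambda>p. pos ts p i) 0"
proof -
  have "pos ts p i \<in> {1..n}" if "p \<le> m" for p
    using permutes_in_image[OF pos_permutes[OF assms(1) that], of i] assms(2) by simp
  then show ?thesis using pos_centre[OF assms(1)] by (simp add: admissible_def Suc_leI)
qed

definition closed_lists :: "(nat \<Rightarrow> nat) list set" where
  "closed_lists = {ts \<in> perm_lists Js. prefix_comp ts m = id}"

definition family :: "(nat \<Rightarrow> nat) list \<Rightarrow> nat \<Rightarrow> arc list" where
  "family ts = (\<lambda>i\<in>{1..n}. trace_path Js (\<lambda>p. pos ts p i) 0)"

lemma closed_listsD: "ts \<in> closed_lists \<Longrightarrow> ts \<in> perm_lists Js" "ts \<in> closed_lists \<Longrightarrow> pos ts m = id"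
  by (auto simp: closed_lists_def pos_def)

lemma family_path_vertices:
  assumes "ts \<in> closed_lists" "i \<in> {1..n}"
  shows "path_vertices (family ts) i = {Bnd p (pos ts p i) | p. p \<le> m} \<union> {Ctr p | p. p < m \<and> pos ts p i \<in> I p}"
  using trace_path_apath_aux[OF admissible_pos[OF closed_listsD(1)[OF assms(1)] assms(2)]] assms(2)
  by (simp add: path_vertices_def family_def)

lemma family_path_families:
  assumes "ts \<in> closed_lists"
  shows "family ts \<in> path_families n Js id"
proof -
  have "pre_digraph.apath (with_proj (network n Js)) (Bnd 0 i) (trace_path Js (\<lambda>p. pos ts p i) 0) (Bnd m i)"
    if "i \<in> {1..n}" for i
    unfolding apath_iff[OF that]
    by (rule exI[of _ "\<lambda>p. pos ts p i"])
      (use closed_listsD[OF assms] admissible_pos[OF _ that] in auto)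
  then show ?thesis by (simp add: path_families_def family_def)
qed

lemma family_covers:
  assumes "ts \<in> closed_lists"
  shows "covers n Js (family ts)"
  unfolding covers_iff[OF family_path_families[OF assms]]
proof
  note ts = closed_listsD(1)[OF assms]
  fix e assume "e \<in> parcs (network n Js)"
  then obtain p h where p: "p < m" and e: "h \<in> {1..n} - I p \<and> e = (Bnd p h, Bnd (Suc p) h) \<or> h \<in> I p \<and> e = (Bnd p h, Ctr p)
      \<or> h \<in> I p \<and> e = (Ctr p, Bnd (Suc p) h)"
    by (auto simp: arc_iff)
  have h: "h \<in> {1..n}" using e I_subset[OF p] by auto
  have ex1: "\<exists>!i. i \<in> {1..n} \<and> pos ts r i = h" if "r \<le> m" for r
  proof (rule ex1I[of _ "prefix_comp ts r h"])
    show "prefix_comp ts r h \<in> {1..n} \<and> pos ts r (prefix_comp ts r h) = h"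
      using h permutes_in_image[OF prefix_comp_permutes[OF ts that], of h] pos_prefix_comp[OF ts that] by simp
    show "i = prefix_comp ts r h" if "i \<in> {1..n} \<and> pos ts r i = h" for i
      using that prefix_comp_pos[OF ts \<open>r \<le> m\<close>, of i] by auto
  qed
  \<comment> \<open>An arc is identified by one height: at the level after the factor if it leaves
    the centre, at the level before it otherwise. Each height on a level is occupied by exactly one
    strand.\<close>
  have "i \<in> {1..n} \<and> e \<in> set (family ts i) \<longleftrightarrow> i \<in> {1..n} \<and> pos ts (if fst e = Ctr p then Suc p else p) i = h" for i
    using e p pos_centre[OF ts p, of i]
    by (auto simp: family_def in_arc_iff out_arc_iff through_arc_iff split: if_splits)
  then show "\<exists>!i. i \<in> {1..n} \<and> e \<in> set (family ts i)"
    using ex1[of "if fst e = Ctr p then Suc p else p"] p by simp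
qed

text \<open>Each boundary vertex before the last level is the tail of an arc, so covering puts a
  path at every height, and a surjection of \<open>{1..n}\<close> to itself is a
  permutation.\<close>

lemma covers_imp_family:
  assumes "\<pi> \<in> path_families n Js id" "covers n Js \<pi>"
  shows "\<exists>ts\<in>closed_lists. \<pi> = family ts"
proof -
  obtain y where y: "\<And>i. i \<in> {1..n} \<Longrightarrow> y i 0 = i \<and> y i m = i \<and> admissible n Js (y i) 0 \<and> \<pi> i = trace_path Js (y i) 0"
    using path_familiesE[OF assms(1)] by blast
  define P where "P p i = (if i \<in> {1..n} then y i p else i)" for p i
  have y_in: "y i p \<in> {1..n}" if "i \<in> {1..n}" "p \<le> m" for i p
    using y[OF that(1)] that by (cases "p = m") (auto simp: admissible_def)
  have P: "P p permutes {1..n}" if p: "p \<le> m" for p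
  proof -
    have "{1..n} \<subseteq> (\<lambda>i. y i p) ` {1..n}"
    proof
      fix h assume h: "h \<in> {1..n}"
      show "h \<in> (\<lambda>i. y i p) ` {1..n}"
      proof (cases "p = m")
        case True
        then show ?thesis using y[OF h] h by (intro image_eqI[of _ _ h]) auto
      next
        case False
        then have p: "p < m" using p by simp
        define e where "e = (if h \<in> I p then (Bnd p h, Ctr p) else (Bnd p h, Bnd (Suc p) h))"
        have "e \<in> parcs (network n Js)" using h p by (auto simp: e_def arc_iff)
        then obtain i where i: "i \<in> {1..n}" "e \<in> set (\<pi> i)"
          using assms by (auto simp: covers_iff)
        then have "y i p = h"
          using y[OF i(1)] by (auto simp: e_def in_arc_iff through_arc_iff split: if_splits)
        then show ?thesis using i by auto
      qed
    qed
    moreover have "(\<lambda>i. y i p) ` {1..n} \<subseteq> {1..n}" using y_in[OF _ p] by auto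
    ultimately have img: "(\<lambda>i. y i p) ` {1..n} = {1..n}" by blast
    then have "inj_on (\<lambda>i. y i p) {1..n}" by (intro eq_card_imp_inj_on) auto
    then have "bij_betw (\<lambda>i. y i p) {1..n} {1..n}" using img by (simp add: bij_betw_def)
    moreover have "bij_betw (P p) {1..n} {1..n} \<longleftrightarrow> bij_betw (\<lambda>i. y i p) {1..n} {1..n}"
      by (rule bij_betw_cong) (simp add: P_def)
    ultimately have "bij_betw (P p) {1..n} {1..n}" by simp
    then show ?thesis by (rule bij_imp_permutes) (simp only: P_def if_False)
  qed
  have P0: "P 0 = id" using y by (auto simp: P_def fun_eq_iff)
  have Pm: "P m = id" using y by (auto simp: P_def fun_eq_iff)
  \<comment> \<open>Chosen so that \<open>prefix_comp ts p\<close> telescopes to the inverse of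
    \<open>P p\<close>, starting from \<open>P 0 = id\<close>.\<close>
  define ts where "ts = map (\<lambda>p. P p \<circ> inv' (P (Suc p))) [0..<m]"
  have ts_nth: "ts ! p = P p \<circ> inv' (P (Suc p))" if "p < m" for p using that by (simp add: ts_def)
  have "ts \<in> perm_lists Js"
    unfolding perm_lists_def mem_Collect_eq list_all2_conv_all_nth
  proof (intro conjI allI impI)
    show "length ts = m" by (simp add: ts_def)
    fix p assume "p < length ts"
    then have p: "p < m" by (simp add: ts_def)
    have Pp: "P p permutes {1..n}" and PS: "P (Suc p) permutes {1..n}" using P p by auto
    show "ts ! p permutes {fst (Js ! p)..snd (Js ! p)}"
    proof (rule permutes_superset)
      show "ts ! p permutes {1..n}"
        unfolding ts_nth[OF p] by (rule permutes_compose[OF permutes_inv[OF PS] Pp])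
      fix x assume x: "x \<in> {1..n} - {fst (Js ! p)..snd (Js ! p)}"
      then have xI: "x \<notin> I p" by (auto simp: centre_interval_def)
      define i where "i = inv' (P (Suc p)) x"
      have i: "i \<in> {1..n}" unfolding i_def using x permutes_in_image[OF permutes_inv[OF PS]] by blast
      have "y i (Suc p) = x"
        using permutes_inverses(1)[OF PS, of x] i by (simp add: i_def[symmetric] P_def)
      \<comment> \<open>A path that leaves the factor outside its centre also entered it outside, at
        the same height.\<close>
      then have "y i p = x" using y[OF i] xI p by (auto simp: admissible_def split: if_splits)
      then show "(ts ! p) x = x" using ts_nth[OF p] i by (simp add: i_def[symmetric] P_def)
    qed
  qed
  moreover have pc: "prefix_comp ts p = inv' (P p)" if "p \<le> m" for p
    using that
  proof (induction p)
    case 0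
    then show ?case by (simp add: P0)
  next
    case (Suc p)
    have "inv' (P p) \<circ> (P p \<circ> inv' (P (Suc p))) = inv' (P (Suc p))"
      using permutes_inverses(2)[OF P[of p]] Suc.prems by (simp add: fun_eq_iff)
    then show ?case using Suc ts_nth[of p] by (simp del: o_apply)
  qed
  ultimately have ts: "ts \<in> closed_lists" by (simp add: closed_lists_def Pm)
  have pos: "pos ts p = P p" if "p \<le> m" for p
    using pc[OF that] permutes_inv_inv[OF P[OF that]] by (simp add: pos_def)
  have "\<pi> = family ts"
  proof
    fix i
    show "\<pi> i = family ts i"
    proof (cases "i \<in> {1..n}")
      case True
      have "trace_path Js (y i) 0 = trace_path Js (\<lambda>p. pos ts p i) 0"
        unfolding trace_path_def
        by (intro arg_cong[where f = concat] map_cong) (use True pos in \<open>auto simp: P_def\<close>)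
      then show ?thesis using True y[OF True] by (simp add: family_def)
    next
      case False
      then show ?thesis using assms(1) by (auto simp: family_def path_families_def PiE_def extensional_def)
    qed
  qed
  then show ?thesis using ts by blast
qed

text \<open>The boundary vertices on a path reveal its height at every level, hence every
  \<open>prefix_comp ts p\<close>; cancelling consecutive ones recovers the entries.\<close>

lemma family_inj: "inj_on family closed_lists"
proof (rule inj_onI)
  fix ts us assume ts: "ts \<in> closed_lists" and us: "us \<in> closed_lists" and eq: "family ts = family us"
  have pos: "pos ts p = pos us p" if p: "p \<le> m" for p
  proof
    fix i
    show "pos ts p i = pos us p i"
    proof (cases "i \<in> {1..n}")
      case True
      have "Bnd p (pos ts p i) \<in> path_vertices (family us) i"
        unfolding eq[symmetric] using p True ts by (auto simp: family_path_vertices)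
      then show ?thesis using True us by (auto simp: family_path_vertices)
    next
      case False
      then show ?thesis
        using pos_permutes[OF closed_listsD(1)[OF ts] p] pos_permutes[OF closed_listsD(1)[OF us] p]
        by (simp add: permutes_not_in)
    qed
  qed
  have pc: "prefix_comp ts p = prefix_comp us p" if "p \<le> m" for p
    using pos[OF that] permutes_inv_inv[OF prefix_comp_permutes[OF closed_listsD(1)[OF ts] that]]
      permutes_inv_inv[OF prefix_comp_permutes[OF closed_listsD(1)[OF us] that]]
    by (metis pos_def)
  show "ts = us"
  proof (rule nth_equalityI)
    show "length ts = length us"
      using closed_listsD(1)[OF ts] closed_listsD(1)[OF us] by (auto simp: perm_lists_def dest!: list_all2_lengthD)
    fix p assume "p < length ts"
    then have p: "p < m" using closed_listsD(1)[OF ts] by (auto simp: perm_lists_def dest!: list_all2_lengthD)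
    have "prefix_comp ts p ((ts ! p) x) = prefix_comp ts p ((us ! p) x)" for x
      using pc[of "Suc p"] pc[of p] p by (simp add: fun_eq_iff)
    then show "ts ! p = us ! p"
      using permutes_inj[OF prefix_comp_permutes[OF closed_listsD(1)[OF ts], of p]] p by (auto simp: fun_eq_iff dest: injD)
  qed
qed

lemma bij_betw_family: "bij_betw family closed_lists {\<pi> \<in> path_families n Js id. covers n Js \<pi>}"
  unfolding bij_betw_def using family_inj family_path_families family_covers covers_imp_family by blast

end

section \<open>Labellings, crossings and tableaux\<close>

lemma permutes_interval_less:
  fixes u :: "nat \<Rightarrow> nat"
  assumes "u permutes {a..b}" "x < y" "\<not> (x \<in> {a..b} \<and> y \<in> {a..b})"
  shows "u x < u y"
  using assms(2,3) permutes_in_image[OF assms(1), of x] permutes_in_image[OF assms(1), of y]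
    permutes_not_in[OF assms(1), of x] permutes_not_in[OF assms(1), of y]
  by (cases "x \<in> {a..b}"; cases "y \<in> {a..b}") auto

text \<open>Names inversions by strands instead of heights, so that the counts before and after a
  factor concern the same pairs of paths.\<close>

lemma inv_no_comp_eq:
  assumes "r permutes S"
  shows "inv_no a b (c \<circ> r) = card {(i, j). inv' r i \<in> {a..b} \<and> inv' r j \<in> {a..b} \<and> inv' r i < inv' r j \<and> c j < c i}"
    (is "_ = card ?E")
  unfolding inv_no_def
proof (rule bij_betw_same_card)
  note inverses = permutes_inverses[OF assms]
  show "bij_betw (map_prod r r) (invs a b (c \<circ> r)) ?E"
    by (rule bij_betw_byWitness[where f' = "map_prod (inv' r) (inv' r)"])
      (auto simp: invs_def inverses)
qed

lemma card_triples:
  fixes X :: "nat \<Rightarrow> ('a \<times> 'b) set"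
  assumes "\<And>p. p < k \<Longrightarrow> finite (X p)"
  shows "card {(i, j, p). p < k \<and> (i, j) \<in> X p} = (\<Sum>p<k. card (X p))"
proof -
  have "bij_betw (\<lambda>(p, i, j). (i, j, p)) (SIGMA p:{..<k}. X p) {(i, j, p). p < k \<and> (i, j) \<in> X p}"
    by (rule bij_betw_byWitness[where f' = "\<lambda>(i, j, p). (p, i, j)"]) auto
  then have "card {(i, j, p). p < k \<and> (i, j) \<in> X p} = card (SIGMA p:{..<k}. X p)"
    by (simp add: bij_betw_same_card)
  then show ?thesis using assms by simp
qed

context star_net
begin

lemma labels_distinct:
  assumes ts: "ts \<in> perm_lists Js" and ok: "chain_ok Js ts c" and p: "p < m" and "c i = c j"
    and "pos ts p i \<in> {fst (Js ! p)..snd (Js ! p)}" "pos ts p j \<in> {fst (Js ! p)..snd (Js ! p)}"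
  shows "i = j"
proof -
  note undo = prefix_comp_pos[OF ts less_imp_le[OF p]]
  have "inj_on (c \<circ> prefix_comp ts p) {fst (Js ! p)..snd (Js ! p)}" using ok p by (simp add: chain_ok_def)
  moreover have "(c \<circ> prefix_comp ts p) (pos ts p i) = (c \<circ> prefix_comp ts p) (pos ts p j)"
    using \<open>c i = c j\<close> by (simp add: undo)
  ultimately have "pos ts p i = pos ts p j" by (rule inj_onD) fact+
  then show ?thesis by (metis undo)
qed

lemma I_subset_interval: "I p \<subseteq> {fst (Js ! p)..snd (Js ! p)}"
  by (auto simp: centre_interval_def)

text \<open>A permutation of an interval can reverse two points only if both lie inside, and
  \<open>chain_ok\<close> forbids this for equal labels.\<close>

lemma order_kept:
  assumes ts: "ts \<in> perm_lists Js" and ok: "chain_ok Js ts c" and "i < j" "c i = c j"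
  shows "p \<le> m \<Longrightarrow> pos ts p i < pos ts p j"
proof (induction p)
  case 0
  then show ?case using assms by simp
next
  case (Suc p)
  then have p: "p < m" and IH: "pos ts p i < pos ts p j" by auto
  have "\<not> (pos ts p i \<in> {fst (Js ! p)..snd (Js ! p)} \<and> pos ts p j \<in> {fst (Js ! p)..snd (Js ! p)})"
    using labels_distinct[OF ts ok p \<open>c i = c j\<close>] \<open>i < j\<close> by auto
  then show ?case
    unfolding pos_Suc[OF ts p]
    by (rule permutes_interval_less[OF permutes_inv[OF perm_lists_nth[OF ts p]] IH])
qed

text \<open>Equally labelled strands never meet, so they keep their relative order; a permutation that
  preserves all labels and is increasing on each label class is the identity.\<close>

lemma closed_if_labels_fixed:
  assumes ts: "ts \<in> perm_lists Js" and ok: "chain_ok Js ts c" and fix_c: "c \<circ> prefix_comp ts m = c"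
  shows "prefix_comp ts m = id"
proof -
  let ?s = "pos ts m"
  have perm: "?s permutes {1..n}" by (rule pos_permutes[OF ts]) simp
  have c: "c (?s i) = c i" for i
    using fun_cong[OF fix_c, of "?s i"] prefix_comp_pos[OF ts, of m i] by simp
  have "?s i = i" for i
  proof (induction i rule: less_induct)
    case (less i)
    show ?case
    proof (rule ccontr)
      assume ne: "?s i \<noteq> i"
      have "\<not> ?s i < i"
      proof
        assume "?s i < i"
        then have "?s (?s i) = ?s i" by (rule less)
        then show False using ne injD[OF permutes_inj[OF perm]] by blast
      qed
      obtain j where j: "?s j = i" using permutes_surj[OF perm] by (metis surjD)
      have "i < j" using less[of j] j ne by (metis linorder_neqE_nat)
      then have "?s i < ?s j"
        by (rule order_kept[OF ts ok]) (use c[of j] j in auto)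
      with j \<open>\<not> ?s i < i\<close> show False by simp
    qed
  qed
  then have "prefix_comp ts m i = i" for i using prefix_comp_pos[OF ts, of m i] by simp
  then show ?thesis by auto
qed

text \<open>\<open>delta c\<close> keeps the chains that return to the word \<open>c\<close>. By
  \<open>closed_if_labels_fixed\<close> their total permutation is trivial, a condition free of
  \<open>c\<close>, so the sum over lists can come first.\<close>

lemma sum_interval_op_delta:
  "(\<Sum>c\<in>words n v0. foldr (interval_op n) Js (delta c) c)
    = (\<Sum>ts\<in>closed_lists. \<Sum>c\<in>{c \<in> words n v0. chain_ok Js ts c}. q_half ^ chain_weight Js ts c)"
proof -
  let ?t = "\<lambda>c ts. if chain_ok Js ts c then q_half ^ chain_weight Js ts c else 0"
  have b: "\<forall>J\<in>set Js. 1 \<le> fst J \<and> snd J \<le> n" using bounds by blast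
  have "(\<Sum>c\<in>words n v0. foldr (interval_op n) Js (delta c) c)
      = (\<Sum>c\<in>words n v0. \<Sum>ts\<in>perm_lists Js. ?t c ts * delta c (c \<circ> prefix_comp ts m))"
    by (simp only: foldr_interval_op[OF b])
  also have "\<dots> = (\<Sum>ts\<in>perm_lists Js. \<Sum>c\<in>words n v0. ?t c ts * delta c (c \<circ> prefix_comp ts m))"
    by (rule sum.swap)
  also have "\<dots> = (\<Sum>ts\<in>closed_lists. \<Sum>c\<in>words n v0. ?t c ts * delta c (c \<circ> prefix_comp ts m))"
  proof (rule sum.mono_neutral_right[OF finite_perm_lists])
    show "closed_lists \<subseteq> perm_lists Js" by (auto simp: closed_lists_def)
    show "\<forall>ts\<in>perm_lists Js - closed_lists. (\<Sum>c\<in>words n v0. ?t c ts * delta c (c \<circ> prefix_comp ts m)) = 0"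
      using closed_if_labels_fixed
      by (auto simp: closed_lists_def delta_def intro!: sum.neutral split: if_splits simp del: o_apply)
  qed
  also have "\<dots> = (\<Sum>ts\<in>closed_lists. \<Sum>c\<in>words n v0. ?t c ts)"
  proof (intro sum.cong refl)
    fix ts c assume "ts \<in> closed_lists"
    then have "prefix_comp ts m = id" by (simp add: closed_lists_def)
    then show "?t c ts * delta c (c \<circ> prefix_comp ts m) = ?t c ts"
      by (simp only: comp_id delta_def simp_thms if_True mult_1_right)
  qed
  also have "\<dots> = (\<Sum>ts\<in>closed_lists. \<Sum>c\<in>{c \<in> words n v0. chain_ok Js ts c}. q_half ^ chain_weight Js ts c)"
    by (intro sum.cong refl sum.inter_filter[symmetric]) simp
  finally show ?thesis .
qed

lemma family_enters_below:
  assumes "ts \<in> closed_lists" "i \<in> {1..n}" "j \<in> {1..n}"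
  shows "enters_below (family ts) p i j \<longleftrightarrow> p < m \<and> pos ts p i \<in> I p \<and> pos ts p j \<in> I p \<and> pos ts p i < pos ts p j"
  using assms by (auto simp: enters_below_def family_def in_arc_iff)

lemma family_leaves_below:
  assumes "ts \<in> closed_lists" "i \<in> {1..n}" "j \<in> {1..n}"
  shows "leaves_below (family ts) p i j \<longleftrightarrow>
    p < m \<and> pos ts p i \<in> I p \<and> pos ts p j \<in> I p \<and> pos ts (Suc p) i < pos ts (Suc p) j"
  using assms by (auto simp: leaves_below_def family_def out_arc_iff)

lemma pos_in_range:
  assumes "ts \<in> perm_lists Js" "p < m" "pos ts p i \<in> I p"
  shows "i \<in> {1..n}"
proof -
  have "pos ts p i \<in> {1..n}" using I_subset[OF assms(2)] assms(3) by blast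
  then show ?thesis using permutes_in_image[OF pos_permutes[OF assms(1)], of p i] assms(2) by simp
qed

text \<open>For one factor let A and B be the label-inverted pairs ordered by entering and by
  leaving heights. Then |A| + |B| = |A - B| + |B - A| + 2 |A \<inter> B|, where the intersection
  consists of inverted noncrossings and the differences of crossings.\<close>

lemma chain_weight_eq:
  assumes ts: "ts \<in> closed_lists" and ok: "chain_ok Js ts c"
  shows "chain_weight Js ts c = cr n Js (family ts) + 2 * card {(i, j, p) \<in> noncrossings n Js (family ts). c j < c i}"
proof -
  note tp = closed_listsD(1)[OF ts]
  \<comment> \<open>\<open>q = p\<close> gives the order on entering, \<open>q = Suc p\<close> the
    order on leaving; passage through the centre is tested at level \<open>p\<close> in both
    cases.\<close>
  define E where "E q p = {(i, j). pos ts p i \<in> I p \<and> pos ts p j \<in> I p \<and> pos ts q i < pos ts q j \<and> c j < c i}" for q p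
  define X where "X p = {(i, j). pos ts p i \<in> I p \<and> pos ts p j \<in> I p \<and> pos ts p i < pos ts p j
      \<and> pos ts (Suc p) j < pos ts (Suc p) i}" for p
  have fin: "finite S" if "S \<subseteq> {(i, j). pos ts p i \<in> I p \<and> pos ts p j \<in> I p}" "p < m" for S p
  proof (rule finite_subset)
    show "S \<subseteq> {1..n} \<times> {1..n}" using that pos_in_range[OF tp that(2)] by blast
  qed simp
  have finE: "finite (E q p)" if "p < m" for q p by (rule fin[OF _ that]) (auto simp: E_def)
  have finX: "finite (X p)" if "p < m" for p by (rule fin[OF _ that]) (auto simp: X_def)
  have range: "i \<in> {1..n}" if "p < m" "pos ts p i \<in> I p" for p i by (rule pos_in_range[OF tp that])
  have crossing: "crossings n Js (family ts) = {(i, j, p). p < m \<and> (i, j) \<in> X p}"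
    using family_enters_below[OF ts] family_leaves_below[OF ts] range
    by (auto simp: crossings_def X_def)
  have noncrossing: "{(i, j, p) \<in> noncrossings n Js (family ts). c j < c i} = {(i, j, p). p < m \<and> (i, j) \<in> E p p \<inter> E (Suc p) p}"
    using family_enters_below[OF ts] family_leaves_below[OF ts] range
    by (auto simp: noncrossings_def E_def)
  have inv: "inv_no (fst (Js ! p)) (snd (Js ! p)) (c \<circ> prefix_comp ts q) = card (E q p)" if p: "p < m" "q = p \<or> q = Suc p" for p q
  proof -
    have q: "q \<le> m" using p by auto
    have iff: "pos ts q i \<in> I p \<longleftrightarrow> pos ts p i \<in> I p" for i using p pos_centre_iff[OF tp p(1)] by auto
    have "fst (Js ! p) \<le> snd (Js ! p)" using bounds[of "Js ! p"] p by simp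
    then have sub: "x \<in> {fst (Js ! p)..snd (Js ! p)} \<and> y \<in> {fst (Js ! p)..snd (Js ! p)} \<and> x < y \<longleftrightarrow> x \<in> I p \<and> y \<in> I p \<and> x < y" for x y
      by (auto simp: centre_interval_def)
    show ?thesis
      unfolding inv_no_comp_eq[OF prefix_comp_permutes[OF tp q]] E_def pos_def[symmetric] iff[symmetric]
      using sub by (intro arg_cong[where f = card]) blast
  qed
  have local: "card (E p p) + card (E (Suc p) p) = card (X p) + 2 * card (E p p \<inter> E (Suc p) p)" if p: "p < m" for p
  proof -
    let ?A = "E p p" and ?B = "E (Suc p) p"
    have ne: "c i \<noteq> c j" if "pos ts p i \<in> I p" "pos ts p j \<in> I p" "i \<noteq> j" for i j
    proof
      assume "c i = c j"
      then have "i = j"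
        by (rule labels_distinct[OF tp ok p]) (use I_subset_interval[of p] that in blast)+
      then show False using \<open>i \<noteq> j\<close> by simp
    qed
    have inj: "pos ts q i \<noteq> pos ts q j" if "i \<noteq> j" "q \<le> m" for i j q
      using prefix_comp_pos[OF tp that(2), of i] prefix_comp_pos[OF tp that(2), of j] that(1) by auto
    \<comment> \<open>A crossing is listed with the path that enters below first. If the labels are
      inverted in that order the pair lies in \<open>?A\<close>, otherwise the swapped pair lies in
      \<open>?B\<close>; the labels are never equal.\<close>
    have X: "X p = (?A - ?B) \<union> prod.swap ` (?B - ?A)"
    proof (intro Set.set_eqI iffI)
      fix x assume "x \<in> X p"
      then obtain i j where x: "x = (i, j)" "pos ts p i \<in> I p" "pos ts p j \<in> I p" "pos ts p i < pos ts p j"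
        "pos ts (Suc p) j < pos ts (Suc p) i" by (auto simp: X_def)
      then have "c i \<noteq> c j" using ne[of i j] by auto
      then consider "c j < c i" | "c i < c j" by linarith
      then show "x \<in> (?A - ?B) \<union> prod.swap ` (?B - ?A)"
      proof cases
        case 2
        then have "(j, i) \<in> ?B - ?A" using x by (auto simp: E_def)
        then show ?thesis using x(1) by force
      qed (use x in \<open>auto simp: E_def\<close>)
    next
      fix x assume "x \<in> (?A - ?B) \<union> prod.swap ` (?B - ?A)"
      then show "x \<in> X p"
      proof (elim UnE imageE)
        assume x: "x \<in> ?A - ?B"
        obtain i j where "x = (i, j)" by fastforce
        moreover from this have "i \<noteq> j" using x by (auto simp: E_def)
        ultimately show ?thesis using x inj[of i j "Suc p"] p by (auto simp: E_def X_def)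
      next
        fix z assume z: "x = prod.swap z" "z \<in> ?B - ?A"
        obtain i j where "z = (i, j)" by fastforce
        moreover from this have "i \<noteq> j" using z by (auto simp: E_def)
        ultimately show ?thesis using z inj[of i j p] p by (auto simp: E_def X_def)
      qed
    qed
    have "(?A - ?B) \<inter> prod.swap ` (?B - ?A) = {}" by (auto simp: E_def)
    then have "card (X p) = card (?A - ?B) + card (prod.swap ` (?B - ?A))"
      unfolding X using finE[OF p] by (intro card_Un_disjoint) auto
    also have "card (prod.swap ` (?B - ?A)) = card (?B - ?A)"
      by (rule card_image) (auto simp: inj_on_def)
    finally have "card (X p) = card (?A - ?B) + card (?B - ?A)" .
    moreover have "card ?A = card (?A \<inter> ?B) + card (?A - ?B)" by (rule card_Int_Diff[OF finE[OF p]])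
    moreover have "card ?B = card (?B \<inter> ?A) + card (?B - ?A)" by (rule card_Int_Diff[OF finE[OF p]])
    ultimately show ?thesis by (simp add: Int_commute)
  qed
  have "chain_weight Js ts c = (\<Sum>p<m. card (E p p) + card (E (Suc p) p))"
    unfolding chain_weight_def by (rule sum.cong[OF refl]) (simp add: inv del: prefix_comp.simps)
  also have "\<dots> = (\<Sum>p<m. card (X p) + 2 * card (E p p \<inter> E (Suc p) p))"
    by (rule sum.cong[OF refl]) (use local in auto)
  also have "\<dots> = (\<Sum>p<m. card (X p)) + 2 * (\<Sum>p<m. card (E p p \<inter> E (Suc p) p))"
    by (simp add: sum.distrib sum_distrib_left)
  also have "(\<Sum>p<m. card (X p)) = cr n Js (family ts)"
    unfolding cr_def crossing using finX by (rule card_triples[symmetric])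
  also have "(\<Sum>p<m. card (E p p \<inter> E (Suc p) p)) = card {(i, j, p) \<in> noncrossings n Js (family ts). c j < c i}"
    unfolding noncrossing using finE by (intro card_triples[symmetric]) blast
  finally show ?thesis .
qed

end

text \<open>Zero-based number of the block that contains \<open>i\<close>, in line with the columns
  of \<open>diagram\<close>; the range of \<open>k\<close> copies the cuts in
  \<open>hecke_sub\<close>.\<close>

definition block_index :: "nat list \<Rightarrow> nat \<Rightarrow> nat" where
  "block_index lam i = card {k. 1 \<le> k \<and> k < length lam \<and> sum_list (take k lam) < i}"

lemma block_index_mono: "block_index lam i \<le> block_index lam (Suc i)"
  unfolding block_index_def by (rule card_mono) auto

lemma block_index_cut:
  "block_index lam i = block_index lam (Suc i) \<longleftrightarrow> i \<notin> {sum_list (take k lam) | k. 1 \<le> k \<and> k < length lam}"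
proof -
  let ?A = "{k. 1 \<le> k \<and> k < length lam \<and> sum_list (take k lam) < i}"
  let ?B = "{k. 1 \<le> k \<and> k < length lam \<and> sum_list (take k lam) < Suc i}"
  have fin: "finite ?B" by auto
  have sub: "?A \<subseteq> ?B" by auto
  have "card ?A = card ?B \<longleftrightarrow> ?A = ?B" 
    by (rule iffI, erule card_subset_eq[OF fin sub], rule arg_cong)
  also have "\<dots> \<longleftrightarrow> i \<notin> {sum_list (take k lam) | k. 1 \<le> k \<and> k < length lam}"
    by (auto simp: less_Suc_eq)
  finally show ?thesis by (simp add: block_index_def)
qed

lemma sum_list_take_mono: "j \<le> k \<Longrightarrow> sum_list (take j lam) \<le> sum_list (take k (lam :: nat list))"
proof -
  assume "j \<le> k"
  then obtain d where "k = j + d" by (auto simp: le_iff_add)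
  then show ?thesis by (simp add: take_add)
qed

lemma block_index_eq:
  assumes "k < length lam" "sum_list (take k lam) < i" "i \<le> sum_list (take (Suc k) lam)"
  shows "block_index lam i = k"
proof -
  have iff: "sum_list (take j lam) < i \<longleftrightarrow> j \<le> k" for j
  proof (cases "j \<le> k")
    case True
    then show ?thesis using sum_list_take_mono[OF True, of lam] assms(2) by linarith
  next
    case False
    then have "sum_list (take (Suc k) lam) \<le> sum_list (take j lam)" by (intro sum_list_take_mono) simp
    with False assms(3) show ?thesis by linarith
  qed
  have "{j. 1 \<le> j \<and> j < length lam \<and> sum_list (take j lam) < i} = {1..k}"
    unfolding iff using assms(1) by auto
  then show ?thesis by (simp add: block_index_def)
qed

lemma card_block:
  "card {i \<in> {1..sum_list lam}. block_index lam i = k} = (if k < length lam then lam ! k else 0)"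
proof -
  have ex: "\<exists>j<length lam. sum_list (take j lam) < i \<and> i \<le> sum_list (take (Suc j) lam)"
    if "i \<in> {1..sum_list lam}" for i
  proof -
    let ?P = "\<lambda>j. i \<le> sum_list (take j lam)"
    define j where "j = (LEAST j. ?P j)"
    have P: "?P (length lam)" using that by simp
    have "?P j" unfolding j_def by (rule LeastI[of ?P, OF P])
    moreover have "j \<noteq> 0" using calculation that by (intro notI) auto
    then obtain l where l: "j = Suc l" by (cases j) auto
    moreover have "\<not> ?P l" using not_less_Least[of l ?P] l by (simp add: j_def)
    moreover have "j \<le> length lam" unfolding j_def by (rule Least_le[of ?P, OF P])
    ultimately show ?thesis by (intro exI[of _ l]) auto
  qed
  show ?thesis
  proof (cases "k < length lam")
    case True
    have le: "sum_list (take (Suc k) lam) \<le> sum_list lam"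
      using sum_list_take_mono[of "Suc k" "length lam" lam] True by simp
    have "{i \<in> {1..sum_list lam}. block_index lam i = k} = {sum_list (take k lam)<..sum_list (take (Suc k) lam)}"
      (is "?A = ?B")
    proof (intro Set.set_eqI iffI)
      fix i assume "i \<in> ?A"
      then have i: "i \<in> {1..sum_list lam}" "block_index lam i = k" by auto
      obtain j where "j < length lam" "sum_list (take j lam) < i" "i \<le> sum_list (take (Suc j) lam)"
        using ex[OF i(1)] by blast
      moreover from this have "j = k" using block_index_eq i(2) by blast
      ultimately show "i \<in> ?B" by simp
    next
      fix i assume "i \<in> ?B"
      then show "i \<in> ?A"
        using block_index_eq[OF True, of i] le
        unfolding greaterThanAtMost_iff mem_Collect_eq atLeastAtMost_iff by linarith
    qed
    then show ?thesis using True by (simp add: take_Suc_conv_app_nth)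
  next
    case False
    then have "{i \<in> {1..sum_list lam}. block_index lam i = k} = {}"
      using ex block_index_eq by blast
    then show ?thesis using False by simp
  qed
qed

section \<open>The conjugate diagram and letter counts\<close>

lemma mem_le_foldr_max: "x \<in> set xs \<Longrightarrow> x \<le> foldr max xs (0 :: nat)"
  by (induction xs) auto

text \<open>In a weakly decreasing list the entries above \<open>r\<close> form a prefix.\<close>

lemma less_length_filter:
  "sorted_wrt (\<ge>) xs \<Longrightarrow> k < length (filter (\<lambda>x. r < x) xs) \<longleftrightarrow> k < length xs \<and> (r :: nat) < xs ! k"
proof (induction xs arbitrary: k)
  case (Cons x xs)
  show ?case
  proof (cases "r < x")
    case True
    then show ?thesis using Cons by (cases k) auto
  next
    case False
    then have "\<not> r < y" if "y \<in> set xs" for y using Cons.prems that by force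
    then have "filter (\<lambda>x. r < x) (x # xs) = []" using False by (simp add: filter_empty_conv)
    moreover have "\<not> r < (x # xs) ! k" if "k < length (x # xs)"
      using that False \<open>\<And>y. y \<in> set xs \<Longrightarrow> \<not> r < y\<close> by (cases k) auto
    ultimately show ?thesis by auto
  qed
qed simp

lemma diagram_conjugate:
  assumes "sorted_wrt (\<ge>) lam"
  shows "(r, k) \<in> diagram (conjugate lam) \<longleftrightarrow> k < length lam \<and> r < lam ! k"
proof -
  have "r < foldr max lam 0" if "k < length lam" "r < lam ! k"
    using mem_le_foldr_max[of "lam ! k" lam] that by simp
  then show ?thesis
    using less_length_filter[OF assms, of k r] by (auto simp: diagram_def conjugate_def)
qed

lemma count_image_mset_set:
  assumes "finite A"
  shows "count (image_mset c (mset_set A)) k = card {i \<in> A. c i = k}"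
proof -
  have "count (image_mset c (mset_set A)) k = (\<Sum>x | x \<in> A \<and> k = c x. count (mset_set A) x)"
    by (simp only: count_image_mset' finite_set_mset_mset_set[OF assms])
  also have "\<dots> = (\<Sum>x | x \<in> A \<and> k = c x. 1)"
    by (rule sum.cong) (use assms in auto)
  also have "{x. x \<in> A \<and> k = c x} = {i \<in> A. c i = k}" by auto
  finally show ?thesis by simp
qed

text \<open>Equal letter counts mean equal multisets, and these differ by a permutation of
  positions. Membership in the orbit thereby becomes a condition on column lengths.\<close>

lemma words_iff:
  "c \<in> words n v \<longleftrightarrow> (\<forall>i. i \<notin> {1..n} \<longrightarrow> c i = v i) \<and>
    (\<forall>k. card {i \<in> {1..n}. c i = k} = card {i \<in> {1..n}. v i = k})"
proof
  assume c: "c \<in> words n v"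
  have "card {i \<in> {1..n}. c i = k} = card {i \<in> {1..n}. v i = k}" for k
    by (simp only: mset_words[OF c] count_image_mset_set[OF finite_atLeastAtMost, symmetric])
  moreover have "c i = v i" if "i \<notin> {1..n}" for i
    using c that by (auto simp: words_def permutes_not_in)
  ultimately show "(\<forall>i. i \<notin> {1..n} \<longrightarrow> c i = v i) \<and> (\<forall>k. card {i \<in> {1..n}. c i = k} = card {i \<in> {1..n}. v i = k})"
    by blast
next
  assume a: "(\<forall>i. i \<notin> {1..n} \<longrightarrow> c i = v i) \<and> (\<forall>k. card {i \<in> {1..n}. c i = k} = card {i \<in> {1..n}. v i = k})"
  then have "image_mset c (mset_set {1..n}) = image_mset v (mset_set {1..n})"
    using a by (intro multiset_eqI) (simp add: count_image_mset_set)
  then obtain p where p: "p permutes {1..n}" "\<forall>x\<in>{1..n}. c x = v (p x)"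
    using image_mset_eq_implies_permutes[of "{1..n}" c v] by auto
  have "c = v \<circ> p"
  proof
    fix i show "c i = (v \<circ> p) i"
      using a p permutes_not_in[OF p(1), of i] by (cases "i \<in> {1..n}") auto
  qed
  then show "c \<in> words n v" using p by (auto simp: words_def)
qed

section \<open>Column-strict tableaux as labellings of paths\<close>

locale star_net_partition = star_net +
  fixes lam :: "nat list"
  assumes partition: "is_partition lam n"
begin

abbreviation v0 :: "nat \<Rightarrow> nat" where "v0 \<equiv> block_index lam"

abbreviation mu :: "nat list" where "mu \<equiv> conjugate lam"

lemma diagram_mu: "(r, k) \<in> diagram mu \<longleftrightarrow> k < length lam \<and> r < lam ! k"
  using partition by (intro diagram_conjugate) (simp add: is_partition_def)

lemma words_v0_iff:
  "c \<in> words n v0 \<longleftrightarrow> (\<forall>i. i \<notin> {1..n} \<longrightarrow> c i = v0 i) \<and>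
    (\<forall>k. card {i \<in> {1..n}. c i = k} = (if k < length lam then lam ! k else 0))"
  unfolding words_iff using card_block[of lam] partition by (simp add: is_partition_def)

text \<open>The value \<open>v0 i\<close> off \<open>{1..n}\<close> is forced by membership in
  \<open>words n v0\<close>.\<close>

definition label :: "(nat \<times> nat \<Rightarrow> nat) \<Rightarrow> nat \<Rightarrow> nat" where
  "label U i = (if i \<in> {1..n} then THE k. in_column mu U i k else v0 i)"

text \<open>Column strictness makes columns increasing, so a labelling leaves only this
  filling.\<close>

definition tableau :: "(nat \<Rightarrow> nat) \<Rightarrow> nat \<times> nat \<Rightarrow> nat" where
  "tableau c = (\<lambda>(r, k)\<in>diagram mu. sorted_list_of_set {i \<in> {1..n}. c i = k} ! r)"

lemma tableauxD:
  assumes "U \<in> tableaux n mu"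
  shows "bij_betw U (diagram mu) {1..n}" "x \<notin> diagram mu \<Longrightarrow> U x = undefined"
  using assms by (auto simp: tableaux_def)

lemma label_cell:
  assumes "U \<in> tableaux n mu" "(r, k) \<in> diagram mu"
  shows "label U (U (r, k)) = k"
proof -
  note bij = tableauxD(1)[OF assms(1)]
  have "U (r, k) \<in> {1..n}" using bij assms(2) by (auto simp: bij_betw_def)
  moreover have "(THE l. in_column mu U (U (r, k)) l) = k"
  proof (rule the_equality)
    show "in_column mu U (U (r, k)) k" using assms(2) by (auto simp: in_column_def)
    show "l = k" if "in_column mu U (U (r, k)) l" for l
      using that assms(2) bij by (auto simp: in_column_def bij_betw_def dest: inj_onD)
  qed
  ultimately show ?thesis by (simp add: label_def)
qed

lemma in_column_iff:
  assumes "U \<in> tableaux n mu" "i \<in> {1..n}"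
  shows "in_column mu U i k \<longleftrightarrow> label U i = k"
proof -
  have "i \<in> U ` diagram mu" using tableauxD(1)[OF assms(1)] assms(2) by (simp add: bij_betw_def)
  then obtain r l where "(r, l) \<in> diagram mu" "i = U (r, l)" by auto
  then have l: "label U i = l" "in_column mu U i l"
    using label_cell[OF assms(1)] by (auto simp: in_column_def)
  have "label U i = k" if "in_column mu U i k"
    using that label_cell[OF assms(1)] by (auto simp: in_column_def)
  with l show ?thesis by blast
qed

lemma label_class:
  assumes "U \<in> tableaux n mu" "k < length lam"
  shows "{i \<in> {1..n}. label U i = k} = (\<lambda>r. U (r, k)) ` {..<lam ! k}"
proof (intro Set.set_eqI iffI)
  fix i assume "i \<in> {i \<in> {1..n}. label U i = k}"
  then have "in_column mu U i k" using in_column_iff[OF assms(1)] by blast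
  then show "i \<in> (\<lambda>r. U (r, k)) ` {..<lam ! k}" by (auto simp: in_column_def diagram_mu)
next
  fix i assume "i \<in> (\<lambda>r. U (r, k)) ` {..<lam ! k}"
  then obtain r where r: "i = U (r, k)" "(r, k) \<in> diagram mu" using assms(2) by (auto simp: diagram_mu)
  then have "i \<in> {1..n}" using tableauxD(1)[OF assms(1)] by (auto simp: bij_betw_def)
  then show "i \<in> {i \<in> {1..n}. label U i = k}" using label_cell[OF assms(1) r(2)] r(1) by simp
qed

lemma label_words:
  assumes U: "U \<in> tableaux n mu"
  shows "label U \<in> words n v0"
  unfolding words_v0_iff
proof (intro conjI allI impI)
  fix k
  show "card {i \<in> {1..n}. label U i = k} = (if k < length lam then lam ! k else 0)"
  proof (cases "k < length lam")
    case True
    have "inj_on (\<lambda>r. U (r, k)) {..<lam ! k}"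
    proof (rule inj_onI)
      fix r s assume "r \<in> {..<lam ! k}" "s \<in> {..<lam ! k}" "U (r, k) = U (s, k)"
      then show "r = s"
        using inj_onD[OF bij_betw_imp_inj_on[OF tableauxD(1)[OF U]], of "(r, k)" "(s, k)"] True
        by (simp add: diagram_mu)
    qed
    then show ?thesis using True by (simp only: label_class[OF U True] card_image) simp
  next
    case False
    then have "label U i \<noteq> k" if "i \<in> {1..n}" for i
      using in_column_iff[OF U that, of k] by (auto simp: in_column_def diagram_mu)
    then have "{i \<in> {1..n}. label U i = k} = {}" by blast
    then show ?thesis using False by simp
  qed
qed (simp only: label_def if_False)

lemma tableau_label:
  assumes U: "U \<in> tableaux n mu"
    and incr: "\<And>r s k. (r, k) \<in> diagram mu \<Longrightarrow> (s, k) \<in> diagram mu \<Longrightarrow> r < s \<Longrightarrow> U (r, k) < U (s, k)"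
  shows "tableau (label U) = U"
proof
  fix x :: "nat \<times> nat"
  obtain r k where x: "x = (r, k)" by fastforce
  show "tableau (label U) x = U x"
  proof (cases "x \<in> diagram mu")
    case True
    then have k: "k < length lam" "r < lam ! k" by (simp_all add: x diagram_mu)
    have "sorted_list_of_set {i \<in> {1..n}. label U i = k} = map (\<lambda>r. U (r, k)) [0..<lam ! k]"
    proof (rule strict_sorted_equal)
      show "sorted_wrt (<) (map (\<lambda>r. U (r, k)) [0..<lam ! k])"
        using incr k by (auto simp: sorted_wrt_iff_nth_less diagram_mu)
      show "set (sorted_list_of_set {i \<in> {1..n}. label U i = k}) = set (map (\<lambda>r. U (r, k)) [0..<lam ! k])"
        using label_class[OF U k(1)] by (simp add: atLeast0LessThan)
    qed simp
    then show ?thesis using True k by (simp add: x tableau_def)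
  qed (use tableauxD(2)[OF U] in \<open>simp add: tableau_def\<close>)
qed

lemma tableau_cell:
  assumes "c \<in> words n v0" "k < length lam" "r < lam ! k"
  shows "tableau c (r, k) = sorted_list_of_set {i \<in> {1..n}. c i = k} ! r"
    "r < length (sorted_list_of_set {i \<in> {1..n}. c i = k})"
    "tableau c (r, k) \<in> {i \<in> {1..n}. c i = k}"
proof -
  show l: "r < length (sorted_list_of_set {i \<in> {1..n}. c i = k})"
    using assms words_v0_iff[of c] by simp
  show eq: "tableau c (r, k) = sorted_list_of_set {i \<in> {1..n}. c i = k} ! r"
    using assms by (simp add: tableau_def diagram_mu)
  show "tableau c (r, k) \<in> {i \<in> {1..n}. c i = k}"
    using nth_mem[OF l] unfolding eq by simp
qed

lemma tableau_increasing:
  assumes "c \<in> words n v0" "k < length lam" "s < lam ! k" "r < s"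
  shows "tableau c (r, k) < tableau c (s, k)"
proof -
  have "r < lam ! k" using assms(3,4) by simp
  then show ?thesis
    using tableau_cell[OF assms(1,2)] assms(3,4)
      sorted_wrt_nth_less[OF strict_sorted_list_of_set, of r s "{i \<in> {1..n}. c i = k}"] by simp
qed

lemma tableau_tableaux:
  assumes c: "c \<in> words n v0"
  shows "tableau c \<in> tableaux n mu"
proof -
  have "inj_on (tableau c) (diagram mu)"
  proof (rule inj_onI)
    fix x y assume x: "x \<in> diagram mu" and y: "y \<in> diagram mu" and eq: "tableau c x = tableau c y"
    obtain r k s l where xy: "x = (r, k)" "y = (s, l)" by fastforce
    have k: "k < length lam" "r < lam ! k" "l < length lam" "s < lam ! l" using x y by (auto simp: xy diagram_mu)
    have "k = l"
      using tableau_cell(3)[OF c k(1,2)] tableau_cell(3)[OF c k(3,4)] eq by (simp add: xy)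
    moreover have "r = s"
      using tableau_increasing[OF c k(1), of r s] tableau_increasing[OF c k(1), of s r] k eq \<open>k = l\<close>
      by (cases r s rule: linorder_cases) (auto simp: xy)
    ultimately show "x = y" by (simp add: xy)
  qed
  moreover have "tableau c ` diagram mu = {1..n}"
  proof
    show "tableau c ` diagram mu \<subseteq> {1..n}"
      using tableau_cell(3)[OF c] by (auto simp: diagram_mu)
    show "{1..n} \<subseteq> tableau c ` diagram mu"
    proof
      fix i assume i: "i \<in> {1..n}"
      define k where "k = c i"
      have mem: "i \<in> {i \<in> {1..n}. c i = k}" using i by (simp add: k_def)
      then have "card {i \<in> {1..n}. c i = k} \<noteq> 0" by (auto simp: card_eq_0_iff)
      then have k: "k < length lam" "card {i \<in> {1..n}. c i = k} = lam ! k"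
        using c words_v0_iff[of c] by (auto split: if_splits)
      have "i \<in> set (sorted_list_of_set {i \<in> {1..n}. c i = k})" using mem by simp
      then obtain r where r: "r < length (sorted_list_of_set {i \<in> {1..n}. c i = k})"
        "sorted_list_of_set {i \<in> {1..n}. c i = k} ! r = i" by (meson in_set_conv_nth)
      then have "r < lam ! k" using k by simp
      then show "i \<in> tableau c ` diagram mu"
        using tableau_cell(1)[OF c k(1)] r k by (intro image_eqI[of _ _ "(r, k)"]) (auto simp: diagram_mu)
    qed
  qed
  ultimately show ?thesis
    by (auto simp: tableaux_def bij_betw_def tableau_def)
qed

lemma label_tableau:
  assumes c: "c \<in> words n v0"
  shows "label (tableau c) = c"
proof
  fix i
  note T = tableau_tableaux[OF c]
  show "label (tableau c) i = c i"
  proof (cases "i \<in> {1..n}")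
    case True
    then have "i \<in> tableau c ` diagram mu" using tableauxD(1)[OF T] by (simp add: bij_betw_def)
    then obtain r k where rk: "(r, k) \<in> diagram mu" "i = tableau c (r, k)" by auto
    then have "c i = k" using tableau_cell(3)[OF c, of k r] by (simp add: diagram_mu)
    then show ?thesis using label_cell[OF T rk(1)] rk(2) by simp
  next
    case False
    then have "c i = v0 i" using c words_v0_iff[of c] by blast
    then show ?thesis unfolding label_def if_not_P[OF False] by (rule sym)
  qed
qed

lemma entirely_below_less:
  assumes "ts \<in> closed_lists" "i \<in> {1..n}" "j \<in> {1..n}" "entirely_below (family ts) i j"
  shows "i < j"
proof -
  have "Bnd 0 i \<in> path_vertices (family ts) i" "Bnd 0 j \<in> path_vertices (family ts) j"
    using assms family_path_vertices by force+
  then show ?thesis using assms(4) by (auto simp: entirely_below_def)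
qed

text \<open>Equal labels inside one interval would put two paths of a column through the same
  central vertex, while paths of a column are disjoint.\<close>

lemma column_strict_chain_ok:
  assumes ts: "ts \<in> closed_lists" and U: "U \<in> column_strict_tableaux n (family ts) mu"
  shows "chain_ok Js ts (label U)"
  unfolding chain_ok_def
proof (intro allI impI)
  fix p assume p: "p < m"
  note tp = closed_listsD(1)[OF ts]
  have Ut: "U \<in> tableaux n mu" using U by (simp add: column_strict_tableaux_def)
  show "inj_on (label U \<circ> prefix_comp ts p) {fst (Js ! p)..snd (Js ! p)}"
  proof (rule inj_onI, rule ccontr)
    fix x y assume x: "x \<in> {fst (Js ! p)..snd (Js ! p)}" and y: "y \<in> {fst (Js ! p)..snd (Js ! p)}"
      and eq: "(label U \<circ> prefix_comp ts p) x = (label U \<circ> prefix_comp ts p) y" and ne: "x \<noteq> y"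
    define i j where "i = prefix_comp ts p x" and "j = prefix_comp ts p y"
    \<comment> \<open>Two different points rule out a one-point interval, so the central vertex
      exists.\<close>
    have "fst (Js ! p) < snd (Js ! p)" using x y ne by auto
    then have I: "I p = {fst (Js ! p)..snd (Js ! p)}" by (simp add: centre_interval_def)
    have pos: "pos ts p i = x" "pos ts p j = y"
      using pos_prefix_comp[OF tp, of p] p by (simp_all add: i_def j_def)
    have ij: "i \<in> {1..n}" "j \<in> {1..n}"
      using pos_in_range[OF tp p] pos x y I by auto
    have "Ctr p \<in> path_vertices (family ts) i" "Ctr p \<in> path_vertices (family ts) j"
      using family_path_vertices[OF ts] ij p pos x y I by auto
    then have meet: "path_vertices (family ts) i \<inter> path_vertices (family ts) j \<noteq> {}" by blast
    have "in_column mu U i (label U i)" "in_column mu U j (label U i)"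
      using in_column_iff[OF Ut] ij eq by (auto simp: i_def j_def)
    then obtain r s where rs: "(r, label U i) \<in> diagram mu" "U (r, label U i) = i"
      "(s, label U i) \<in> diagram mu" "U (s, label U i) = j" by (auto simp: in_column_def)
    have "i \<noteq> j" using pos ne by auto
    then have "r \<noteq> s" using rs by auto
    moreover have "entirely_below (family ts) (U (r, k)) (U (s, k))"
      if "(r, k) \<in> diagram mu" "(s, k) \<in> diagram mu" "r < s" for r s k
      using U that by (simp add: column_strict_tableaux_def)
    ultimately have "entirely_below (family ts) i j \<or> entirely_below (family ts) j i"
      using rs by (metis linorder_neqE_nat)
    then show False using meet by (auto simp: entirely_below_def)
  qed
qed

text \<open>\<open>order_kept\<close> compares the heights of two paths of a column at every level,
  and \<open>labels_distinct\<close> keeps them from a common centre; these are the two halves of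
  \<open>entirely_below\<close>.\<close>

lemma tableau_column_strict:
  assumes ts: "ts \<in> closed_lists" and c: "c \<in> words n v0" and ok: "chain_ok Js ts c"
  shows "tableau c \<in> column_strict_tableaux n (family ts) mu"
proof -
  note tp = closed_listsD(1)[OF ts]
  have "entirely_below (family ts) (tableau c (r, k)) (tableau c (s, k))"
    if rk: "(r, k) \<in> diagram mu" "(s, k) \<in> diagram mu" "r < s" for r s k
  proof -
    define i j where "i = tableau c (r, k)" and "j = tableau c (s, k)"
    have k: "k < length lam" "r < lam ! k" "s < lam ! k" using rk by (auto simp: diagram_mu)
    have ij: "i \<in> {1..n}" "j \<in> {1..n}" "c i = c j"
      using tableau_cell(3)[OF c k(1)] k(2,3) by (auto simp: i_def j_def)
    have "i < j" unfolding i_def j_def by (rule tableau_increasing[OF c k(1,3) rk(3)])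
    then have less: "pos ts p i < pos ts p j" if "p \<le> m" for p
      by (rule order_kept[OF tp ok _ ij(3) that])
    have "\<not> (pos ts p i \<in> I p \<and> pos ts p j \<in> I p)" if p: "p < m" for p
    proof
      assume "pos ts p i \<in> I p \<and> pos ts p j \<in> I p"
      then have "i = j"
        using I_subset_interval[of p] by (intro labels_distinct[OF tp ok p ij(3)]) auto
      then show False using \<open>i < j\<close> by simp
    qed
    then have "entirely_below (family ts) i j"
      using less unfolding entirely_below_def family_path_vertices[OF ts ij(1)] family_path_vertices[OF ts ij(2)]
      by fastforce
    then show ?thesis by (simp add: i_def j_def)
  qed
  then show ?thesis using tableau_tableaux[OF c] by (auto simp: column_strict_tableaux_def)
qed

lemma bij_betw_label:
  assumes ts: "ts \<in> closed_lists"
  shows "bij_betw label (column_strict_tableaux n (family ts) mu) {c \<in> words n v0. chain_ok Js ts c}"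
proof (rule bij_betw_byWitness[where f' = tableau])
  show "\<forall>U\<in>column_strict_tableaux n (family ts) mu. tableau (label U) = U"
  proof
    fix U assume U: "U \<in> column_strict_tableaux n (family ts) mu"
    then have Ut: "U \<in> tableaux n mu" by (simp add: column_strict_tableaux_def)
    have "U x \<in> {1..n}" if "x \<in> diagram mu" for x
      using tableauxD(1)[OF Ut] that by (auto simp: bij_betw_def)
    then show "tableau (label U) = U"
      using U entirely_below_less[OF ts]
      by (intro tableau_label[OF Ut]) (auto simp: column_strict_tableaux_def simp del: atLeastAtMost_iff)
  qed
  show "label ` column_strict_tableaux n (family ts) mu \<subseteq> {c \<in> words n v0. chain_ok Js ts c}"
    using column_strict_chain_ok[OF ts] label_words by (auto simp: column_strict_tableaux_def)
qed (use label_tableau tableau_column_strict[OF ts] in auto)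

text \<open>The column of an entry is its label, so inverted noncrossings become the label
  inversions counted in \<open>chain_weight_eq\<close>.\<close>

lemma invnc_label:
  assumes "U \<in> tableaux n mu"
  shows "invnc n Js \<pi> mu U = card {(i, j, p) \<in> noncrossings n Js \<pi>. label U j < label U i}"
proof -
  have "(\<exists>k l. in_column mu U j k \<and> in_column mu U i l \<and> k < l) \<longleftrightarrow> label U j < label U i"
    if "(i, j, p) \<in> noncrossings n Js \<pi>" for i j p
  proof -
    have ij: "i \<in> {1..n}" "j \<in> {1..n}" using that unfolding noncrossings_def by blast+
    show ?thesis unfolding in_column_iff[OF assms ij(1)] in_column_iff[OF assms ij(2)] by blast
  qed
  then have "{(i, j, p) \<in> noncrossings n Js \<pi>. \<exists>k l. in_column mu U j k \<and> in_column mu U i l \<and> k < l}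
     = {(i, j, p) \<in> noncrossings n Js \<pi>. label U j < label U i}" by blast
  then show ?thesis by (simp add: invnc_def)
qed

sublocale sign_induction n lam v0
  by unfold_locales (use block_index_mono block_index_cut in auto)

text \<open>Both sides become sums over closed lists and labellings, through
  \<open>bij_betw_family\<close> and \<open>bij_betw_label\<close>; \<open>q_var\<close> is the
  square of \<open>q_half\<close>, matching the factor \<open>2\<close> in
  \<open>chain_weight_eq\<close>.\<close>

lemma sum_families:
  "(\<Sum>\<pi> \<in> {\<pi> \<in> path_families n Js id. covers n Js \<pi>}.
      q_half ^ cr n Js \<pi> * (\<Sum>W \<in> column_strict_tableaux n \<pi> mu. q_var ^ invnc n Js \<pi> mu W))
    = (\<Sum>c\<in>words n v0. foldr (interval_op n) Js (delta c) c)"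
proof -
  have "(\<Sum>W \<in> column_strict_tableaux n (family ts) mu. q_half ^ cr n Js (family ts) * q_var ^ invnc n Js (family ts) mu W)
      = (\<Sum>c\<in>{c \<in> words n v0. chain_ok Js ts c}. q_half ^ chain_weight Js ts c)" if ts: "ts \<in> closed_lists" for ts
  proof -
    have "q_half ^ cr n Js (family ts) * q_var ^ invnc n Js (family ts) mu W = q_half ^ chain_weight Js ts (label W)"
      if W: "W \<in> column_strict_tableaux n (family ts) mu" for W
    proof -
      have "W \<in> tableaux n mu" using W by (simp add: column_strict_tableaux_def)
      then show ?thesis
        unfolding chain_weight_eq[OF ts column_strict_chain_ok[OF ts W]]
        by (simp add: invnc_label q_var_def power_add power_mult)
    qed
    then have "(\<Sum>W \<in> column_strict_tableaux n (family ts) mu. q_half ^ cr n Js (family ts) * q_var ^ invnc n Js (family ts) mu W)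
        = (\<Sum>W \<in> column_strict_tableaux n (family ts) mu. q_half ^ chain_weight Js ts (label W))"
      by (rule sum.cong[OF refl])
    also have "\<dots> = (\<Sum>c\<in>{c \<in> words n v0. chain_ok Js ts c}. q_half ^ chain_weight Js ts c)"
      by (rule sum.reindex_bij_betw[OF bij_betw_label[OF ts]])
    finally show ?thesis .
  qed
  then show ?thesis
    unfolding sum_interval_op_delta sum_distrib_left sum.reindex_bij_betw[OF bij_betw_family, symmetric]
    by (rule sum.cong[OF refl])
qed

end

theorem theorem6p5:
  fixes n :: nat and Js :: "(nat \<times> nat) list" and lam :: "nat list"
  assumes "n \<ge> 1"
    and "\<forall>J \<in> set Js. 1 \<le> fst J \<and> fst J \<le> snd J \<and> snd J \<le> n"
    and "is_partition lam n"
  shows "induced_sign_character n lam (hecke_prod n (map (C_tilde n) Js)) =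
    (\<Sum>\<pi> \<in> {\<pi> \<in> path_families n Js id. covers n Js \<pi>}.
       q_half ^ cr n Js \<pi> *
       (\<Sum>W \<in> column_strict_tableaux n \<pi> (conjugate lam).
          q_var ^ invnc n Js \<pi> (conjugate lam) W))"
proof -
  interpret star_net_partition n Js lam
    by unfold_locales (use assms in auto)
  have prod: "hecke_prod n (map (C_tilde n) Js) = hproj n (prod_list (map (C_free n) Js))"
    "prod_list (map (C_free n) Js) \<in> free_carrier n"
    using hecke_prod_eq[of Js n] assms(2) by auto
  show ?thesis
    unfolding prod(1) induced_sign_character_eq[OF prod(2)] ract_prod_C_free sum_families ..
qed

end
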